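(* The $m$-th order cardinal $B$-spline wavelet $\psi_m$, $m\ge 2$, has the asymptotic form $$\psi_m(x)=\left[\sum_{x-m\le j\le x}(-1)^{r_j}E_j\,\frac{e^{-\alpha_0 r_j}}{\sqrt{r_j}}\,N_m(x-j)\right][1+o(1)]\qquad\text{as } |x|\to\infty,$$ in which $r_j=\left[\frac{|j|}{2}\right]$ and $E_j$ depends only on the sign and parity of $j\in\mathbb Z$. The constant $\alpha_0$ is given by $$\alpha_0=\ln\left[\frac{\sqrt{\mu_{m-1}+1}+\sqrt{\mu_{m-1}}}{\sqrt{\mu_{m-1}+1}-\sqrt{\mu_{m-1}}}\right],\qquad\text{where}\qquad \mu_{m-1}=\frac{(\lambda_{m-1}+1)^2}{4|\lambda_{m-1}|}$$ and $\lambda_{m-1}$ is the $(m-1)$-st smallest (in absolute value) negative root of the Euler-Frobenius polynomial of degree $2m-2$.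
   Context: $[t]$ denotes the integer part of $t\ge 0$ in the definition of $r_j$; the sum in the claim is over integers $j$. Cardinal $B$-splines: $N_1=\chi_{[0,1)}$ and $N_m(x)=\int_0^1 N_{m-1}(x-y)\,dy$ for $m\ge2$; $N_m$ is supported in $[0,m]$. Fourier transform: $\widehat f(\lambda)=\frac1{\sqrt{2\pi}}\int_{\mathbb R}f(t)e^{-i\lambda t}\,dt$. The polynomial $P_m$ satisfies $P_m\left(\cos\frac\theta2\right)=2\pi\sum_{j\in\mathbb Z}|\widehat{N_m}(\theta+2\pi j)|^2$. Scaling function: $\varphi_m(x)=\sum_{j\in\mathbb Z}c_jN_m(x-j)$ with $c_j=\frac1{2\pi}\int_{-\pi}^{\pi}\frac{\cos j\theta}{\sqrt{P_m(\cos\frac\theta2)}}\,d\theta$; then $\{\varphi_m(x-j)\}_{j\in\mathbb Z}$ is an orthonormal system. The scaling constants $a_j$ of $\varphi_m$ are the constants in the relation $\varphi_m(x)=\sum_{j\in\mathbb Z}a_j\varphi_m(2x-j)$, and the wavelet is $\psi_m(x)=\sum_{j\in\mathbb Z}(-1)^ja_{1-j}\varphi_m(2x-j)$. Euler-Frobenius polynomial of degree $2m-2$: $E_{2m-1}(z)=(2m-1)!\,z^{m-1}\sum_{k=-m+1}^{m-1}N_{2m}(m+k)z^k$. It has $2m-2$ simple negative real roots $0>\lambda_1>\lambda_2>\dots>\lambda_{2m-2}$, with $\lambda_1\lambda_{2m-2}=\dots=\lambda_{m-1}\lambda_m=1$.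
   Formalization: With the stated definitions the printed formula fails by a dilation: N_m(x-j) and x-m≤j≤x are replaced by N_m(2x-j) and 2x-m≤j≤2x. The factor 1+o(1) multiplies each summand, uniformly in j, since a common factor would force ψ_m and the bracket to share zeros. *)

theory Defs
  imports "HOL-Analysis.Analysis" "HOL-Computational_Algebra.Polynomial"
begin

(* The index is the order; order 0 is a dummy value. *)
fun bspline :: "nat \<Rightarrow> real \<Rightarrow> real" where
  "bspline 0 x = 0"
| "bspline (Suc 0) x = indicat_real {0..<1} x"
| "bspline (Suc (Suc n)) x = integral {0..1} (\<lambda>y. bspline (Suc n) (x - y))"

definition fourier :: "(real \<Rightarrow> real) \<Rightarrow> real \<Rightarrow> complex" where
  "fourier f \<xi> = of_real (1 / sqrt (2 * pi)) *
     (LINT t|lborel. of_real (f t) * exp (- \<i> * of_real \<xi> * of_real t))"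

(* Unique, because cos (\<theta> / 2) runs through all of [-1, 1]. *)
definition bspline_P :: "nat \<Rightarrow> real poly" where
  "bspline_P m = (THE p. \<forall>\<theta>. poly p (cos (\<theta> / 2)) =
     2 * pi * (\<Sum>\<^sub>\<infinity>j\<in>(UNIV::int set). (norm (fourier (bspline m) (\<theta> + 2 * pi * of_int j)))\<^sup>2))"

definition scaling_coeff :: "nat \<Rightarrow> int \<Rightarrow> real" where
  "scaling_coeff m j = 1 / (2 * pi) *
     integral {-pi..pi} (\<lambda>\<theta>. cos (of_int j * \<theta>) / sqrt (poly (bspline_P m) (cos (\<theta> / 2))))"

definition scaling_fun :: "nat \<Rightarrow> real \<Rightarrow> real" where
  "scaling_fun m x = (\<Sum>\<^sub>\<infinity>j\<in>(UNIV::int set). scaling_coeff m j * bspline m (x - of_int j))"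

(* The translates of the scaling function are orthonormal, so its two-scale relation is
   an expansion with square-summable coefficients; in that class they are unique. *)
definition scaling_const :: "nat \<Rightarrow> int \<Rightarrow> real" where
  "scaling_const m = (THE a. (\<lambda>j. (a j)\<^sup>2) summable_on UNIV \<and>
     (\<forall>x. ((\<lambda>j. a j * scaling_fun m (2 * x - of_int j)) has_sum scaling_fun m x) UNIV))"

definition wavelet :: "nat \<Rightarrow> real \<Rightarrow> real" where
  "wavelet m x = (\<Sum>\<^sub>\<infinity>j\<in>(UNIV::int set).
     (- 1) powi j * scaling_const m (1 - j) * scaling_fun m (2 * x - of_int j))"

(* The polynomial E_{2m-1}, of degree 2m-2. *)
definition euler_frobenius :: "nat \<Rightarrow> real poly" where
  "euler_frobenius m = smult (fact (2 * m - 1))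
     (\<Sum>k = - int m + 1..int m - 1.
        monom (bspline (2 * m) (of_int (int m + k))) (nat (int m - 1 + k)))"

(* lam 1 > lam 2 > ... > lam (2m-2) are the roots of E_{2m-1}, all of them negative.
   Since the degree is 2m-2, this determines lam on {1..2m-2} and makes the roots simple. *)
definition euler_frobenius_roots :: "nat \<Rightarrow> (nat \<Rightarrow> real) \<Rightarrow> bool" where
  "euler_frobenius_roots m lam \<longleftrightarrow>
     (\<forall>k\<in>{1..2 * m - 2}. lam k < 0 \<and> poly (euler_frobenius m) (lam k) = 0) \<and>
     strict_antimono_on {1..2 * m - 2} lam"

definition root_mu :: "real \<Rightarrow> real" where
  "root_mu l = (l + 1)\<^sup>2 / (4 * \<bar>l\<bar>)"

definition decay_alpha :: "real \<Rightarrow> real" where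
  "decay_alpha l = ln ((sqrt (root_mu l + 1) + sqrt (root_mu l)) /
                       (sqrt (root_mu l + 1) - sqrt (root_mu l)))"

definition half_index :: "int \<Rightarrow> nat" where
  "half_index j = nat \<lfloor>real_of_int \<bar>j\<bar> / 2\<rfloor>"

end

(* Let z = exp(-i theta) and let P(z) be the symbol of the integer samples of N_{2m}. Termwise
   differentiation of the partial fraction expansion of 1/sin^2 (in terms of polygamma functions)
   identifies 2 pi sum_j |N_m^(theta + 2 pi j)|^2 with P(z), and the Euler--Frobenius roots give
   P(z) = c prod_k (1 + t_k/z)(1 + t_k z) with 0 < t_k < 1. The coefficients of the scaling function,
   of its two-scale relation and of the wavelet in terms of B-splines are therefore the Laurent
   coefficients of explicit products of binomial series. The wavelet symbol is a multiple of
   z^{1-m} (z-1)^m sqrt(P(-z)) / (sqrt(P(z)) sqrt(P(z^2))). The factor P(z^2) produces the dominant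
   singularities, z = +-i/s with s^2 = t_{m-1} = exp(-alpha_0), of type (1 + s^2 z^2)^{-1/2}; hence the
   decay s^{2r}/sqrt r and the sign (-1)^r, and a constant for each parity: up to a positive factor,
   the real and the imaginary part of the remaining factor at i/s. The symmetry z -> 1/z gives the
   negative indices.

   These constants must not vanish. By the two-scale relation of P, the sign of P(-u^2) is that of
   cos(2 m delta + Sigma), where delta = pi/4 - arctan u and Sigma = -arg P(iu). This angle starts
   at 0 for u = 1 and first reaches pi/2 at u = s, so 0 < m delta < pi/4 there, and the phase of the
   factor at i/s, which is (m-2) pi/4 + m delta modulo pi/2, is not a multiple of pi/2. *)

theory Submission
  imports Defs "HOL-Real_Asymp.Real_Asymp"
begin

section \<open>Cardinal B-splines\<close>

text \<open>Two obstacles shape the development. First, the constants a_j are specified only through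
  the two-scale relation within the square-summable class, so uniqueness has to be shown before a
  symbol can be attributed to them. The difference of two solutions is merely known to be bounded;
  convolved with the scaling coefficients it gives a spline that vanishes identically. B-splines of
  order at least 2 are linearly independent for arbitrary coefficients, and the absolutely summable
  coefficients of P^(1/2) undo the convolution. This is why \<open>spline_conv\<close> and
  \<open>conv_assoc_bounded\<close> accept bounded sequences. Second, a power of P at a complex
  point depends on a branch. Powers are taken factor by factor, each factor lying in the unit disc
  about 1, and the phases of the factors are added as real numbers. The link between phase and decay
  rate is that P(-u^2) is positive for s < u <= 1 and vanishes at u = s. Since the wavelet is a
  spline in the variable 2x, the asymptotic form is stated with N_m(2x - j). The formula for
  \<open>\<alpha>\<^sub>0\<close> is an algebraic disguise of exp(-alpha_0) =
  |lambda_{m-1}|.\<close>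

lemma bspline_1_eq: "bspline (Suc 0) = indicat_real {0..<1}"
  by (auto simp: fun_eq_iff)

lemma bspline_Suc_integral:
  assumes "n \<ge> 1"
  shows "bspline (Suc n) x = integral {x - 1..x} (bspline n)"
proof -
  obtain k where k: "n = Suc k" using assms by (cases n) auto
  have "bspline (Suc n) x = integral {0..1} (\<lambda>y. bspline n (x - y))" by (simp add: k)
  also have "\<dots> = integral {-1..0} (\<lambda>u. bspline n (u + x))"
    using Henstock_Kurzweil_Integration.integral_reflect_real[of 0 "-1" "\<lambda>u. bspline n (u + x)"] by (simp add: algebra_simps)
  also have "\<dots> = integral {x - 1..x} (bspline n)"
    using integral_shift_real_ivl[of "x - 1" x x "bspline n"] by (simp add: algebra_simps)
  finally show ?thesis .
qed

declare bspline.simps(3) [simp del]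

lemma bspline_1_integrable: "bspline (Suc 0) integrable_on {a..b}"
proof -
  show ?thesis
    unfolding bspline_1_eq integrable_on_indicator
    by (intro bounded_set_imp_lmeasurable) (auto intro: bounded_subset[OF bounded_closed_interval[of a b]])
qed

text \<open>With a fixed base point \<open>a\<close> the variable enters only through upper limits
  of one indefinite integral, so continuity and differentiability in \<open>x\<close> can be read
  off.\<close>

lemma bspline_Suc_diff:
  assumes "n \<ge> 1" "\<And>a b. bspline n integrable_on {a..b}" "a + 1 \<le> x"
  shows "bspline (Suc n) x = integral {a..x} (bspline n) - integral {a..x - 1} (bspline n)"
proof -
  have "integral {a..x - 1} (bspline n) + integral {x - 1..x} (bspline n) = integral {a..x} (bspline n)"
    using assms by (intro Henstock_Kurzweil_Integration.integral_combine) auto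
  then show ?thesis using bspline_Suc_integral[OF assms(1)] by simp
qed

lemma bspline_Suc_isCont:
  assumes "n \<ge> 1" and int: "\<And>a b. bspline n integrable_on {a..b}"
  shows "isCont (bspline (Suc n)) x"
proof -
  define a where "a = x - 3"
  define J where "J = (\<lambda>y. integral {a..y} (bspline n))"
  have J: "continuous_on {a..x+2} J" unfolding J_def
    by (intro indefinite_integral_continuous_1 int)
  have "isCont J y" if "y \<in> {a<..<x+2}" for y
    by (rule continuous_on_interior[OF J]) (use that in auto)
  then have "isCont J x" "isCont J (x - 1)" by (auto simp: a_def)
  then have "isCont (\<lambda>y. J y - J (y - 1)) x"
    by (intro continuous_intros) (auto intro!: continuous_intros isCont_o2[where f="\<lambda>y. y - 1" and g=J])
  moreover have "\<forall>\<^sub>F y in nhds x. bspline (Suc n) y = J y - J (y - 1)"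
  proof -
    have "\<forall>\<^sub>F y in nhds x. y \<in> {a+1<..}"
      by (intro eventually_nhds_in_open) (auto simp: a_def)
    then show ?thesis
      by eventually_elim (use bspline_Suc_diff[OF assms, of a] in \<open>auto simp: J_def\<close>)
  qed
  ultimately show ?thesis by (simp add: isCont_cong)
qed

lemma bspline_integrable_on: "bspline n integrable_on {a..b}"
proof (induction n arbitrary: a b)
  case 0
  have "bspline 0 = (\<lambda>_. 0)" by auto
  then show ?case by (metis integrable_0)
next
  case (Suc n)
  show ?case
  proof (cases "n = 0")
    case True
    then show ?thesis using bspline_1_integrable by metis
  next
    case False
    then show ?thesis
      by (intro integrable_continuous_interval continuous_at_imp_continuous_on ballI bspline_Suc_isCont Suc) auto
  qed
qed

lemma bspline_isCont: "n \<ge> 2 \<Longrightarrow> isCont (bspline n) x"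
  using bspline_Suc_isCont[of "n - 1"] bspline_integrable_on by (cases n) auto

lemma bspline_continuous_on: "n \<ge> 2 \<Longrightarrow> continuous_on A (bspline n)"
  by (intro continuous_at_imp_continuous_on ballI bspline_isCont)

lemma bspline_measurable [measurable]: "bspline n \<in> borel_measurable borel"
proof -
  consider "n = 0" | "n = Suc 0" | "n \<ge> 2" by linarith
  then show ?thesis
  proof cases
    case 2
    then show ?thesis by (simp add: bspline_1_eq)
  qed (auto simp: bspline.simps(1)[abs_def] intro!: borel_measurable_continuous_onI bspline_continuous_on)
qed

lemma bspline_nonneg: "bspline n x \<ge> 0" and bspline_le_1: "bspline n x \<le> 1"
proof (induction n arbitrary: x)
  case (Suc n)
  case 1
  show ?case
  proof (cases "n = 0")
    case False
    then show ?thesis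
      by (subst bspline_Suc_integral) (auto intro!: integral_nonneg bspline_integrable_on Suc)
  qed auto
  case 2
  show ?case
  proof (cases "n = 0")
    case False
    then have "bspline (Suc n) x = integral {x-1..x} (bspline n)"
      by (subst bspline_Suc_integral) auto
    also have "\<dots> \<le> integral {x-1..x} (\<lambda>_. 1)"
      by (intro Henstock_Kurzweil_Integration.integral_le bspline_integrable_on) (auto simp: Suc)
    finally have "bspline (Suc n) x \<le> integral {x-1..x} (\<lambda>_. 1)" .
    then show ?thesis by simp
  qed (auto simp: indicator_def)
qed auto

lemma bspline_eq_0_right: "x \<ge> real n \<Longrightarrow> bspline n x = 0"
proof (induction n arbitrary: x)
  case (Suc n)
  show ?case
  proof (cases "n = 0")
    case False
    then have "bspline (Suc n) x = integral {x-1..x} (bspline n)"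
      by (subst bspline_Suc_integral) auto
    also have "\<dots> = integral {x-1..x} (\<lambda>_. 0)"
      by (intro Henstock_Kurzweil_Integration.integral_cong) (use Suc in auto)
    finally have "bspline (Suc n) x = integral {x-1..x} (\<lambda>_. 0::real)" .
    then show ?thesis by simp
  qed (use Suc in \<open>auto simp: indicator_def\<close>)
qed auto

lemma bspline_eq_0_left: "x < 0 \<Longrightarrow> bspline n x = 0"
proof (induction n arbitrary: x)
  case (Suc n)
  show ?case
  proof (cases "n = 0")
    case False
    then have "bspline (Suc n) x = integral {x-1..x} (bspline n)"
      by (subst bspline_Suc_integral) auto
    also have "\<dots> = integral {x-1..x} (\<lambda>_. 0)"
      by (intro Henstock_Kurzweil_Integration.integral_cong) (use Suc in auto)
    finally have "bspline (Suc n) x = integral {x-1..x} (\<lambda>_. 0::real)" .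
    then show ?thesis by simp
  qed (use Suc in \<open>auto simp: indicator_def\<close>)
qed auto

lemma bspline_at_0:
  assumes "n \<ge> 2" shows "bspline n 0 = 0"
proof -
  have "(bspline n \<longlongrightarrow> bspline n 0) (at_left 0)"
    using bspline_isCont[OF assms, of 0] by (auto simp: isCont_def intro: tendsto_within_subset)
  moreover have "(bspline n \<longlongrightarrow> 0) (at_left 0)"
    by (rule tendsto_eventually) (auto simp: eventually_at_filter bspline_eq_0_left)
  ultimately show ?thesis using tendsto_unique trivial_limit_at_left_real by blast
qed

lemma bspline_eq_0_left': "n \<ge> 2 \<Longrightarrow> x \<le> 0 \<Longrightarrow> bspline n x = 0"
  using bspline_at_0 bspline_eq_0_left by (cases "x = 0") auto

text \<open>For \<open>n = 1\<close> the integrand jumps at 0 and 1, and it is evaluated at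
  \<open>x\<close> and at \<open>x - 1\<close>; this is the origin of the exceptional points 0, 1,
  2.\<close>

lemma bspline_has_derivative:
  assumes "n \<ge> 1" "n \<ge> 2 \<or> x \<notin> {0,1,2}"
  shows "(bspline (Suc n) has_real_derivative bspline n x - bspline n (x - 1)) (at x)"
proof -
  define a where "a = x - 3"
  define J where "J = (\<lambda>y. integral {a..y} (bspline n))"
  have c: "isCont (bspline n) y" if "n \<ge> 2 \<or> y \<notin> {0,1}" for y
  proof (cases "n \<ge> 2")
    case False
    then have n: "n = Suc 0" and y: "y \<notin> {0,1}" using assms that by auto
    have "isCont (indicat_real {0..<1}) y"
      using y by (intro isCont_indicator[THEN iffD2]) (auto simp: frontier_def)
    then show ?thesis by (simp add: n bspline_1_eq)
  qed (rule bspline_isCont)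
  have J: "(J has_real_derivative bspline n y) (at y)"
    if "n \<ge> 2 \<or> y \<notin> {0,1}" "y \<in> {a<..<x+2}" for y
  proof -
    have "(J has_vector_derivative bspline n y) (at y within {a..x+2} - {})" unfolding J_def
      by (intro integral_has_vector_derivative_continuous_at bspline_integrable_on)
         (use that c in \<open>auto intro: continuous_within_subset\<close>)
    moreover have "at y within {a..x+2} = at y" using that
      by (intro at_within_interior) auto
    ultimately show ?thesis by (simp add: has_real_derivative_iff_has_vector_derivative)
  qed
  have "(J has_real_derivative bspline n x) (at x)" "(J has_real_derivative bspline n (x - 1)) (at (x - 1))"
    by (rule J; use assms in \<open>auto simp: a_def\<close>)+
  note J1 = this(1) and J2 = DERIV_chain2[where g="\<lambda>y. y - 1" and Db=1 and x=x, OF this(2)]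
  have "((\<lambda>y. J y - J (y - 1)) has_real_derivative bspline n x - bspline n (x - 1) * 1) (at x)"
    by (intro DERIV_diff J1 J2) (auto intro!: derivative_eq_intros)
  moreover have "\<forall>\<^sub>F y in nhds x. bspline (Suc n) y = J y - J (y - 1)"
  proof -
    have "\<forall>\<^sub>F y in nhds x. y \<in> {a+1<..}"
      by (intro eventually_nhds_in_open) (auto simp: a_def)
    then show ?thesis
      by eventually_elim (use bspline_Suc_diff[OF assms(1) bspline_integrable_on, of a] in \<open>auto simp: J_def\<close>)
  qed
  ultimately show ?thesis by (subst DERIV_cong_ev) auto
qed

lemma bspline_2: "bspline 2 x = (if x \<in> {0..1} then x else if x \<in> {1..2} then 2 - x else 0)"
proof -
  have "bspline 2 x = integral {x-1..x} (indicat_real {0..<1})"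
    using bspline_Suc_integral[of 1 x] by (simp add: numeral_2_eq_2 bspline.simps(2)[abs_def])
  also have "\<dots> = measure lebesgue ({0..<1} \<inter> {x-1..x})"
    by (rule Equivalence_Lebesgue_Henstock_Integration.integral_indicator)
       (intro bounded_set_imp_lmeasurable, auto intro: bounded_subset[OF bounded_closed_interval[of "x - 1" x]])
  also have "\<dots> = (if x \<in> {0..1} then x else if x \<in> {1..2} then 2 - x else 0)"
  proof -
    consider "x < 0" | "x \<in> {0..<1}" | "x \<in> {1..<2}" | "x \<ge> 2"
      by (meson atLeastLessThan_iff not_less)
    then show ?thesis
    proof cases
      case 2
      then have "{0..<1} \<inter> {x-1..x} = {0..x}" by auto
      then show ?thesis using 2 by simp
    next
      case 3
      then have "{0..<1} \<inter> {x-1..x} = {x-1..<1}" by auto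
      then show ?thesis using 3 by simp
    next
      case 1
      then have "{0..<1} \<inter> {x-1..x} = {}" by auto
      then show ?thesis using 1 by simp
    next
      case 4
      then have "{0..<1} \<inter> {x-1..x} = {}" by auto
      then show ?thesis using 4 by simp
    qed
  qed
  finally show ?thesis .
qed

text \<open>The difference of the two sides is continuous, vanishes on the negative axis and has
  derivative 0 off finitely many points, hence is 0.\<close>

lemma bspline_recurrence:
  assumes "n \<ge> 1"
  shows "real n * bspline (Suc n) x = x * bspline n x + (real (Suc n) - x) * bspline n (x - 1)"
  using assms
proof (induction n arbitrary: x rule: dec_induct)
  case base
  show ?case using bspline_2[of x]
    by (auto simp: numeral_2_eq_2 indicator_def)
next
  case (step n)
  define f where "f = (\<lambda>x. real (Suc n) * bspline (Suc (Suc n)) x - (x * bspline (Suc n) x + (real (Suc (Suc n)) - x) * bspline (Suc n) (x - 1)))"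
  have cont: "continuous_on A f" for A unfolding f_def
    by (intro continuous_intros bspline_continuous_on[of "Suc (Suc n)"] bspline_continuous_on[of "Suc n"] 
         continuous_on_compose2[OF bspline_continuous_on[of "Suc n" UNIV]])
       (use step in auto)
  \<comment> \<open>The derivative formula is applied at \<open>y\<close> and at
    \<open>y - 1\<close>; for order 2 this excludes 0, 1, 2 and their shifts by 1.\<close>
  have der: "(f has_real_derivative 0) (at y)" if "y \<notin> {0,1,2,3}" for y
  proof -
    have 1: "(bspline (Suc (Suc n)) has_real_derivative bspline (Suc n) y - bspline (Suc n) (y - 1)) (at y)"
      by (rule bspline_has_derivative) (use step that in auto)
    have 2: "(bspline (Suc n) has_real_derivative bspline n y - bspline n (y - 1)) (at y)"
      by (rule bspline_has_derivative) (use step that in auto)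
    have "(bspline (Suc n) has_real_derivative bspline n (y - 1) - bspline n (y - 1 - 1)) (at (y - 1))"
      by (rule bspline_has_derivative) (use step that in auto)
    then have 3: "((\<lambda>y. bspline (Suc n) (y - 1)) has_real_derivative (bspline n (y - 1) - bspline n (y - 1 - 1)) * 1) (at y)"
      by (rule DERIV_chain2) (auto intro!: derivative_eq_intros)
    have "(f has_real_derivative (real (Suc n) * (bspline (Suc n) y - bspline (Suc n) (y - 1))
       - (bspline (Suc n) y + y * (bspline n y - bspline n (y - 1)) +
         (- bspline (Suc n) (y - 1) + (real (Suc (Suc n)) - y) * (bspline n (y - 1) - bspline n (y - 1 - 1)))))) (at y)"
      unfolding f_def by (rule derivative_eq_intros 1 2 3 refl | simp)+
    \<comment> \<open>The derivative is the induction hypothesis at \<open>y\<close> minus the one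
      at \<open>y - 1\<close>.\<close>
    moreover have "real (Suc n) * (bspline (Suc n) y - bspline (Suc n) (y - 1))
       - (bspline (Suc n) y + y * (bspline n y - bspline n (y - 1)) +
         (- bspline (Suc n) (y - 1) + (real (Suc (Suc n)) - y) * (bspline n (y - 1) - bspline n (y - 1 - 1)))) = 0"
      using step.IH[of y] step.IH[of "y - 1"] by (simp add: algebra_simps)
    ultimately show ?thesis by simp
  qed
  have "f x = 0"
  proof (cases "x < 0")
    case True
    then show ?thesis by (simp add: f_def bspline_eq_0_left)
  next
    case False
    show ?thesis
    proof (rule has_derivative_zero_unique_strong_interval[of "{0,1,2,3}" "-1" x f])
      show "f (-1) = 0" by (simp add: f_def bspline_eq_0_left)
      show "(f has_derivative (\<lambda>h. 0)) (at y within {-1..x})" if "y \<in> {-1..x} - {0,1,2,3}" for y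
      proof -
        have "(f has_derivative (*) 0) (at y)"
          using der[of y] that by (simp add: has_field_derivative_def)
        moreover have "(*) 0 = (\<lambda>h::real. 0::real)" by auto
        ultimately show ?thesis by (metis has_derivative_at_withinI)
      qed
      show "continuous_on {-1..x} f" by (rule cont)
    qed (use False in auto)
  qed
  then show ?case by (simp add: f_def)
qed

text \<open>Integrating the relation over a window of length 1 turns each dilate into the sum of two
  neighbouring dilates of the next order, and Pascal's rule merges the binomial
  coefficients.\<close>

lemma bspline_two_scale:
  assumes "n \<ge> 1"
  shows "bspline n x = 2 * (1/2) ^ n * (\<Sum>k\<le>n. real (n choose k) * bspline n (2 * x - real k))"
  using assms
proof (induction n arbitrary: x rule: dec_induct)
  case base
  show ?case by (auto simp: indicator_def)
next
  case (step n)
  have n: "n \<ge> 1" by fact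
  \<comment> \<open>Under y -> 2y - c the unit window becomes an interval of length 2, which is
    split into two unit windows.\<close>
  have half: "integral {x-1..x} (\<lambda>y. bspline n (2 * y - c)) = 1/2 * (bspline (Suc n) (2 * x - c) + bspline (Suc n) (2 * x - (c + 1)))" for c
  proof -
    have "(bspline n has_integral integral {2*x-c-2..2*x-c} (bspline n)) (cbox (2*x-c-2) (2*x-c))"
      using bspline_integrable_on by auto
    from has_integral_affinity'[OF this, of 2 "-c"]
    have "((\<lambda>y. bspline n (2 * y - c)) has_integral 1/2 * integral {2*x-c-2..2*x-c} (bspline n)) {x-1..x}"
      by (simp add: algebra_simps diff_divide_distrib add_divide_distrib)
    then have "integral {x-1..x} (\<lambda>y. bspline n (2 * y - c)) = 1/2 * integral {2*x-c-2..2*x-c} (bspline n)"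
      by (rule integral_unique)
    also have "integral {2*x-c-2..2*x-c} (bspline n) = integral {2*x-c-2..2*x-c-1} (bspline n) + integral {2*x-c-1..2*x-c} (bspline n)"
      by (rule Henstock_Kurzweil_Integration.integral_combine[symmetric]) (auto intro: bspline_integrable_on)
    also have "\<dots> = bspline (Suc n) (2*x-c) + bspline (Suc n) (2*x-(c+1))"
      by (simp add: bspline_Suc_integral[OF n] algebra_simps)
    finally show ?thesis .
  qed
  have int: "(\<lambda>y. bspline n (2 * y - c)) integrable_on {x-1..x}" for c
  proof -
    have "(bspline n has_integral integral {2*x-c-2..2*x-c} (bspline n)) (cbox (2*x-c-2) (2*x-c))"
      using bspline_integrable_on by auto
    from has_integral_affinity'[OF this, of 2 "-c"] show ?thesis
      by (auto simp: integrable_on_def algebra_simps diff_divide_distrib add_divide_distrib)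
  qed
  define N where "N k = bspline (Suc n) (2 * x - real k)" for k
  have "bspline (Suc n) x = integral {x-1..x} (\<lambda>y. 2 * (1/2) ^ n * (\<Sum>k\<le>n. real (n choose k) * bspline n (2 * y - real k)))"
    by (subst bspline_Suc_integral[OF n]) (rule Henstock_Kurzweil_Integration.integral_cong, rule step.IH)
  also have "\<dots> = 2 * (1/2)^n * (\<Sum>k\<le>n. real (n choose k) * integral {x-1..x} (\<lambda>y. bspline n (2 * y - real k)))"
    by (simp add: Henstock_Kurzweil_Integration.integral_sum integrable_on_mult_right int)
  also have "\<dots> = 2 * (1/2)^Suc n * (\<Sum>k\<le>n. real (n choose k) * (N k + N (Suc k)))"
    unfolding half N_def sum_distrib_left by (intro sum.cong refl) (simp add: add.commute)
  also have "(\<Sum>k\<le>n. real (n choose k) * (N k + N (Suc k))) = (\<Sum>k\<le>Suc n. real (Suc n choose k) * N k)"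
  proof -
    have "(\<Sum>k\<le>Suc n. real (Suc n choose k) * N k) = N 0 + (\<Sum>k\<le>n. real (Suc n choose Suc k) * N (Suc k))"
      by (subst sum.atMost_Suc_shift) simp
    also have "\<dots> = N 0 + (\<Sum>k\<le>n. real (n choose Suc k) * N (Suc k)) + (\<Sum>k\<le>n. real (n choose k) * N (Suc k))"
      by (simp add: sum.distrib distrib_right)
    also have "N 0 + (\<Sum>k\<le>n. real (n choose Suc k) * N (Suc k)) = (\<Sum>k\<le>Suc n. real (n choose k) * N k)"
      using sum.atMost_Suc_shift[of "\<lambda>k. real (n choose k) * N k" n] by simp
    finally show ?thesis by (simp add: sum.distrib distrib_left)
  qed
  finally show ?case by (simp add: N_def)
qed

section \<open>Values at the integers\<close>

text \<open>For order 2m this is z times the Euler-Frobenius polynomial divided by (2m-1)! (see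
  \<open>poly_euler_frobenius\<close>). The coefficients are complex because the polynomial is
  evaluated on the unit circle and on the imaginary axis.\<close>

definition bpoly :: "nat \<Rightarrow> complex poly" where
  "bpoly n = (\<Sum>k\<le>n. monom (of_real (bspline n (real k))) k)"

lemma coeff_bpoly: "coeff (bpoly n) k = of_real (bspline n (real k))"
  by (auto simp: bpoly_def coeff_sum coeff_monom bspline_eq_0_right if_distrib cong: if_cong)

lemma poly_bpoly: "poly (bpoly n) z = (\<Sum>k\<le>n. of_real (bspline n (real k)) * z ^ k)"
  by (simp add: bpoly_def poly_sum poly_monom)

text \<open>This is \<open>bspline_recurrence\<close> at the integers in generating-function form: a
  factor k in front of the k-th coefficient becomes z d/dz.\<close>

lemma bpoly_recurrence:
  assumes "n \<ge> 1"
  shows "smult (of_nat n) (bpoly (Suc n)) = pCons 0 ([:1, -1:] * pderiv (bpoly n) + smult (of_nat n) (bpoly n))"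
proof (rule poly_eqI)
  fix k
  show "coeff (smult (of_nat n) (bpoly (Suc n))) k =
        coeff (pCons 0 ([:1, -1:] * pderiv (bpoly n) + smult (of_nat n) (bpoly n))) k"
  proof (cases k)
    case 0
    then show ?thesis using assms by (simp add: coeff_bpoly bspline_at_0)
  next
    case (Suc k')
    have "real n * bspline (Suc n) (real (Suc k')) =
       real (Suc k') * bspline n (real (Suc k')) + (real n - real k') * bspline n (real k')"
      using bspline_recurrence[OF assms, of "real (Suc k')"] by simp
    then have "complex_of_real (real n * bspline (Suc n) (real (Suc k'))) =
       of_real (real (Suc k') * bspline n (real (Suc k')) + (real n - real k') * bspline n (real k'))" by simp
    then have "of_nat n * complex_of_real (bspline (Suc n) (real (Suc k'))) =
       of_nat (Suc k') * of_real (bspline n (real (Suc k'))) + (of_nat n - of_nat k') * of_real (bspline n (real k'))"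
      by (simp only: of_real_mult of_real_add of_real_diff of_real_of_nat_eq)
    then show ?thesis using Suc
      by (cases k') (simp_all add: coeff_bpoly coeff_pderiv coeff_pCons algebra_simps)
  qed
qed

text \<open>At 1 the factor 1 - z removes the derivative from the recurrence, so the value does not
  change with the order. It expresses the partition of unity at the integers.\<close>

lemma poly_bpoly_1: "n \<ge> 1 \<Longrightarrow> poly (bpoly n) 1 = 1"
proof (induction n rule: dec_induct)
  case base
  then show ?case by (simp add: poly_bpoly)
next
  case (step n)
  have "of_nat n * poly (bpoly (Suc n)) 1 = of_nat n * poly (bpoly n) 1"
    using arg_cong[OF bpoly_recurrence[OF step(1)], of "\<lambda>p. poly p 1"] by simp
  then show ?case using step by simp
qed

lemma sum_bspline_int: "n \<ge> 1 \<Longrightarrow> (\<Sum>k\<le>n. bspline n (real k)) = 1"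
  using poly_bpoly_1[of n] unfolding poly_bpoly
  by (metis (no_types, lifting) mult.right_neutral of_real_1 of_real_eq_iff of_real_sum power_one sum.cong)

text \<open>The reflection x -> n + 1 - x exchanges the two terms of the recurrence. The induction
  starts at order 2, because the half-open interval makes order 1 asymmetric at the
  integers.\<close>

lemma bspline_int_symmetric:
  assumes "n \<ge> 2" "k \<le> n"
  shows "bspline n (real (n - k)) = bspline n (real k)"
  using assms
proof (induction n arbitrary: k rule: dec_induct)
  case base
  then have "k = 0 \<or> k = 1 \<or> k = 2" by auto
  then show ?case by (auto simp: bspline_2)
next
  case (step n)
  show ?case
  proof (cases "k = 0 \<or> k = Suc n")
    case True
    then show ?thesis using step by (auto simp: bspline_at_0 bspline_eq_0_right)
  next
    case False
    then obtain j where j: "k = Suc j" "j < n" using step.prems by (cases k) auto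
    have 1: "bspline n (real (n - k)) = bspline n (real k)" "bspline n (real (n - j)) = bspline n (real j)"
      using step.IH[of k] step.IH[of j] j by auto
    have n: "n \<ge> 1" using step by simp
    have e: "real (n - j) - 1 = real (n - k)" "real k - 1 = real j" "real (Suc n) - real (n - j) = real k"
         "real (Suc n) - real k = real (n - j)"
    proof -
      have "real (n - j) = real n - real j" "real (n - k) = real n - real k" "real k = real j + 1"
        using j by (auto simp only: of_nat_diff less_imp_le Suc_leI of_nat_Suc)
      then show "real (n - j) - 1 = real (n - k)" "real k - 1 = real j" "real (Suc n) - real (n - j) = real k"
         "real (Suc n) - real k = real (n - j)" by linarith+
    qed
    have "real n * bspline (Suc n) (real (n - j)) = real (n - j) * bspline n (real j) + real k * bspline n (real k)"
      using bspline_recurrence[OF n, of "real (n - j)"] by (simp only: e 1)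
    also have "\<dots> = real n * bspline (Suc n) (real k)"
      using bspline_recurrence[OF n, of "real k"] by (simp only: e 1)
    finally have "real n * bspline (Suc n) (real (n - j)) = real n * bspline (Suc n) (real k)" .
    then have "bspline (Suc n) (real (n - j)) = bspline (Suc n) (real k)"
      using n by (subst (asm) mult_left_cancel) auto
    moreover have "Suc n - k = n - j" by (simp only: j diff_Suc_Suc)
    ultimately show ?thesis by (simp only:)
  qed
qed

text \<open>The two-scale relation at integer arguments says that the coefficients of 2^n B(z^2) are
  twice the even-indexed ones of \<open>Q\<close>; adding the values at z and -z extracts
  these.\<close>

lemma bpoly_two_scale:
  assumes "n \<ge> 1"
  shows "2 ^ n * poly (bpoly n) (z\<^sup>2) = (1 + z) ^ n * poly (bpoly n) z + (1 - z) ^ n * poly (bpoly n) (- z)"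
proof -
  define Q where "Q = [:1, 1:] ^ n * bpoly n"
  have cQ: "2 * coeff Q (2 * i) = 2 ^ n * coeff (bpoly n) i" for i
  proof -
    have c: "coeff ([:1, 1::complex:] ^ n) k = of_nat (n choose k)" for k
    proof (cases "k \<le> n")
      case False
      then have "coeff ([:1, 1::complex:] ^ n) k = 0"
        by (intro coeff_eq_0) (simp add: degree_linear_power)
      then show ?thesis using False by simp
    qed (simp add: coeff_linear_poly_power)
    have "coeff Q (2 * i) = (\<Sum>k\<le>2*i. of_nat (n choose k) * of_real (bspline n (real (2 * i - k))))"
      by (simp add: Q_def coeff_mult c coeff_bpoly)
    also have "\<dots> = (\<Sum>k\<le>2*i. of_real (real (n choose k) * bspline n (2 * real i - real k)))"
      by (intro sum.cong) auto
    also have "\<dots> = (\<Sum>k\<le>2*i+n. of_real (real (n choose k) * bspline n (2 * real i - real k)))"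
      by (intro sum.mono_neutral_left) (auto simp: bspline_eq_0_left)
    also have "\<dots> = (\<Sum>k\<le>n. of_real (real (n choose k) * bspline n (2 * real i - real k)))"
      by (intro sum.mono_neutral_right) auto
    finally have "coeff Q (2 * i) = of_real (\<Sum>k\<le>n. real (n choose k) * bspline n (2 * real i - real k))"
      by (simp only: of_real_sum)
    moreover have "2 ^ n * bspline n (real i) = 2 * (\<Sum>k\<le>n. real (n choose k) * bspline n (2 * real i - real k))"
    proof -
      have "2 ^ n * (2 * (1/2) ^ n * X) = 2 * X" for X :: real by (simp add: power_one_over)
      then show ?thesis using arg_cong[OF bspline_two_scale[OF assms, of "real i"], of "\<lambda>x. 2 ^ n * x"] by (simp only:)
    qed
    ultimately have "2 * coeff Q (2 * i) = of_real (2 ^ n * bspline n (real i))"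
      by (simp only: of_real_mult of_real_numeral)
    then show ?thesis by (simp add: coeff_bpoly)
  qed
  \<comment> \<open>A crude common bound on all indices that occur, so that every sum can be
    extended to the same range.\<close>
  define D where "D = degree Q + n"
  have P: "poly Q y = (\<Sum>i\<le>2*D. coeff Q i * y ^ i)" for y
    unfolding poly_altdef by (intro sum.mono_neutral_left) (auto simp: D_def coeff_eq_0)
  have "poly Q z + poly Q (- z) = (\<Sum>i\<le>2*D. coeff Q i * (z ^ i + (- z) ^ i))"
    by (simp add: P sum.distrib distrib_left)
  also have "\<dots> = (\<Sum>i\<in>(\<lambda>i. 2 * i) ` {..D}. coeff Q i * (z ^ i + (- z) ^ i))"
  proof (intro sum.mono_neutral_right ballI)
    fix i assume "i \<in> {..2 * D} - (\<lambda>i. 2 * i) ` {..D}"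
    then have "odd i" by (auto elim!: evenE)
    then show "coeff Q i * (z ^ i + (- z) ^ i) = 0" by simp
  qed auto
  also have "\<dots> = (\<Sum>i\<le>D. 2 * coeff Q (2 * i) * (z\<^sup>2) ^ i)"
    by (subst sum.reindex) (auto simp: inj_on_def power_mult intro!: sum.cong)
  also have "\<dots> = 2 ^ n * (\<Sum>i\<le>D. coeff (bpoly n) i * (z\<^sup>2) ^ i)"
    unfolding cQ sum_distrib_left by (simp add: mult_ac)
  also have "(\<Sum>i\<le>D. coeff (bpoly n) i * (z\<^sup>2) ^ i) = poly (bpoly n) (z\<^sup>2)"
    unfolding poly_bpoly coeff_bpoly
    by (intro sum.mono_neutral_right) (auto simp: D_def bspline_eq_0_right)
  finally show ?thesis by (simp add: Q_def)
qed

text \<open>The sum of (x + j)^(-n) over all integers j, for x not an integer; for n = 1 it is the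
  conditionally convergent expansion of the cotangent.\<close>

definition lattice_sum :: "nat \<Rightarrow> complex \<Rightarrow> complex" where
  "lattice_sum n x = (-1) ^ n / fact (n - 1) * (Polygamma (n - 1) x + (-1) ^ n * Polygamma (n - 1) (1 - x))"

lemma not_Int_imp_not_nonpos_Int:
  assumes "(x::complex) \<notin> \<int>" shows "x \<notin> \<int>\<^sub>\<le>\<^sub>0" "1 - x \<notin> \<int>\<^sub>\<le>\<^sub>0"
proof -
  show "x \<notin> \<int>\<^sub>\<le>\<^sub>0" using assms nonpos_Ints_subset_Ints by blast
  have "1 - x \<notin> \<int>" using assms Ints_diff[of 1 "1 - x"] by auto
  then show "1 - x \<notin> \<int>\<^sub>\<le>\<^sub>0" using nonpos_Ints_subset_Ints by blast
qed

text \<open>Formally (x+j)^(-n) is differentiated termwise. In the closed form, the inner derivative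
  -1 of the reflected argument supplies the change from (-1)^n to (-1)^(n+1).\<close>

lemma lattice_sum_deriv:
  assumes "n \<ge> 1" "x \<notin> \<int>"
  shows "(lattice_sum n has_field_derivative - of_nat n * lattice_sum (Suc n) x) (at x)"
proof -
  obtain k where k: "n = Suc k" using assms by (cases n) auto
  note ni = not_Int_imp_not_nonpos_Int[OF assms(2)]
  have 1: "(Polygamma k has_field_derivative Polygamma (Suc k) x) (at x)"
    by (rule has_field_derivative_Polygamma[OF ni(1)])
  have "((\<lambda>x. Polygamma k (1 - x)) has_field_derivative Polygamma (Suc k) (1 - x) * (- 1)) (at x)"
    by (rule DERIV_chain2[where f="Polygamma k" and g="\<lambda>x. 1 - x", OF has_field_derivative_Polygamma[OF ni(2)]]) (auto intro!: derivative_eq_intros)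
  from DERIV_cmult[OF DERIV_add[OF 1 DERIV_cmult[OF this, of "(-1)^n"]], of "(-1)^n / fact k"]
  have "(lattice_sum n has_field_derivative (-1)^n / fact k * (Polygamma (Suc k) x + (-1)^n * (Polygamma (Suc k) (1 - x) * (- 1)))) (at x)"
    by (simp add: lattice_sum_def[abs_def] k)
  also have "(-1)^n / fact k * (Polygamma (Suc k) x + (-1)^n * (Polygamma (Suc k) (1 - x) * (- 1))) = - of_nat n * lattice_sum (Suc n) x"
    using of_nat_neq_0[of k, where 'a=complex] by (simp add: lattice_sum_def k divide_simps del: of_nat_Suc)
  finally show ?thesis .
qed

lemma sin_pi_nonzero: "(x::complex) \<notin> \<int> \<Longrightarrow> sin (of_real pi * x) \<noteq> 0"
  by (auto simp: sin_eq_0 mult.commute)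

lemma open_not_Ints: "open (- (\<int> :: complex set))"
  by (simp add: open_Compl closed_Ints)

text \<open>Taking the logarithmic derivative of Euler's reflection formula Gamma(x) Gamma(1-x) = pi
  / sin(pi x) gives the cotangent.\<close>

lemma lattice_sum_1:
  assumes "x \<notin> \<int>"
  shows "lattice_sum 1 x = of_real pi * cos (of_real pi * x) / sin (of_real pi * x)"
proof -
  note ni = not_Int_imp_not_nonpos_Int[OF assms]
  have s: "sin (of_real pi * x) \<noteq> 0" using sin_pi_nonzero[OF assms] .
  have "((\<lambda>x. Gamma (1 - x)) has_field_derivative Gamma (1 - x) * Digamma (1 - x) * (- 1)) (at x)"
    by (rule DERIV_chain2[where f=Gamma and g="\<lambda>x. 1 - x", OF has_field_derivative_Gamma[OF ni(2)]]) (auto intro!: derivative_eq_intros)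
  from DERIV_mult[OF has_field_derivative_Gamma[OF ni(1)] this]
  have "((\<lambda>x. Gamma x * Gamma (1 - x)) has_field_derivative Gamma x * Gamma (1 - x) * (Digamma x - Digamma (1 - x))) (at x)"
    by (simp add: algebra_simps)
  then have 1: "((\<lambda>x. of_real pi / sin (of_real pi * x)) has_field_derivative of_real pi / sin (of_real pi * x) * (Digamma x - Digamma (1 - x))) (at x)"
    by (simp only: Gamma_reflection_complex)
  have 2: "((\<lambda>x. of_real pi / sin (of_real pi * x)) has_field_derivative - (of_real pi * (of_real pi * cos (of_real pi * x))) / (sin (of_real pi * x))\<^sup>2) (at x)"
    using s by (auto intro!: derivative_eq_intros simp: power2_eq_square field_simps)
  have *: "of_real pi / sin (of_real pi * x) * (Digamma x - Digamma (1 - x)) = - (of_real pi * (of_real pi * cos (of_real pi * x))) / (sin (of_real pi * x))\<^sup>2"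
    using DERIV_unique[OF 1 2] .
  then have "Digamma x - Digamma (1 - x) = - (of_real pi * cos (of_real pi * x)) / sin (of_real pi * x)"
  proof -
    have "of_real pi / sin (of_real pi * x) * ((Digamma x - Digamma (1 - x)) + of_real pi * cos (of_real pi * x) / sin (of_real pi * x)) = 0"
      using * s by (simp add: distrib_left power2_eq_square)
    then show ?thesis using s by (simp add: eq_neg_iff_add_eq_0 add.commute)
  qed
  then show ?thesis by (simp add: lattice_sum_def field_simps)
qed

lemma lattice_sum_2:
  assumes "x \<notin> \<int>"
  shows "lattice_sum 2 x = (of_real pi / sin (of_real pi * x))\<^sup>2"
proof -
  have s: "sin (of_real pi * x) \<noteq> 0" using sin_pi_nonzero[OF assms] .
  have 1: "(lattice_sum 1 has_field_derivative - of_nat 1 * lattice_sum (Suc 1) x) (at x)"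
    by (rule lattice_sum_deriv) (use assms in auto)
  have "((\<lambda>x. of_real pi * cos (of_real pi * x) / sin (of_real pi * x)) has_field_derivative - (of_real pi / sin (of_real pi * x))\<^sup>2) (at x)"
  proof -
    have "of_real pi * (of_real pi * (sin (of_real pi * x) * sin (of_real pi * x))) + of_real pi * (of_real pi * (cos (of_real pi * x) * cos (of_real pi * x))) = of_real pi * (of_real pi :: complex)"
      using sin_cos_squared_add[of "of_real pi * x"] by (simp add: power2_eq_square distrib_left[symmetric] mult_ac)
    then show ?thesis
      using s by (auto intro!: derivative_eq_intros simp: power2_eq_square divide_simps) (simp add: algebra_simps)
  qed
  then have "(lattice_sum 1 has_field_derivative - (of_real pi / sin (of_real pi * x))\<^sup>2) (at x)"
    by (rule has_field_derivative_transform_within_open[OF _ open_not_Ints]) (use assms lattice_sum_1 in auto)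
  from DERIV_unique[OF 1 this] show ?thesis by (simp add: numeral_2_eq_2)
qed

text \<open>The induction differentiates in x. With E = exp(-2 pi i x) one has E' = -2 pi i E, so
  differentiation produces the combination of the polynomial and its derivative that occurs in
  \<open>bpoly_recurrence\<close>, while it raises the order of \<open>lattice_sum\<close> by
  1.\<close>

lemma bpoly_lattice_sum:
  assumes "n \<ge> 2" "x \<notin> \<int>"
  shows "poly (bpoly n) (exp (- (2 * of_real pi * \<i> * x))) * (2 * of_real pi * \<i>) ^ n =
         (1 - exp (- (2 * of_real pi * \<i> * x))) ^ n * lattice_sum n x"
  using assms
proof (induction n arbitrary: x rule: dec_induct)
  case base
  \<comment> \<open>The square root of the exponential makes sin(pi x) a rational function of
    \<open>w\<close>.\<close>
  define w where "w = exp (- (of_real pi * \<i> * x))"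
  have w: "exp (- (2 * of_real pi * \<i> * x)) = w\<^sup>2" "w \<noteq> 0"
    by (auto simp: w_def exp_double[symmetric] mult_ac)
  have "exp (\<i> * (of_real pi * x)) = 1 / w" by (simp add: w_def exp_minus divide_simps mult_ac)
  moreover have "exp (- (\<i> * (of_real pi * x))) = w" by (simp add: w_def mult_ac)
  ultimately have sn: "sin (of_real pi * x) = (1 / w - w) / (2 * \<i>)"
    by (simp add: sin_exp_eq' minus_divide_left[symmetric]) (simp add: algebra_simps)
  have ne: "1 / w - w \<noteq> 0" using sin_pi_nonzero[OF base] sn by auto
  then have ne2: "1 - w\<^sup>2 \<noteq> 0" using w by (auto simp: divide_simps power2_eq_square)
  have "poly (bpoly 2) y = y" for y
  proof -
    have "{..2::nat} = {0,1,2}" by auto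
    then show ?thesis by (simp add: poly_bpoly bspline_2)
  qed
  moreover have "lattice_sum 2 x = - (4 * (of_real pi)\<^sup>2 * w\<^sup>2) / (1 - w\<^sup>2)\<^sup>2"
  proof -
    have "1 / w - w = (1 - w\<^sup>2) / w" using w by (simp add: field_simps power2_eq_square)
    then show ?thesis using ne2 w unfolding lattice_sum_2[OF base] sn
      by (simp add: power_divide power_mult_distrib field_simps)
  qed
  ultimately show ?case using ne2 by (simp add: w power_mult_distrib)
next
  case (step n)
  define E where "E = (\<lambda>x. exp (- (2 * of_real pi * \<i> * x)))"
  define p where "p = 2 * of_real pi * \<i>"
  have n: "n \<ge> 1" "n \<ge> 2" using step by auto
  have dE: "(E has_field_derivative - (p * E x)) (at x)"
    unfolding E_def p_def by (auto intro!: derivative_eq_intros)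
  have "((\<lambda>x. poly (bpoly n) (E x)) has_field_derivative poly (pderiv (bpoly n)) (E x) * (- (p * E x))) (at x)"
    by (rule DERIV_chain2[OF poly_DERIV dE])
  from DERIV_cmult_right[OF this, of "p ^ n"]
  have 1: "((\<lambda>x. poly (bpoly n) (E x) * p ^ n) has_field_derivative poly (pderiv (bpoly n)) (E x) * (- (p * E x)) * p ^ n) (at x)" .
  have "((\<lambda>x. (1 - E x) ^ n) has_field_derivative of_nat n * (1 - E x) ^ (n - 1) * (p * E x)) (at x)"
    by (auto intro!: derivative_eq_intros dE)
  from DERIV_mult[OF this lattice_sum_deriv[OF n(1) step.prems]]
  have 2: "((\<lambda>x. (1 - E x) ^ n * lattice_sum n x) has_field_derivative
     of_nat n * (1 - E x) ^ (n - 1) * (p * E x) * lattice_sum n x + - of_nat n * lattice_sum (Suc n) x * (1 - E x) ^ n) (at x)" .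
  \<comment> \<open>The induction hypothesis holds on the whole open set of non-integers, so the
    product has the same derivative as the polynomial side; comparing \<open>2\<close> and
    \<open>3\<close> isolates the next lattice sum.\<close>
  have 3: "((\<lambda>x. (1 - E x) ^ n * lattice_sum n x) has_field_derivative poly (pderiv (bpoly n)) (E x) * (- (p * E x)) * p ^ n) (at x)"
    by (rule has_field_derivative_transform_within_open[OF 1 open_not_Ints])
       (use step.IH step.prems in \<open>auto simp: E_def p_def\<close>)
  have 4: "poly (pderiv (bpoly n)) (E x) * (- (p * E x)) * p ^ n =
      of_nat n * (1 - E x) ^ (n - 1) * (p * E x) * lattice_sum n x + - of_nat n * lattice_sum (Suc n) x * (1 - E x) ^ n"
    using DERIV_unique[OF 3 2] .
  have pw: "(1 - E x) ^ n = (1 - E x) * (1 - E x) ^ (n - 1)" using n by (cases n) auto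
  have rec: "of_nat n * poly (bpoly (Suc n)) (E x) = E x * ((1 - E x) * poly (pderiv (bpoly n)) (E x) + of_nat n * poly (bpoly n) (E x))"
    using arg_cong[OF bpoly_recurrence[OF n(1)], of "\<lambda>p. poly p (E x)"] by (simp add: algebra_simps)
  have IH: "poly (bpoly n) (E x) * p ^ n = (1 - E x) ^ n * lattice_sum n x"
    using step.IH[OF step.prems] by (simp add: E_def p_def)
  have "of_nat n * (poly (bpoly (Suc n)) (E x) * p ^ Suc n) =
     p * E x * (1 - E x) * (poly (pderiv (bpoly n)) (E x) * p ^ n) + p * E x * of_nat n * (poly (bpoly n) (E x) * p ^ n)"
  proof -
    have "of_nat n * (poly (bpoly (Suc n)) (E x) * p ^ Suc n) = (of_nat n * poly (bpoly (Suc n)) (E x)) * p ^ Suc n" by simp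
    also have "\<dots> = p * E x * (1 - E x) * (poly (pderiv (bpoly n)) (E x) * p ^ n) + p * E x * of_nat n * (poly (bpoly n) (E x) * p ^ n)"
      unfolding rec by (simp add: algebra_simps)
    finally show ?thesis .
  qed
  also have "\<dots> = - (1 - E x) * (poly (pderiv (bpoly n)) (E x) * (- (p * E x)) * p ^ n) + p * E x * of_nat n * ((1 - E x) ^ n * lattice_sum n x)"
    unfolding IH by (simp add: algebra_simps)
  also have "\<dots> = of_nat n * ((1 - E x) ^ Suc n * lattice_sum (Suc n) x)"
    unfolding 4 power_Suc pw by (simp add: algebra_simps)
  finally show ?case using n by (simp add: E_def p_def)
qed

section \<open>The Fourier transform of a B-spline\<close>

abbreviation fexp :: "real \<Rightarrow> real \<Rightarrow> complex" where
  "fexp \<xi> t \<equiv> exp (- \<i> * of_real \<xi> * of_real t)"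

lemma norm_fexp [simp]: "norm (fexp \<xi> t) = 1"
  by (simp add: norm_exp_eq_Re)

text \<open>The closed interval of the recursion and the half-open interval of order 1 differ by a
  null set, so the recursion is a convolution.\<close>

lemma bspline_Suc_lborel:
  assumes "n \<ge> 1"
  shows "bspline (Suc n) t = (LINT y|lborel. bspline 1 y * bspline n (t - y))"
proof -
  obtain k where k: "n = Suc k" using assms by (cases n) auto
  have int: "set_integrable lborel {0..1} (\<lambda>y. bspline n (t - y))"
    unfolding set_integrable_def
    by (rule integrableI_bounded_set_indicator[where B=1]) (auto simp: bspline_nonneg bspline_le_1)
  have "bspline (Suc n) t = integral {0..1} (\<lambda>y. bspline n (t - y))"
    by (simp add: k bspline.simps(3))
  also have "\<dots> = (LINT y|lborel. indicat_real {0..1} y * bspline n (t - y))"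
    using set_borel_integral_eq_integral(2)[OF int] by (simp add: set_lebesgue_integral_def)
  also have "\<dots> = (LINT y|lborel. bspline 1 y * bspline n (t - y))"
  proof (rule integral_cong_AE)
    show "AE y in lborel. indicat_real {0..1} y * bspline n (t - y) = bspline 1 y * bspline n (t - y)"
      using AE_lborel_singleton[of "1::real"] by eventually_elim (auto simp: bspline_1_eq indicator_def)
  qed measurable
  finally show ?thesis .
qed

text \<open>Each order is the convolution of the preceding one with order 1, and Fubini's theorem
  turns convolution into multiplication.\<close>

lemma bspline_fourier_power:
  assumes "n \<ge> 1"
  shows "(LINT t|lborel. of_real (bspline n t) * fexp \<xi> t) = (LINT t|lborel. of_real (bspline 1 t) * fexp \<xi> t) ^ n"
  using assms
proof (induction n rule: dec_induct)
  case (step n)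
  define F where "F n = (LINT t|lborel. of_real (bspline n t) * fexp \<xi> t)" for n
  define f where "f = (\<lambda>t y. of_real (bspline 1 y * bspline n (t - y)) * fexp \<xi> t)"
  have [measurable]: "(\<lambda>t. fexp \<xi> t) \<in> borel_measurable borel"
    by (intro borel_measurable_continuous_onI continuous_intros)
  \<comment> \<open>The integrand is bounded by 1 and vanishes outside a bounded rectangle, because
    the supports of the factors are [0,1] and [0,n].\<close>
  have intf: "integrable (lborel \<Otimes>\<^sub>M lborel) (case_prod f)"
  proof (rule integrableI_bounded_set[where A="{0..real n + 1} \<times> {0..1}" and B=1])
    show "{0..real n + 1} \<times> {0..1::real} \<in> sets (lborel \<Otimes>\<^sub>M lborel)" by measurable
    show "case_prod f \<in> borel_measurable (lborel \<Otimes>\<^sub>M lborel)" unfolding f_def by measurable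
    show "emeasure (lborel \<Otimes>\<^sub>M lborel) ({0..real n + 1} \<times> {0..1::real}) < \<infinity>"
      by (subst lborel.emeasure_pair_measure_Times) (auto simp: ennreal_mult_less_top)
    show "AE x in lborel \<Otimes>\<^sub>M lborel. x \<in> {0..real n + 1} \<times> {0..1} \<longrightarrow> norm (case_prod f x) \<le> 1"
      by (auto simp: f_def norm_mult bspline_nonneg bspline_le_1 mult_le_one simp del: bspline.simps)
    show "AE x in lborel \<Otimes>\<^sub>M lborel. x \<notin> {0..real n + 1} \<times> {0..1} \<longrightarrow> case_prod f x = 0"
    proof (rule AE_I2, rule impI)
      fix p :: "real \<times> real" assume p: "p \<notin> {0..real n + 1} \<times> {0..1}"
      obtain t y where ty: "p = (t, y)" by (cases p)
      show "case_prod f p = 0"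
      proof (cases "y \<in> {0..<1}")
        case True
        then have "t < y \<or> t - y \<ge> real n" using p ty by auto
        then have "bspline n (t - y) = 0" by (auto intro: bspline_eq_0_left bspline_eq_0_right)
        then show ?thesis by (simp add: f_def ty)
      qed (simp add: f_def ty bspline_1_eq)
    qed
  qed
  have inner: "(LINT t|lborel. f t y) = of_real (bspline 1 y) * fexp \<xi> y * F n" for y
  proof -
    have "(LINT t|lborel. f t y) = (LINT t|lborel. f (y + 1 * t) y)"
      by (subst lborel_integral_real_affine[of 1 _ y]) auto
    also have "\<dots> = (LINT t|lborel. (of_real (bspline 1 y) * fexp \<xi> y) * (of_real (bspline n t) * fexp \<xi> t))"
      by (intro Bochner_Integration.integral_cong refl) (simp add: f_def exp_add[symmetric] algebra_simps)
    finally show ?thesis by (simp add: F_def)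
  qed
  have "F (Suc n) = (LINT t|lborel. LINT y|lborel. f t y)"
    unfolding F_def f_def using step by (simp add: bspline_Suc_lborel mult_ac del: of_real_mult)
  also have "\<dots> = (LINT y|lborel. LINT t|lborel. f t y)"
    by (rule lborel_pair.Fubini_integral[OF intf, symmetric])
  also have "\<dots> = F 1 * F n" by (simp add: inner F_def)
  finally show ?case using step by (simp add: F_def)
qed simp

lemma bspline_1_fourier:
  "(norm (LINT t|lborel. of_real (bspline 1 t) * fexp \<xi> t))\<^sup>2 = (if \<xi> = 0 then 1 else (2 - 2 * cos \<xi>) / \<xi>\<^sup>2)"
proof -
  have "(LINT t|lborel. of_real (bspline 1 t) * fexp \<xi> t) = (LINT t|lborel. indicat_real {0..1} t *\<^sub>R fexp \<xi> t)"
  proof (rule integral_cong_AE)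
    show "AE t in lborel. of_real (bspline 1 t) * fexp \<xi> t = indicat_real {0..1} t *\<^sub>R fexp \<xi> t"
      using AE_lborel_singleton[of "1::real"] 
      by eventually_elim (auto simp: bspline_1_eq indicator_def)
    have [measurable]: "(\<lambda>t. fexp \<xi> t) \<in> borel_measurable borel"
      by (intro borel_measurable_continuous_onI continuous_intros)
    show "(\<lambda>t. of_real (bspline 1 t) * fexp \<xi> t) \<in> borel_measurable lborel"
      "(\<lambda>t. indicat_real {0..1} t *\<^sub>R fexp \<xi> t) \<in> borel_measurable lborel" by measurable
  qed
  also have "\<dots> = integral {0..1} (fexp \<xi>)"
  proof -
    have "set_integrable lborel {0..1} (fexp \<xi>)"
      by (intro borel_integrable_atLeastAtMost' continuous_intros)
    from set_borel_integral_eq_integral(2)[OF this] show ?thesis by (simp add: set_lebesgue_integral_def)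
  qed
  finally have *: "(LINT t|lborel. of_real (bspline 1 t) * fexp \<xi> t) = integral {0..1} (fexp \<xi>)" .
  show ?thesis
  proof (cases "\<xi> = 0")
    case True
    then show ?thesis unfolding * by simp
  next
    case False
    have "(fexp \<xi> has_integral (\<i> / of_real \<xi> * fexp \<xi> 1 - \<i> / of_real \<xi> * fexp \<xi> 0)) {0..1}"
    proof (rule fundamental_theorem_of_calculus)
      fix t :: real
      have "((\<lambda>z. \<i> / of_real \<xi> * exp (- \<i> * of_real \<xi> * z)) has_field_derivative fexp \<xi> t) (at (of_real t))"
        using False by (auto intro!: derivative_eq_intros)
      then show "((\<lambda>t. \<i> / of_real \<xi> * fexp \<xi> t) has_vector_derivative fexp \<xi> t) (at t within {0..1})"
        by (rule has_vector_derivative_real_field)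
    qed simp
    then have "integral {0..1} (fexp \<xi>) = \<i> / of_real \<xi> * (fexp \<xi> 1 - 1)"
      by (simp add: integral_unique algebra_simps)
    then have "(norm (integral {0..1} (fexp \<xi>)))\<^sup>2 = (norm (fexp \<xi> 1 - 1))\<^sup>2 / \<xi>\<^sup>2"
      by (simp add: norm_mult norm_divide power_divide)
    also have "(norm (fexp \<xi> 1 - 1))\<^sup>2 = (cos \<xi> - 1)\<^sup>2 + (sin \<xi>)\<^sup>2"
      by (simp add: cmod_power2 Re_exp Im_exp)
    also have "\<dots> = 2 - 2 * cos \<xi>"
      using sin_cos_squared_add[of \<xi>] by (simp add: power2_eq_square algebra_simps)
    finally show ?thesis using False * by simp
  qed
qed

lemma norm_fourier_bspline:
  assumes "m \<ge> 1"
  shows "2 * pi * (norm (fourier (bspline m) \<xi>))\<^sup>2 = (if \<xi> = 0 then 1 else ((2 - 2 * cos \<xi>) / \<xi>\<^sup>2) ^ m)"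
proof -
  define I where "I = (LINT t|lborel. of_real (bspline 1 t) * fexp \<xi> t)"
  have "fourier (bspline m) \<xi> = of_real (1 / sqrt (2 * pi)) * I ^ m"
    unfolding fourier_def I_def using bspline_fourier_power[OF assms, of \<xi>] by simp
  then have "(norm (fourier (bspline m) \<xi>))\<^sup>2 = 1 / (2 * pi) * ((norm I)\<^sup>2) ^ m"
    by (simp add: norm_mult norm_divide power_mult_distrib norm_power power_divide power_mult[symmetric] mult.commute)
  then show ?thesis unfolding I_def bspline_1_fourier by simp
qed

section \<open>Summation of the squared transform over shifts by 2 pi\<close>

lemma has_sum_int_split:
  fixes f :: "int \<Rightarrow> 'a :: {topological_comm_monoid_add}"
  assumes "((\<lambda>k::nat. f (int k)) has_sum a) UNIV" "((\<lambda>k::nat. f (- int k - 1)) has_sum b) UNIV"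
  shows "(f has_sum (a + b)) UNIV"
proof -
  have 1: "(f has_sum a) (range int)"
    using assms(1) by (subst has_sum_reindex) (auto simp: o_def)
  have 2: "(f has_sum b) (range (\<lambda>k. - int k - 1))"
    using assms(2) by (subst has_sum_reindex) (auto simp: o_def inj_on_def)
  have "range int \<union> range (\<lambda>k. - int k - 1) = UNIV"
  proof -
    have "x \<in> range int \<union> range (\<lambda>k. - int k - 1)" for x
    proof (cases "x \<ge> 0")
      case True
      then show ?thesis by (metis UnI1 nonneg_int_cases rangeI)
    next
      case False
      then have "x = - int (nat (- x - 1)) - 1" by simp
      then show ?thesis by blast
    qed
    then show ?thesis by blast
  qed
  moreover have "range int \<inter> range (\<lambda>k. - int k - 1) = {}" by auto
  ultimately show ?thesis using has_sum_Un_disjoint[OF 1 2] by simp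
qed

text \<open>The even exponent makes all terms nonnegative, so the convergent Polygamma series are
  unordered sums. The reflected series covers the negative integers through j = -i - 1.\<close>

lemma lattice_sum_has_sum:
  assumes "m \<ge> 1" "(x::real) \<notin> \<int>"
  shows "\<exists>S. ((\<lambda>j::int. 1 / (x + of_int j) ^ (2 * m)) has_sum S) UNIV \<and> lattice_sum (2 * m) (of_real x) = of_real S"
proof -
  define k where "k = 2 * m - 1"
  have k: "Suc k = 2 * m" "k > 0" using assms by (auto simp: k_def)
  have x: "x \<noteq> 0" "1 - x \<noteq> 0" using assms(2) by auto
  have nn: "inverse (y ^ (2 * m)) \<ge> (0::real)" for y by (simp add: power_mult)
  have "((\<lambda>i. inverse ((x + of_nat i) ^ (2 * m))) has_sum (Polygamma k x / fact k)) UNIV"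
    by (rule sums_nonneg_imp_has_sum) (use Polygamma_LIMSEQ[OF x(1) k(2)] k nn in auto)
  then have 1: "((\<lambda>i. 1 / (x + of_int (int i)) ^ (2 * m)) has_sum (Polygamma k x / fact k)) UNIV"
    by (simp add: field_simps)
  have "((\<lambda>i. inverse ((1 - x + of_nat i) ^ (2 * m))) has_sum (Polygamma k (1 - x) / fact k)) UNIV"
    by (rule sums_nonneg_imp_has_sum) (use Polygamma_LIMSEQ[OF x(2) k(2)] k nn in auto)
  moreover have "inverse ((1 - x + of_nat i) ^ (2 * m)) = 1 / (x + of_int (- int i - 1)) ^ (2 * m)" for i
  proof -
    have "(1 - x + of_nat i) ^ (2 * m) = (- (1 - x + of_nat i)) ^ (2 * m)" by (rule power_minus_even[symmetric]) simp
    moreover have "- (1 - x + of_nat i) = x + of_int (- int i - 1)" by simp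
    ultimately show ?thesis by (simp only: inverse_eq_divide)
  qed
  ultimately have 2: "((\<lambda>i. 1 / (x + of_int (- int i - 1)) ^ (2 * m)) has_sum (Polygamma k (1 - x) / fact k)) UNIV"
    by simp
  have "lattice_sum (2 * m) (of_real x) = of_real (Polygamma k x / fact k + Polygamma k (1 - x) / fact k)"
  proof -
    have "Polygamma k (1 - of_real x :: complex) = of_real (Polygamma k (1 - x))"
      using Polygamma_of_real[of "1 - x" k] x by simp
    then show ?thesis
      using x unfolding lattice_sum_def k_def[symmetric] by (simp add: Polygamma_of_real add_divide_distrib)
  qed
  then show ?thesis using has_sum_int_split[OF 1 2] by blast
qed

text \<open>The numerator of the squared transform has period 2 pi and leaves the sum, and what
  remains is a lattice sum of order 2m at theta / (2 pi). Integer values of this quotient, where the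
  lattice sum has a pole, are treated directly.\<close>

lemma sum_norm_fourier_bspline:
  assumes m: "m \<ge> 1"
  shows "of_real (2 * pi * (\<Sum>\<^sub>\<infinity>j\<in>(UNIV::int set). (norm (fourier (bspline m) (\<theta> + 2 * pi * of_int j)))\<^sup>2)) * exp (- \<i> * of_real \<theta>) ^ m
         = poly (bpoly (2 * m)) (exp (- \<i> * of_real \<theta>))"
proof -
  define x where "x = \<theta> / (2 * pi)"
  define g where "g = (\<lambda>j::int. 2 * pi * (norm (fourier (bspline m) (\<theta> + 2 * pi * of_int j)))\<^sup>2)"
  have inf: "2 * pi * (\<Sum>\<^sub>\<infinity>j\<in>(UNIV::int set). (norm (fourier (bspline m) (\<theta> + 2 * pi * of_int j)))\<^sup>2) = (\<Sum>\<^sub>\<infinity>j. g j)"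
    unfolding g_def by (subst infsum_cmult_right') simp
  have th: "\<theta> + 2 * pi * of_int j = 2 * pi * (x + of_int j)" for j
    by (simp add: x_def field_simps)
  have cos_eq: "cos (\<theta> + 2 * pi * of_int j) = cos \<theta>" for j
    using sin_cos_eq_iff[of "\<theta> + 2 * pi * of_int j" \<theta>] by (metis mult.commute)
  show ?thesis
  proof (cases "x \<in> \<int>")
    case True
    then obtain i where i: "x = of_int i" by (elim Ints_cases)
    have th_i: "\<theta> = 2 * pi * of_int i" using i by (simp add: x_def field_simps)
    have "cos \<theta> = 1" unfolding th_i by (metis cos_int_2pin mult.commute)
    \<comment> \<open>All frequencies are multiples of 2 pi, where the transform vanishes except at
      frequency 0.\<close>
    then have gj: "g j = (if j = - i then 1 else 0)" for j
      unfolding g_def norm_fourier_bspline[OF m] cos_eq unfolding th i using m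
      by (auto simp: add_eq_0_iff)
    have "(g has_sum 1) UNIV"
      by (rule has_sum_finite_neutralI[of "{- i}"]) (auto simp: gj)
    then have s: "(\<Sum>\<^sub>\<infinity>j. g j) = 1" by (rule infsumI)
    have "exp (- \<i> * of_real \<theta>) = 1"
      using exp_integer_2pi[of "of_int (-i)"] by (simp add: th_i mult_ac)
    then show ?thesis unfolding inf s using poly_bpoly_1[of "2 * m"] m by simp
  next
    case False
    obtain S where S: "((\<lambda>j::int. 1 / (x + of_int j) ^ (2 * m)) has_sum S) UNIV" "lattice_sum (2 * m) (of_real x) = of_real S"
      using lattice_sum_has_sum[OF m False] by blast
    define c where "c = (2 - 2 * cos \<theta>) ^ m / (2 * pi) ^ (2 * m)"
    have "g j = c * (1 / (x + of_int j) ^ (2 * m))" for j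
    proof -
      have "x + of_int j \<noteq> 0" using False by (metis Ints_minus Ints_of_int eq_neg_iff_add_eq_0)
      then show ?thesis
        unfolding g_def norm_fourier_bspline[OF m] cos_eq unfolding th c_def
        by (simp add: power_divide power_mult_distrib power_mult)
    qed
    then have "(\<Sum>\<^sub>\<infinity>j. g j) = c * S"
      using has_sum_cmult_right[OF S(1), of c] by (simp add: infsumI)
    define E where "E = exp (- \<i> * of_real \<theta>)"
    have E0: "E \<noteq> 0" by (simp add: E_def)
    have EE: "exp (- (2 * of_real pi * \<i> * of_real x)) = E"
      by (simp add: E_def x_def mult_ac)
    have "of_real x \<notin> (\<int>::complex set)" using False by simp
    from bpoly_lattice_sum[OF _ this, of "2 * m"] m
    have 1: "poly (bpoly (2 * m)) E * (2 * of_real pi * \<i>) ^ (2 * m) = (1 - E) ^ (2 * m) * of_real S"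
      by (simp add: S EE)
    \<comment> \<open>This introduces the sign (-1)^m into (1 - E)^(2m); it cancels against the sign
      of (2 pi i)^(2m).\<close>
    have "(1 - E)\<^sup>2 = - (E * of_real (2 - 2 * cos \<theta>))"
    proof -
      have "of_real (2 * cos \<theta>) = E + 1 / E"
        unfolding E_def cos_of_real[symmetric] of_real_mult cos_exp_eq by (simp add: exp_minus field_simps)
      then have "E * of_real (2 * cos \<theta>) = E * E + 1" using E0 by (simp add: field_simps)
      then show ?thesis by (simp add: power2_eq_square algebra_simps)
    qed
    then have "(1 - E) ^ (2 * m) = (-1) ^ m * (E ^ m * of_real ((2 - 2 * cos \<theta>) ^ m))"
      by (simp add: power_mult power_mult_distrib[symmetric])
    moreover have "(2 * of_real pi * \<i>) ^ (2 * m) = (-1) ^ m * of_real ((2 * pi) ^ (2 * m))"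
    proof -
      have "(2 * of_real pi * \<i>)\<^sup>2 = (-1) * of_real ((2 * pi)\<^sup>2)" by (simp add: power_mult_distrib)
      then have "(2 * of_real pi * \<i>) ^ (2 * m) = ((-1 :: complex) * of_real ((2 * pi)\<^sup>2)) ^ m"
        unfolding power_mult by (rule arg_cong)
      also have "\<dots> = (-1) ^ m * of_real ((2 * pi)\<^sup>2) ^ m" by (rule power_mult_distrib)
      finally show ?thesis by (simp only: power_mult of_real_power)
    qed
    ultimately have "poly (bpoly (2 * m)) E * ((-1) ^ m * of_real ((2 * pi) ^ (2 * m))) = (-1) ^ m * (E ^ m * of_real ((2 - 2 * cos \<theta>) ^ m)) * of_real S"
      using 1 by (simp only:)
    moreover have "B * Y = Z * S'" if "B * (p * Y) = p * Z * S'" "p \<noteq> 0" for B p Y Z S' :: complex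
      using that by (simp add: mult.left_commute[of B p] mult.assoc)
    ultimately have "poly (bpoly (2 * m)) E * of_real ((2 * pi) ^ (2 * m)) = E ^ m * of_real ((2 - 2 * cos \<theta>) ^ m) * of_real S"
      by (metis power_not_zero neg_equal_0_iff_equal zero_neq_one)
    moreover have "complex_of_real ((2 * pi) ^ (2 * m)) \<noteq> 0" by simp
    ultimately have "poly (bpoly (2 * m)) E = E ^ m * of_real ((2 - 2 * cos \<theta>) ^ m) * of_real S / of_real ((2 * pi) ^ (2 * m))"
      by (rule eq_divide_imp[rotated])
    also have "\<dots> = of_real (c * S) * E ^ m"
      unfolding c_def by (simp only: of_real_mult of_real_divide) (simp only: times_divide_eq_left times_divide_eq_right mult_ac)
    finally show ?thesis unfolding inf \<open>(\<Sum>\<^sub>\<infinity>j. g j) = c * S\<close> E_def by (rule sym)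
  qed
qed

section \<open>Laurent series with real coefficients\<close>

text \<open>Unordered convergence in the complex numbers is absolute, so products and reindexings
  are unconditional. \<open>R\<close> need not be open; often it is just the unit circle.\<close>

definition laurent_on :: "(int \<Rightarrow> real) \<Rightarrow> (complex \<Rightarrow> complex) \<Rightarrow> complex set \<Rightarrow> bool" where
  "laurent_on f F R \<longleftrightarrow> (\<forall>z\<in>R. ((\<lambda>j. of_real (f j) * z powi j) has_sum F z) UNIV)"

definition conv :: "(int \<Rightarrow> real) \<Rightarrow> (int \<Rightarrow> real) \<Rightarrow> int \<Rightarrow> real" where
  "conv f g n = (\<Sum>\<^sub>\<infinity>k. f k * g (n - k))"

lemma laurent_onD: "laurent_on f F R \<Longrightarrow> z \<in> R \<Longrightarrow> ((\<lambda>j. of_real (f j) * z powi j) has_sum F z) UNIV"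
  by (simp add: laurent_on_def)

lemma laurent_on_cong: "laurent_on f F R \<Longrightarrow> (\<And>z. z \<in> R \<Longrightarrow> F z = G z) \<Longrightarrow> laurent_on f G R"
  by (simp add: laurent_on_def)

lemma laurent_on_subset: "laurent_on f F R \<Longrightarrow> S \<subseteq> R \<Longrightarrow> laurent_on f F S"
  by (auto simp: laurent_on_def)

lemma laurent_on_summable:
  assumes "laurent_on f F R" "z \<in> R"
  shows "(\<lambda>j. \<bar>f j\<bar> * norm z powi j) summable_on UNIV"
proof -
  have "(\<lambda>j. of_real (f j) * z powi j) summable_on UNIV"
    using laurent_onD[OF assms] by (auto simp: summable_on_def)
  then have "(\<lambda>j. norm (of_real (f j) * z powi j)) summable_on UNIV"
    by (rule summable_on_iff_abs_summable_on_complex[THEN iffD1])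
  then show ?thesis by (simp add: norm_mult norm_power_int)
qed

lemma laurent_on_abs_summable:
  assumes "laurent_on f F R" "z \<in> R" "norm z = 1"
  shows "(\<lambda>j. \<bar>f j\<bar>) summable_on UNIV"
  using laurent_on_summable[OF assms(1,2)] assms(3) by simp

lemma abs_summable_times:
  fixes a :: "'a \<Rightarrow> 'c::{real_normed_algebra,banach}" and b :: "'b \<Rightarrow> 'c"
  assumes a: "(\<lambda>j. norm (a j)) summable_on A" and b: "(\<lambda>k. norm (b k)) summable_on B"
  shows "(\<lambda>(j,k). norm (a j * b k)) summable_on (A \<times> B)"
proof -
  have "(\<lambda>(j,k). norm (a j) * norm (b k)) summable_on (A \<times> B)"
  proof (rule summable_on_SigmaI)
    show "((\<lambda>k. case (j, k) of (j, k) \<Rightarrow> norm (a j) * norm (b k)) has_sum norm (a j) * (\<Sum>\<^sub>\<infinity>k\<in>B. norm (b k))) B" for j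
      using b by (simp add: has_sum_cmult_right)
    show "(\<lambda>j. norm (a j) * (\<Sum>\<^sub>\<infinity>k\<in>B. norm (b k))) summable_on A"
      using a by (rule summable_on_cmult_left)
  qed auto
  from summable_on_comparison_test[OF this, of "\<lambda>(j,k). norm (a j * b k)"] show ?thesis
    by (auto simp: norm_mult_ineq)
qed

lemma has_sum_times:
  fixes a b :: "_ \<Rightarrow> 'c::{real_normed_algebra,banach}"
  assumes "(a has_sum x) A" "(b has_sum y) B"
    and "(\<lambda>j. norm (a j)) summable_on A" "(\<lambda>k. norm (b k)) summable_on B"
  shows "((\<lambda>(j,k). a j * b k) has_sum x * y) (A \<times> B)"
proof (rule has_sum_SigmaI)
  show "((\<lambda>k. case (j, k) of (j, k) \<Rightarrow> a j * b k) has_sum a j * y) B" for j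
    using has_sum_cmult_right[OF assms(2)] by simp
  show "((\<lambda>j. a j * y) has_sum x * y) A"
    by (rule has_sum_cmult_left[OF assms(1)])
  show "(\<lambda>(j,k). a j * b k) summable_on (A \<times> B)"
    using abs_summable_times[OF assms(3,4)] by - (rule abs_summable_summable, simp add: case_prod_unfold)
qed

lemma bij_conv: "bij_betw (\<lambda>(n,k). (k, n - k)) (UNIV \<times> UNIV) (UNIV \<times> (UNIV :: int set))"
  by (rule bij_betwI[of _ _ _ "\<lambda>(j,k). (j + k, j)"]) auto

lemma laurent_on_mult:
  assumes f: "laurent_on f F R" and g: "laurent_on g G R" and R: "0 \<notin> R"
  shows "laurent_on (conv f g) (\<lambda>z. F z * G z) R"
  unfolding laurent_on_def
proof
  fix z assume z: "z \<in> R"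
  then have z0: "z \<noteq> 0" using R by auto
  define a where "a j = of_real (f j) * z powi j" for j
  define b where "b j = of_real (g j) * z powi j" for j
  have "((\<lambda>(j,k). a j * b k) has_sum F z * G z) (UNIV \<times> UNIV)"
    using laurent_onD[OF f z] laurent_onD[OF g z] laurent_on_summable[OF f z] laurent_on_summable[OF g z]
    by (intro has_sum_times) (simp_all add: a_def[abs_def] b_def[abs_def] norm_mult norm_power_int)
  then have s: "((\<lambda>(n,k). a k * b (n - k)) has_sum F z * G z) (UNIV \<times> UNIV)"
    using has_sum_reindex_bij_betw[OF bij_conv, of "\<lambda>(j,k). a j * b k"] by (simp add: case_prod_unfold)
  have ab: "a k * b (n - k) = of_real (f k * g (n - k)) * z powi n" for n k
    using z0 by (simp add: a_def b_def power_int_diff)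
  have inner: "((\<lambda>k. a k * b (n - k)) has_sum (of_real (conv f g n) * z powi n)) UNIV" for n
  proof -
    have "(\<lambda>k. a k * b (n - k)) summable_on UNIV"
      using summable_on_SigmaD1[of "\<lambda>n k. a k * b (n - k)" UNIV "\<lambda>_. UNIV" n] s by (auto simp: summable_on_def)
    \<comment> \<open>Dividing by the nonzero power shows that the coefficient sum converges, so
      that \<open>conv f g n\<close> is its actual sum and not the default value 0 of a divergent
      \<open>infsum\<close>.\<close>
    then have "(\<lambda>k. of_real (f k * g (n - k)) * z powi n * inverse (z powi n)) summable_on UNIV"
      unfolding ab by (rule summable_on_cmult_left)
    then have "(\<lambda>k. complex_of_real (f k * g (n - k))) summable_on UNIV"
      using z0 by (simp add: mult.assoc)
    then have "(\<lambda>k. Re (of_real (f k * g (n - k)))) summable_on UNIV" by (rule summable_on_Re)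
    then have "((\<lambda>k. f k * g (n - k)) has_sum conv f g n) UNIV"
      unfolding conv_def by simp
    then have "((\<lambda>k. complex_of_real (f k * g (n - k))) has_sum of_real (conv f g n)) UNIV"
      by (rule has_sum_of_real)
    then show ?thesis unfolding ab by (rule has_sum_cmult_left)
  qed
  show "((\<lambda>n. of_real (conv f g n) * z powi n) has_sum F z * G z) UNIV"
    by (rule has_sum_SigmaD[OF s]) (use inner in auto)
qed

section \<open>Fourier integrals for the coefficients, and their uniqueness\<close>

lemma integral_exp_int:
  "((\<lambda>\<theta>. exp (\<i> * of_int k * of_real \<theta>)) has_integral (if k = 0 then 2 * of_real pi else 0)) {-pi..pi}"
proof (cases "k = 0")
  case True
  then show ?thesis using has_integral_const_real[of "1::complex" "-pi" pi] by (simp add: scaleR_conv_of_real)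
next
  case False
  define g where "g z = exp (\<i> * of_int k * z) / (\<i> * of_int k)" for z :: complex
  have "((\<lambda>\<theta>. exp (\<i> * of_int k * of_real \<theta>)) has_integral (g (of_real pi) - g (of_real (-pi)))) {-pi..pi}"
  proof (rule fundamental_theorem_of_calculus)
    fix t :: real
    have "(g has_field_derivative exp (\<i> * of_int k * of_real t)) (at (of_real t))"
      unfolding g_def using False by (auto intro!: derivative_eq_intros)
    then show "((\<lambda>t. g (of_real t)) has_vector_derivative exp (\<i> * of_int k * of_real t)) (at t within {-pi..pi})"
      by (rule has_vector_derivative_real_field)
  qed simp
  moreover have "g (of_real pi) - g (of_real (-pi)) = 0"
  proof -
    have "exp (\<i> * of_int k * of_real pi) = exp (\<i> * of_int k * of_real (-pi))"
      by (subst exp_eq) (rule exI[of _ k], simp add: algebra_simps)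
    then show ?thesis by (simp add: g_def)
  qed
  ultimately show ?thesis using False by simp
qed

text \<open>Absolute summability of the coefficients gives uniform convergence on the circle by the
  Weierstrass test, which permits termwise integration.\<close>

lemma laurent_coeff_integral:
  assumes "laurent_on f F (sphere 0 1)"
  shows "((\<lambda>\<theta>. F (exp (\<i> * of_real \<theta>)) * exp (- \<i> * of_int n * of_real \<theta>)) has_integral of_real (2 * pi * f n)) {-pi..pi}"
proof -
  define h where "h j \<theta> = of_real (f j) * exp (\<i> * of_int (j - n) * of_real \<theta>)" for j and \<theta> :: real
  have summand: "of_real (f j) * exp (\<i> * of_real \<theta>) powi j * exp (- \<i> * of_int n * of_real \<theta>) = h j \<theta>" for j \<theta>
  proof -
    have "exp (\<i> * of_real \<theta>) powi j = exp (of_int j * (\<i> * of_real \<theta>))" by (simp add: exp_power_int)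
    moreover have "exp (of_int j * (\<i> * of_real \<theta>)) * exp (- \<i> * of_int n * of_real \<theta>) = exp (\<i> * of_int (j - n) * of_real \<theta>)"
      unfolding exp_add[symmetric] by (rule arg_cong[of _ _ exp]) (simp add: algebra_simps)
    ultimately show ?thesis by (simp only: h_def mult.assoc)
  qed
  have sm: "(\<lambda>j. \<bar>f j\<bar>) summable_on UNIV"
    by (rule laurent_on_abs_summable[OF assms, of 1]) auto
  have "uniform_limit (cbox (-pi) pi) (\<lambda>X \<theta>. \<Sum>j\<in>X. h j \<theta>) (\<lambda>\<theta>. \<Sum>\<^sub>\<infinity>j. h j \<theta>) (finite_subsets_at_top UNIV)"
    by (rule Weierstrass_m_test_general[OF _ sm]) (simp add: h_def norm_mult norm_exp_eq_Re)
  then obtain I J where IJ: "\<And>X. ((\<lambda>\<theta>. \<Sum>j\<in>X. h j \<theta>) has_integral I X) (cbox (-pi) pi)"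
      "((\<lambda>\<theta>. \<Sum>\<^sub>\<infinity>j. h j \<theta>) has_integral J) (cbox (-pi) pi)" "(I \<longlongrightarrow> J) (finite_subsets_at_top UNIV)"
    by (rule uniform_limit_integral_cbox) (auto simp: h_def intro!: continuous_intros)
  have hint: "(h j has_integral (if j = n then of_real (2 * pi * f n) else 0)) {-pi..pi}" for j
    using has_integral_mult_right[OF integral_exp_int[of "j - n"], of "of_real (f j)"]
    by (auto simp: h_def[abs_def] mult_ac)
  have I: "I X = of_real (2 * pi * f n)" if "finite X" "n \<in> X" for X
  proof -
    have "((\<lambda>\<theta>. \<Sum>j\<in>X. h j \<theta>) has_integral (\<Sum>j\<in>X. if j = n then of_real (2 * pi * f n) else 0)) {-pi..pi}"
      by (intro has_integral_sum hint that)
    then have "((\<lambda>\<theta>. \<Sum>j\<in>X. h j \<theta>) has_integral of_real (2 * pi * f n)) {-pi..pi}"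
      using that by simp
    moreover have "((\<lambda>\<theta>. \<Sum>j\<in>X. h j \<theta>) has_integral I X) {-pi..pi}"
      using IJ(1)[of X] by (simp only: interval_cbox)
    ultimately show ?thesis by (metis has_integral_unique)
  qed
  have "(I \<longlongrightarrow> of_real (2 * pi * f n)) (finite_subsets_at_top UNIV)"
    by (rule tendsto_eventually) (auto simp: eventually_finite_subsets_at_top I intro!: exI[of _ "{n}"])
  then have J: "J = of_real (2 * pi * f n)"
    using IJ(3) tendsto_unique finite_subsets_at_top_neq_bot by blast
  have "(\<Sum>\<^sub>\<infinity>j. h j \<theta>) = F (exp (\<i> * of_real \<theta>)) * exp (- \<i> * of_int n * of_real \<theta>)" for \<theta>
  proof -
    have "((\<lambda>j. of_real (f j) * exp (\<i> * of_real \<theta>) powi j) has_sum F (exp (\<i> * of_real \<theta>))) UNIV"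
      by (rule laurent_onD[OF assms]) (simp add: norm_exp_eq_Re)
    from has_sum_cmult_left[OF this, of "exp (- \<i> * of_int n * of_real \<theta>)"] show ?thesis
      unfolding summand by (rule infsumI)
  qed
  then show ?thesis using IJ(2) J by simp
qed

text \<open>Identities between coefficient sequences are proved through this lemma by comparing
  functions on the unit circle.\<close>

lemma laurent_on_unique:
  assumes "laurent_on f F (sphere 0 1)" "laurent_on g F (sphere 0 1)"
  shows "f = g"
proof
  fix n
  have "complex_of_real (2 * pi * f n) = of_real (2 * pi * g n)"
    using laurent_coeff_integral[OF assms(1), of n] laurent_coeff_integral[OF assms(2), of n]
    by (rule has_integral_unique)
  then have "2 * pi * f n = 2 * pi * g n" by (simp only: of_real_eq_iff)
  then show "f n = g n" by simp
qed

lemma laurent_on_zmonom: "laurent_on (\<lambda>j. if j = n then c else 0) (\<lambda>z. of_real c * z powi n) R"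
  unfolding laurent_on_def
  by (intro ballI has_sum_finite_neutralI[of "{n}"]) auto

lemma laurent_on_add:
  "laurent_on f F R \<Longrightarrow> laurent_on g G R \<Longrightarrow> laurent_on (\<lambda>j. f j + g j) (\<lambda>z. F z + G z) R"
  by (auto simp: laurent_on_def distrib_right intro!: has_sum_add)

lemma laurent_on_nat:
  assumes "\<And>z. z \<in> R \<Longrightarrow> (\<lambda>n. of_real (f n) * z ^ n) sums F z"
    and "\<And>z. z \<in> R \<Longrightarrow> summable (\<lambda>n. norm (of_real (f n) * z ^ n))"
  shows "laurent_on (\<lambda>j. if j \<ge> 0 then f (nat j) else 0) F R"
  unfolding laurent_on_def
proof
  fix z assume z: "z \<in> R"
  have "((\<lambda>n. of_real (f n) * z ^ n) has_sum F z) UNIV"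
    using norm_summable_imp_has_sum[OF assms(2)[OF z] assms(1)[OF z]] .
  then have "(((\<lambda>j. of_real (if j \<ge> 0 then f (nat j) else 0) * z powi j) \<circ> int) has_sum F z) UNIV"
    by (simp add: o_def power_int_of_nat)
  then have "((\<lambda>j. of_real (if j \<ge> 0 then f (nat j) else 0) * z powi j) has_sum F z) (range int)"
    by (subst has_sum_reindex) auto
  also have "?this \<longleftrightarrow> ((\<lambda>j. of_real (if j \<ge> 0 then f (nat j) else 0) * z powi j) has_sum F z) UNIV"
  proof (rule has_sum_cong_neutral)
    fix j :: int assume "j \<in> UNIV - range int"
    then have "j < 0" by (metis DiffD2 nonneg_int_cases not_less rangeI)
    then show "of_real (if j \<ge> 0 then f (nat j) else 0) * z powi j = 0" by simp
  qed auto
  finally show "((\<lambda>j. of_real (if j \<ge> 0 then f (nat j) else 0) * z powi j) has_sum F z) UNIV" .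
qed

lemma of_real_gbinomial': "complex_of_real (a gchoose n) = of_real a gchoose n"
  by (simp add: gbinomial_prod_rev)

lemma laurent_on_binomial:
  fixes a \<alpha> :: real
  assumes "\<And>z. z \<in> R \<Longrightarrow> norm (of_real a * z) < 1"
  shows "laurent_on (\<lambda>j. if j \<ge> 0 then (\<alpha> gchoose nat j) * a ^ nat j else 0)
           (\<lambda>z. (1 + of_real a * z) powr of_real \<alpha>) R"
proof (rule laurent_on_nat)
  fix z assume z: "z \<in> R"
  have e: "of_real ((\<alpha> gchoose n) * a ^ n) * z ^ n = (of_real \<alpha> gchoose n) * (of_real a * z) ^ n" for n
    by (simp add: of_real_gbinomial' power_mult_distrib)
  show "(\<lambda>n. of_real ((\<alpha> gchoose n) * a ^ n) * z ^ n) sums (1 + of_real a * z) powr of_real \<alpha>"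
    unfolding e by (rule gen_binomial_complex[OF assms[OF z]])
  \<comment> \<open>Convergence of the power series at the larger radius \<open>r\<close> yields
    absolute convergence at the given point.\<close>
  obtain r where r: "norm (of_real a * z) < r" "r < 1" using dense[OF assms[OF z]] by blast
  have r0: "r > 0" using r by (meson norm_ge_zero order_le_less_trans)
  have "summable (\<lambda>n. (of_real \<alpha> gchoose n) * (complex_of_real r) ^ n)"
    using gen_binomial_complex[of "of_real r" "of_real \<alpha>"] r r0 by (auto simp: sums_iff)
  from powser_insidea[OF this, of "of_real a * z"] r r0
  show "summable (\<lambda>n. norm (of_real ((\<alpha> gchoose n) * a ^ n) * z ^ n))" unfolding e by simp
qed

lemma laurent_on_reflect:
  assumes "laurent_on f F S" "\<And>z. z \<in> R \<Longrightarrow> 1 / z \<in> S"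
  shows "laurent_on (\<lambda>j. f (- j)) (\<lambda>z. F (1 / z)) R"
  unfolding laurent_on_def
proof
  fix z assume z: "z \<in> R"
  have "((\<lambda>j. of_real (f j) * (1 / z) powi j) has_sum F (1 / z)) UNIV"
    using laurent_onD[OF assms(1) assms(2)[OF z]] .
  also have "?this \<longleftrightarrow> ((\<lambda>j. of_real (f (- j)) * z powi j) has_sum F (1 / z)) UNIV"
    by (rule has_sum_reindex_bij_witness[where i=uminus and j=uminus])
       (auto simp: power_int_minus power_int_divide_distrib inverse_eq_divide)
  finally show "((\<lambda>j. of_real (f (- j)) * z powi j) has_sum F (1 / z)) UNIV" .
qed

lemma laurent_on_neg:
  assumes "laurent_on f F S" "\<And>z. z \<in> R \<Longrightarrow> - z \<in> S"
  shows "laurent_on (\<lambda>j. (-1) powi j * f j) (\<lambda>z. F (- z)) R"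
  unfolding laurent_on_def
proof
  fix z assume z: "z \<in> R"
  have "(- z) powi j = (-1) powi j * z powi j" for j
    using power_int_mult_distrib[of "-1" z j] by simp
  then have "of_real (f j) * (- z) powi j = of_real ((-1) powi j * f j) * z powi j" for j
    by (simp add: of_real_power_int mult_ac)
  then show "((\<lambda>j. of_real ((-1) powi j * f j) * z powi j) has_sum F (- z)) UNIV"
    using laurent_onD[OF assms(1) assms(2)[OF z]] by (simp only:)
qed

lemma laurent_on_square:
  assumes "laurent_on f F S" "\<And>z. z \<in> R \<Longrightarrow> z\<^sup>2 \<in> S"
  shows "laurent_on (\<lambda>j. if even j then f (j div 2) else 0) (\<lambda>z. F (z\<^sup>2)) R"
  unfolding laurent_on_def
proof
  fix z assume z: "z \<in> R"
  have "(z\<^sup>2) powi j = z powi (2 * j)" for j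
    by (metis power_int_mult power_int_numeral)
  then have "((\<lambda>j. of_real (f j) * z powi (2 * j)) has_sum F (z\<^sup>2)) UNIV"
    using laurent_onD[OF assms(1) assms(2)[OF z]] by simp
  then have "(((\<lambda>j. of_real (if even j then f (j div 2) else 0) * z powi j) \<circ> (\<lambda>j. 2 * j)) has_sum F (z\<^sup>2)) UNIV"
    by (simp add: o_def)
  then have "((\<lambda>j. of_real (if even j then f (j div 2) else 0) * z powi j) has_sum F (z\<^sup>2)) (range (\<lambda>j. 2 * j))"
    by (subst has_sum_reindex) (auto simp: inj_on_def)
  also have "?this \<longleftrightarrow> ((\<lambda>j. of_real (if even j then f (j div 2) else 0) * z powi j) has_sum F (z\<^sup>2)) UNIV"
    by (rule has_sum_cong_neutral) (auto elim!: evenE)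
  finally show "((\<lambda>j. of_real (if even j then f (j div 2) else 0) * z powi j) has_sum F (z\<^sup>2)) UNIV" .
qed

lemma laurent_on_shift:
  assumes "laurent_on f F R" "0 \<notin> R"
  shows "laurent_on (\<lambda>j. f (j - n)) (\<lambda>z. z powi n * F z) R"
  unfolding laurent_on_def
proof
  fix z assume z: "z \<in> R"
  then have z0: "z \<noteq> 0" using assms by auto
  have "((\<lambda>j. z powi n * (of_real (f j) * z powi j)) has_sum z powi n * F z) UNIV"
    by (rule has_sum_cmult_right[OF laurent_onD[OF assms(1) z]])
  also have "?this \<longleftrightarrow> ((\<lambda>j. of_real (f (j - n)) * z powi j) has_sum z powi n * F z) UNIV"
    by (rule has_sum_reindex_bij_witness[where i="\<lambda>j. j - n" and j="\<lambda>j. j + n"])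
       (auto simp: power_int_add z0)
  finally show "((\<lambda>j. of_real (f (j - n)) * z powi j) has_sum z powi n * F z) UNIV" .
qed

lemma laurent_on_cmult: "laurent_on f F R \<Longrightarrow> laurent_on (\<lambda>j. c * f j) (\<lambda>z. of_real c * F z) R"
  by (auto simp: laurent_on_def mult.assoc intro!: has_sum_cmult_right)

text \<open>For most factors only the existence of an expansion matters; the coefficients of the
  product are identified afterwards by uniqueness.\<close>

definition has_laurent :: "(complex \<Rightarrow> complex) \<Rightarrow> complex set \<Rightarrow> bool" where
  "has_laurent F R \<longleftrightarrow> (\<exists>f. laurent_on f F R)"

lemma has_laurent_mult: "has_laurent F R \<Longrightarrow> has_laurent G R \<Longrightarrow> 0 \<notin> R \<Longrightarrow> has_laurent (\<lambda>z. F z * G z) R"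
  using laurent_on_mult unfolding has_laurent_def by blast

lemma has_laurent_zmonom: "has_laurent (\<lambda>z. of_real c * z powi n) R"
  using laurent_on_zmonom unfolding has_laurent_def by blast

lemma has_laurent_const: "has_laurent (\<lambda>z. of_real c) R"
  using has_laurent_zmonom[of c 0] by simp

lemma has_laurent_linear: "has_laurent (\<lambda>z. of_real a + of_real b * z) R"
  using laurent_on_add[OF laurent_on_zmonom[of 0 a R] laurent_on_zmonom[of 1 b R]]
  unfolding has_laurent_def by auto

lemma has_laurent_power: "has_laurent F R \<Longrightarrow> 0 \<notin> R \<Longrightarrow> has_laurent (\<lambda>z. F z ^ n) R"
proof (induction n)
  case 0
  then show ?case using has_laurent_const[of 1] by simp
qed (simp add: has_laurent_mult)

lemma has_laurent_prod:
  "finite K \<Longrightarrow> 0 \<notin> R \<Longrightarrow> (\<And>k. k \<in> K \<Longrightarrow> has_laurent (F k) R) \<Longrightarrow> has_laurent (\<lambda>z. \<Prod>k\<in>K. F k z) R"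
proof (induction K rule: finite_induct)
  case empty
  then show ?case using has_laurent_const[of 1] by simp
qed (simp add: has_laurent_mult)

lemma has_laurent_binomial:
  "(\<And>z. z \<in> R \<Longrightarrow> norm (of_real a * z) < 1) \<Longrightarrow> has_laurent (\<lambda>z. (1 + of_real a * z) powr of_real \<alpha>) R"
  using laurent_on_binomial unfolding has_laurent_def by blast

lemma has_laurent_reflect: "has_laurent F S \<Longrightarrow> (\<And>z. z \<in> R \<Longrightarrow> 1 / z \<in> S) \<Longrightarrow> has_laurent (\<lambda>z. F (1 / z)) R"
  using laurent_on_reflect unfolding has_laurent_def by blast

lemma has_laurent_neg: "has_laurent F S \<Longrightarrow> (\<And>z. z \<in> R \<Longrightarrow> - z \<in> S) \<Longrightarrow> has_laurent (\<lambda>z. F (- z)) R"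
  using laurent_on_neg unfolding has_laurent_def by blast

lemma has_laurent_square: "has_laurent F S \<Longrightarrow> (\<And>z. z \<in> R \<Longrightarrow> z\<^sup>2 \<in> S) \<Longrightarrow> has_laurent (\<lambda>z. F (z\<^sup>2)) R"
  using laurent_on_square unfolding has_laurent_def by blast

lemma has_laurent_cong: "has_laurent F R \<Longrightarrow> (\<And>z. z \<in> R \<Longrightarrow> F z = G z) \<Longrightarrow> has_laurent G R"
  using laurent_on_cong unfolding has_laurent_def by blast

text \<open>Only \<open>b\<close> lacks summability: it will be the difference of two candidates for
  the two-scale constants, which is just bounded. Two summable factors still dominate the double
  series.\<close>

lemma conv_assoc_bounded:
  assumes b: "\<And>j. \<bar>b j\<bar> \<le> M" and c: "(\<lambda>j. \<bar>c j\<bar>) summable_on UNIV" and d: "(\<lambda>j. \<bar>d j\<bar>) summable_on UNIV"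
  shows "conv (conv b c) d n = conv b (conv c d) n"
proof -
  have bij: "bij_betw (\<lambda>(k,l). (k - l, n - k)) (UNIV \<times> UNIV) (UNIV \<times> (UNIV :: int set))"
    by (rule bij_betwI[of _ _ _ "\<lambda>(p,q). (n - q, n - q - p)"]) auto
  have "(\<lambda>(p,q). norm (c p * d q)) summable_on (UNIV \<times> UNIV)"
    by (rule abs_summable_times) (use c d in auto)
  then have "(\<lambda>(p,q). \<bar>c p * d q\<bar>) summable_on (UNIV \<times> UNIV)" by (simp add: case_prod_unfold)
  then have "(\<lambda>(k,l). \<bar>c (k - l) * d (n - k)\<bar>) summable_on (UNIV \<times> UNIV)"
    using summable_on_reindex_bij_betw[OF bij, of "\<lambda>(p,q). \<bar>c p * d q\<bar>"] by (simp add: case_prod_unfold)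
  then have "(\<lambda>x. M * (case x of (k,l) \<Rightarrow> \<bar>c (k - l) * d (n - k)\<bar>)) summable_on (UNIV \<times> UNIV)"
    by (rule summable_on_cmult_right)
  then have "(\<lambda>x. norm (case x of (k,l) \<Rightarrow> b l * c (k - l) * d (n - k))) summable_on (UNIV \<times> UNIV)"
    by (rule summable_on_comparison_test)
       (auto simp: abs_mult mult.assoc intro!: mult_right_mono b)
  then have s: "(\<lambda>(k,l). b l * c (k - l) * d (n - k)) summable_on (UNIV \<times> UNIV)"
    by (rule abs_summable_summable)
  have e: "(\<Sum>\<^sub>\<infinity>k. c (k - l) * d (n - k)) = conv c d (n - l)" for l
    unfolding conv_def
    by (rule infsum_reindex_bij_witness[where i="\<lambda>k. k + l" and j="\<lambda>k. k - l"]) (auto simp: algebra_simps)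
  have "conv (conv b c) d n = (\<Sum>\<^sub>\<infinity>k. \<Sum>\<^sub>\<infinity>l. b l * c (k - l) * d (n - k))"
    by (simp add: conv_def infsum_cmult_left')
  also have "\<dots> = (\<Sum>\<^sub>\<infinity>l. \<Sum>\<^sub>\<infinity>k. b l * c (k - l) * d (n - k))"
    by (rule infsum_swap_banach[OF s])
  also have "\<dots> = (\<Sum>\<^sub>\<infinity>l. b l * conv c d (n - l))"
    by (simp add: mult.assoc infsum_cmult_right' e)
  finally show ?thesis by (simp add: conv_def[of b])
qed

section \<open>Euler--Frobenius roots\<close>

text \<open>Subtracting the product cancels the coefficient of index \<open>d\<close>, and a nonzero
  polynomial of degree below \<open>d\<close> cannot have \<open>d\<close> zeros. As
  \<open>d\<close> is only a bound on the degree, that coefficient need not be known to be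
  nonzero.\<close>

lemma poly_eq_prod_roots:
  fixes p :: "'a::field poly"
  assumes "degree p \<le> d" "finite S" "card S = d" "\<And>x. x \<in> S \<Longrightarrow> poly p x = 0"
  shows "p = smult (coeff p d) (\<Prod>x\<in>S. [:- x, 1:])"
proof (rule ccontr)
  define P where "P = (\<Prod>x\<in>S. [:- x, 1:])"
  define q where "q = p - smult (coeff p d) P"
  assume "p \<noteq> smult (coeff p d) (\<Prod>x\<in>S. [:- x, 1:])"
  then have q0: "q \<noteq> 0" by (simp add: q_def P_def)
  have degP: "degree P = d" unfolding P_def using assms(3)
    by (subst degree_prod_eq_sum_degree) auto
  have "lead_coeff P = 1" unfolding P_def by (simp add: lead_coeff_prod)
  then have "coeff q d = 0" by (simp add: q_def degP)
  moreover have "degree q \<le> d"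
    unfolding q_def by (intro degree_diff_le assms(1) order_trans[OF degree_smult_le]) (simp add: degP)
  ultimately have "degree q < d" using q0
    by (metis coeff_0_degree_minus_1 le_neq_implies_less leading_coeff_0_iff)
  moreover have "d \<le> degree q"
  proof -
    have "S \<subseteq> {x. poly q x = 0}"
      using assms by (auto simp: q_def P_def poly_prod intro!: prod_zero)
    then have "card S \<le> card {x. poly q x = 0}" using poly_roots_finite[OF q0] card_mono by blast
    also have "\<dots> \<le> degree q" by (rule card_poly_roots_bound[OF q0])
    finally show ?thesis using assms by simp
  qed
  ultimately show False by simp
qed

text \<open>The position of a value in a decreasing list is the number of listed values that are not
  smaller, and this depends on the set of values alone.\<close>

lemma strict_antimono_enumeration_unique:
  fixes f g :: "nat \<Rightarrow> 'a::linorder"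
  assumes f: "strict_antimono_on {1..n} f" and g: "strict_antimono_on {1..n} g"
    and im: "f ` {1..n} = g ` {1..n}" and k: "k \<in> {1..n}"
  shows "f k = g k"
proof -
  have c: "card {y \<in> h ` {1..n}. h k \<le> y} = k" if h: "strict_antimono_on {1..n} h" and k: "k \<in> {1..n}"
    for h :: "nat \<Rightarrow> 'a" and k
  proof -
    have lt: "h j < h i" if "i < j" "i \<in> {1..n}" "j \<in> {1..n}" for i j
      using monotone_onD[OF h that(2,3,1)] .
    have "inj_on h {1..n}"
    proof (rule linorder_inj_onI)
      show "h i \<noteq> h j" if "i < j" "i \<in> {1..n}" "j \<in> {1..n}" for i j
        using lt[OF that] by simp
    qed auto
    moreover have "{y \<in> h ` {1..n}. h k \<le> y} = h ` {1..k}"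
    proof (intro equalityI subsetI)
      fix y assume "y \<in> {y \<in> h ` {1..n}. h k \<le> y}"
      then obtain i where i: "i \<in> {1..n}" "y = h i" "h k \<le> h i" by auto
      then have "\<not> k < i" using lt[of k i] k by auto
      then show "y \<in> h ` {1..k}" using i by auto
    next
      fix y assume "y \<in> h ` {1..k}"
      then obtain i where i: "i \<in> {1..k}" "y = h i" by auto
      then have "h k \<le> h i" using lt[of i k] k by (cases "i = k") auto
      then show "y \<in> {y \<in> h ` {1..n}. h k \<le> y}" using i k by auto
    qed
    ultimately show ?thesis using k
      by (simp add: card_image inj_on_subset)
  qed
  obtain l where l: "l \<in> {1..n}" "f k = g l" using im k by (metis imageE imageI)
  have "k = card {y \<in> f ` {1..n}. f k \<le> y}" using c[OF f k] by simp
  also have "\<dots> = card {y \<in> g ` {1..n}. g l \<le> y}" using im l by simp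
  also have "\<dots> = l" using c[OF g l(1)] .
  finally show ?thesis using l by simp
qed

lemma poly_euler_frobenius:
  assumes "m \<ge> 1"
  shows "of_real (x * poly (euler_frobenius m) x) = fact (2 * m - 1) * poly (bpoly (2 * m)) (of_real x)"
proof -
  define N where "N = bspline (2 * m)"
  have "poly (euler_frobenius m) x = fact (2 * m - 1) * (\<Sum>k=-int m + 1..int m - 1. N (of_int (int m + k)) * x ^ nat (int m - 1 + k))"
    by (simp add: euler_frobenius_def poly_sum poly_monom N_def)
  also have "(\<Sum>k=-int m + 1..int m - 1. N (of_int (int m + k)) * x ^ nat (int m - 1 + k)) = (\<Sum>i\<in>{1..2*m-1}. N (real i) * x ^ (i - 1))"
    by (rule sum.reindex_bij_witness[where i="\<lambda>i. int i - int m" and j="\<lambda>k. nat (int m + k)"])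
       (auto simp: nat_diff_distrib' intro!: arg_cong2[where f="(*)"] arg_cong[where f="\<lambda>k. x ^ k"])
  finally have "x * poly (euler_frobenius m) x = fact (2 * m - 1) * (\<Sum>i\<in>{1..2*m-1}. N (real i) * (x * x ^ (i - 1)))"
    by (simp add: sum_distrib_left mult_ac)
  also have "(\<Sum>i\<in>{1..2*m-1}. N (real i) * (x * x ^ (i - 1))) = (\<Sum>i\<in>{1..2*m-1}. N (real i) * x ^ i)"
    by (intro sum.cong refl) (metis atLeastAtMost_iff less_le_trans power_eq_if zero_less_one not_one_le_zero)
  also have "\<dots> = (\<Sum>i\<le>2*m. N (real i) * x ^ i)"
  proof (rule sum.mono_neutral_left)
    show "\<forall>i\<in>{..2 * m} - {1..2 * m - 1}. N (real i) * x ^ i = 0"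
    proof
      fix i assume "i \<in> {..2 * m} - {1..2 * m - 1}"
      then have "i = 0 \<or> i = 2 * m" using assms by auto
      then show "N (real i) * x ^ i = 0"
        using assms by (auto simp: N_def bspline_at_0 bspline_eq_0_right)
    qed
  qed auto
  finally have "x * poly (euler_frobenius m) x = fact (2 * m - 1) * (\<Sum>i\<le>2*m. N (real i) * x ^ i)" .
  then have "complex_of_real (x * poly (euler_frobenius m) x) = of_real (fact (2 * m - 1) * (\<Sum>i\<le>2*m. N (real i) * x ^ i))"
    by (rule arg_cong)
  then show ?thesis by (simp add: poly_bpoly N_def)
qed

lemma poly_bpoly_palindrome:
  assumes "n \<ge> 2" "z \<noteq> 0"
  shows "poly (bpoly n) z = z ^ n * poly (bpoly n) (1 / z)"
proof -
  have "poly (bpoly n) z = (\<Sum>k\<le>n. of_real (bspline n (real (n - k))) * z ^ (n - k))"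
    unfolding poly_bpoly by (rule sum.reindex_bij_witness[where i="\<lambda>k. n - k" and j="\<lambda>k. n - k"]) auto
  also have "\<dots> = (\<Sum>k\<le>n. z ^ n * (of_real (bspline n (real k)) * (1 / z) ^ k))"
  proof (intro sum.cong refl)
    fix k assume "k \<in> {..n}"
    then have "bspline n (real (n - k)) = bspline n (real k)" "z ^ (n - k) = z ^ n * (1 / z) ^ k"
      using assms bspline_int_symmetric[OF assms(1), of k] by (auto simp: power_diff power_one_over field_simps)
    then show "of_real (bspline n (real (n - k))) * z ^ (n - k) = z ^ n * (of_real (bspline n (real k)) * (1 / z) ^ k)"
      by (simp only: mult_ac)
  qed
  finally show ?thesis by (simp add: poly_bpoly sum_distrib_left)
qed

text \<open>The t k are the absolute values of the roots inside the unit circle; the other roots are their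
  reciprocals.\<close>

locale spline_roots =
  fixes m :: nat and t :: "nat \<Rightarrow> real" and c :: real
  assumes m: "m \<ge> 2"
    and t_bounds: "\<And>k. k \<in> {1..<m} \<Longrightarrow> 0 < t k \<and> t k < 1"
    and t_less: "\<And>k. k \<in> {1..<m-1} \<Longrightarrow> t k < t (m - 1)"
    and c_pos: "c > 0"
    and bpoly_factor: "\<And>z. z \<noteq> 0 \<Longrightarrow> poly (bpoly (2 * m)) z =
       z ^ m * (of_real c * (\<Prod>k\<in>{1..<m}. (1 + of_real (t k) / z) * (1 + of_real (t k) * z)))"

text \<open>The palindromic symmetry maps roots to reciprocals. Inversion followed by reversal of
  the order is again a decreasing enumeration of the same set, so it is the original one: root k is
  paired with root 2m - 1 - k, and the first m - 1 roots lie in (-1, 0).\<close>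

lemma euler_frobenius_roots_imp:
  assumes m: "m \<ge> 2" and lam: "euler_frobenius_roots m lam"
  shows "\<exists>c. spline_roots m (\<lambda>k. - lam k) c"
proof -
  define n where "n = 2 * m - 2"
  have neg: "lam k < 0" and root: "poly (euler_frobenius m) (lam k) = 0" if "k \<in> {1..n}" for k
    using lam that by (auto simp: euler_frobenius_roots_def n_def)
  have anti: "strict_antimono_on {1..n} lam" using lam by (auto simp: euler_frobenius_roots_def n_def)
  have lt: "lam j < lam i" if "i < j" "i \<in> {1..n}" "j \<in> {1..n}" for i j
    using monotone_onD[OF anti that(2,3,1)] .
  have inj: "inj_on lam {1..n}"
  proof (rule linorder_inj_onI)
    show "lam i \<noteq> lam j" if "i < j" "i \<in> {1..n}" "j \<in> {1..n}" for i j
      using lt[OF that] by simp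
  qed auto
  define p where "p = bpoly (2 * m)"
  \<comment> \<open>The additional root 0 completes the count to 2m - 1, which bounds the degree of
    \<open>p\<close>.\<close>
  define S where "S = insert 0 (complex_of_real ` lam ` {1..n})"
  have S0: "0 \<notin> complex_of_real ` lam ` {1..n}"
  proof
    assume "0 \<in> complex_of_real ` lam ` {1..n}"
    then obtain k where k: "k \<in> {1..n}" "0 = complex_of_real (lam k)" by blast
    then show False using neg[OF k(1)] by simp
  qed
  have inj2: "inj_on (\<lambda>k. complex_of_real (lam k)) {1..n}" 
    using inj unfolding inj_on_def of_real_eq_iff .
  have cardS: "card S = 2 * m - 1"
  proof -
    have "card (complex_of_real ` lam ` {1..n}) = n"
      using card_image[OF inj2] by (simp only: image_image card_atLeastAtMost diff_Suc_1)
    moreover have "card S = Suc (card (complex_of_real ` lam ` {1..n}))"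
      unfolding S_def by (rule card_insert_disjoint[OF _ S0]) simp
    ultimately show ?thesis using m by (simp only: n_def)
  qed
  have proot: "poly p x = 0" if "x \<in> S" for x
  proof (cases "x = 0")
    case True
    then show ?thesis using m by (simp add: p_def poly_0_coeff_0 coeff_bpoly bspline_at_0)
  next
    case False
    then obtain k where "k \<in> {1..n}" "x = of_real (lam k)" using \<open>x \<in> S\<close> by (auto simp: S_def)
    then show ?thesis using poly_euler_frobenius[of m "lam k"] root[of k] m by (simp add: p_def)
  qed
  have deg: "degree p \<le> 2 * m - 1"
    by (rule degree_le) (auto simp: p_def coeff_bpoly bspline_eq_0_right)
  define A where "A = bspline (2 * m) (real (2 * m - 1))"
  have p: "p = smult (of_real A) (\<Prod>x\<in>S. [:- x, 1:])"
    using poly_eq_prod_roots[OF deg _ cardS proot] by (simp add: p_def coeff_bpoly A_def S_def)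
  have pz: "poly p z = of_real A * (z * (\<Prod>k\<in>{1..n}. z - of_real (lam k)))" for z
  proof -
    have "poly p z = of_real A * (\<Prod>x\<in>S. z - x)"
      unfolding p by (simp add: poly_prod)
    also have "(\<Prod>x\<in>S. z - x) = z * (\<Prod>x\<in>complex_of_real ` lam ` {1..n}. z - x)"
      unfolding S_def using S0 by (subst prod.insert) auto
    also have "(\<Prod>x\<in>complex_of_real ` lam ` {1..n}. z - x) = (\<Prod>k\<in>{1..n}. z - of_real (lam k))"
      using prod.reindex[OF inj2, of "\<lambda>x. z - x"] by (simp add: image_image o_def)
    finally show ?thesis .
  qed
  have p1: "poly p 1 = 1" using poly_bpoly_1[of "2 * m"] m by (simp add: p_def)
  then have A0: "A \<noteq> 0" using pz[of 1] by auto
  have inv_mem: "1 / lam k \<in> lam ` {1..n}" if k: "k \<in> {1..n}" for k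
  proof -
    have "poly p (of_real (lam k)) = 0" by (rule proot) (use k in \<open>auto simp: S_def\<close>)
    then have "poly p (of_real (1 / lam k)) = 0"
      using poly_bpoly_palindrome[of "2 * m" "of_real (lam k)"] m neg[OF k] by (simp add: p_def)
    then have "(\<Prod>i\<in>{1..n}. complex_of_real (1 / lam k) - of_real (lam i)) = 0"
      using A0 neg[OF k] by (simp add: pz del: of_real_divide)
    then obtain i where i: "i \<in> {1..n}" "complex_of_real (1 / lam k) - of_real (lam i) = 0"
      by (auto simp: prod_zero_iff simp del: of_real_divide)
    then have "1 / lam k = lam i" by (simp del: of_real_divide)
    then show ?thesis using i by auto
  qed
  have pair: "lam k = 1 / lam (n + 1 - k)" if k: "k \<in> {1..n}" for k
  proof (rule strict_antimono_enumeration_unique[OF anti _ _ k])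
    show "strict_antimono_on {1..n} (\<lambda>k. 1 / lam (n + 1 - k))"
    proof (rule monotone_onI)
      fix i j assume ij: "i \<in> {1..n}" "j \<in> {1..n}" "i < j"
      then have "n + 1 - i \<in> {1..n}" "n + 1 - j \<in> {1..n}" "n + 1 - j < n + 1 - i" by auto
      then show "1 / lam (n + 1 - i) > 1 / lam (n + 1 - j)"
        using lt[of "n + 1 - j" "n + 1 - i"] neg[of "n + 1 - i"] neg[of "n + 1 - j"]
        by (simp add: frac_less2 divide_simps)
    qed
    show "lam ` {1..n} = (\<lambda>k. 1 / lam (n + 1 - k)) ` {1..n}"
    proof (rule card_subset_eq[symmetric])
      show "(\<lambda>k. 1 / lam (n + 1 - k)) ` {1..n} \<subseteq> lam ` {1..n}"
      proof (rule image_subsetI)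
        fix i assume "i \<in> {1..n}"
        then have "n + 1 - i \<in> {1..n}" by auto
        then show "1 / lam (n + 1 - i) \<in> lam ` {1..n}" by (rule inv_mem)
      qed
      have "inj_on (\<lambda>k. 1 / lam (n + 1 - k)) {1..n}"
      proof (rule inj_onI)
        fix i j assume ij: "i \<in> {1..n}" "j \<in> {1..n}" "1 / lam (n + 1 - i) = 1 / lam (n + 1 - j)"
        then have "lam (n + 1 - i) = lam (n + 1 - j)" by (metis inverse_eq_divide inverse_eq_iff_eq)
        moreover have "n + 1 - i \<in> {1..n}" "n + 1 - j \<in> {1..n}" using ij by auto
        ultimately have "n + 1 - i = n + 1 - j" by (rule inj_onD[OF inj])
        then show "i = j" using ij by auto
      qed
      then show "card ((\<lambda>k. 1 / lam (n + 1 - k)) ` {1..n}) = card (lam ` {1..n})"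
        using inj by (simp add: card_image)
    qed simp
  qed
  define t where "t k = - lam k" for k
  have sub: "k \<in> {1..n}" "n + 1 - k \<in> {1..n}" "k < n + 1 - k" if "k \<in> {1..<m}" for k
    using that by (auto simp: n_def)
  have tb: "0 < t k \<and> t k < 1" if k: "k \<in> {1..<m}" for k
  proof -
    have "lam k > lam (n + 1 - k)" using lt sub[OF k] by blast
    moreover have "lam (n + 1 - k) = 1 / lam k"
    proof -
      have "n + 1 - (n + 1 - k) = k" using sub(1)[OF k] by auto
      then show ?thesis using pair[OF sub(2)[OF k]] by (simp only:)
    qed
    moreover have "lam k < 0" using neg sub[OF k] by blast
    ultimately have l: "1 / lam k < lam k" "lam k < 0" by auto
    have "lam k > -1"
    proof (rule ccontr)
      assume "\<not> lam k > -1"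
      then have "1 / lam k \<ge> -1" using l(2) by (simp add: divide_simps)
      then show False using l \<open>\<not> lam k > -1\<close> by linarith
    qed
    then show ?thesis using l by (simp add: t_def)
  qed
  \<comment> \<open>The factor 1 / t_k arises from z + 1/t_k = (1/t_k) (1 + t_k z), the factor of
    the reciprocal root.\<close>
  define c where "c = A * (\<Prod>k\<in>{1..<m}. 1 / t k)"
  have fac: "poly p z = z ^ m * (of_real c * (\<Prod>k\<in>{1..<m}. (1 + of_real (t k) / z) * (1 + of_real (t k) * z)))" if z: "z \<noteq> 0" for z
  proof -
    have "{1..n} = {1..<m} \<union> {m..n}" "{1..<m} \<inter> {m..n} = {}" using m by (auto simp: n_def)
    then have "(\<Prod>k\<in>{1..n}. z - of_real (lam k)) = (\<Prod>k\<in>{1..<m}. z - of_real (lam k)) * (\<Prod>k\<in>{m..n}. z - of_real (lam k))"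
      by (simp add: prod.union_disjoint)
    also have "(\<Prod>k\<in>{m..n}. z - of_real (lam k)) = (\<Prod>k\<in>{1..<m}. z - of_real (lam (n + 1 - k)))"
      using m by (intro prod.reindex_bij_witness[where i="\<lambda>k. n + 1 - k" and j="\<lambda>k. n + 1 - k"]) (auto simp: n_def)
    also have "(\<Prod>k\<in>{1..<m}. z - of_real (lam k)) * \<dots> = (\<Prod>k\<in>{1..<m}. (z - of_real (lam k)) * (z - of_real (lam (n + 1 - k))))"
      by (simp add: prod.distrib)
    also have "\<dots> = (\<Prod>k\<in>{1..<m}. z * (of_real (1 / t k) * ((1 + of_real (t k) / z) * (1 + of_real (t k) * z))))"
    proof (rule prod.cong[OF refl])
      fix k assume k: "k \<in> {1..<m}"
      have "n + 1 - (n + 1 - k) = k" using sub(1)[OF k] by auto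
      then have "lam (n + 1 - k) = 1 / lam k" using pair[OF sub(2)[OF k]] by (simp only:)
      then have 1: "complex_of_real (lam (n + 1 - k)) = - 1 / of_real (t k)" by (simp add: t_def)
      have 2: "complex_of_real (lam k) = - of_real (t k)" by (simp add: t_def)
      have "complex_of_real (t k) \<noteq> 0" using tb[OF k] by auto
      then show "(z - of_real (lam k)) * (z - of_real (lam (n + 1 - k))) =
          z * (of_real (1 / t k) * ((1 + of_real (t k) / z) * (1 + of_real (t k) * z)))"
        unfolding 1 2 using z by (simp add: field_simps)
    qed
    also have "\<dots> = z ^ (m - 1) * (of_real (\<Prod>k\<in>{1..<m}. 1 / t k) * (\<Prod>k\<in>{1..<m}. (1 + of_real (t k) / z) * (1 + of_real (t k) * z)))"
      by (simp only: prod.distrib prod_constant card_atLeastLessThan of_real_prod)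
    finally show ?thesis using m unfolding pz c_def by (cases m) (simp_all add: mult_ac)
  qed
  \<comment> \<open>The value of \<open>p\<close> at 1 is 1, while every factor 1 + t_k is positive
    there.\<close>
  have "c > 0"
  proof -
    have "complex_of_real 1 = of_real (c * (\<Prod>k\<in>{1..<m}. (1 + t k) * (1 + t k)))"
      using fac[of 1] p1 by simp
    then have "1 = c * (\<Prod>k\<in>{1..<m}. (1 + t k) * (1 + t k))" by (simp only: of_real_eq_iff)
    moreover have "(\<Prod>k\<in>{1..<m}. (1 + t k) * (1 + t k)) > 0"
    proof (rule prod_pos, rule mult_pos_pos)
      show "1 + t k > 0" if "k \<in> {1..<m}" for k using tb[OF that] by auto
      then show "1 + t k > 0" if "k \<in> {1..<m}" for k using that .
    qed
    ultimately show ?thesis by (metis zero_less_mult_pos2 zero_less_one)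
  qed
  moreover have "t k < t (m - 1)" if "k \<in> {1..<m-1}" for k
    using lt[of k "m - 1"] that m by (auto simp: t_def n_def)
  ultimately have "spline_roots m t c"
    unfolding spline_roots_def using m tb fac by (auto simp: p_def)
  then show ?thesis unfolding t_def[abs_def] by blast
qed

section \<open>The argument of the symbol on the imaginary axis\<close>

lemma one_plus_i_polar: "1 + \<i> * of_real x = of_real (sqrt (1 + x\<^sup>2)) * cis (arctan x)"
proof -
  have "sqrt (1 + x\<^sup>2) \<noteq> 0" using sum_power2_gt_zero_iff[of 1 x] by simp
  then show ?thesis by (simp add: complex_eq_iff cos_arctan sin_arctan)
qed

lemma one_minus_i_polar: "1 - \<i> * of_real x = of_real (sqrt (1 + x\<^sup>2)) * cis (- arctan x)"
  using one_plus_i_polar[of "- x"] by (simp add: arctan_minus)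

lemma Ln_one_plus_i: "Ln (1 + \<i> * of_real x) = of_real (ln (sqrt (1 + x\<^sup>2))) + \<i> * of_real (arctan x)"
proof (rule Ln_unique)
  have "0 < 1 + x\<^sup>2" by (simp add: add_pos_nonneg)
  then show "exp (of_real (ln (sqrt (1 + x\<^sup>2))) + \<i> * of_real (arctan x)) = 1 + \<i> * of_real x"
    unfolding one_plus_i_polar by (simp add: exp_add cis_conv_exp exp_of_real)
  show "- pi < Im (of_real (ln (sqrt (1 + x\<^sup>2))) + \<i> * of_real (arctan x))"
  proof -
    have "- pi < arctan x" using arctan_lbound[of x] pi_gt_zero by linarith
    then show ?thesis by simp
  qed
  show "Im (of_real (ln (sqrt (1 + x\<^sup>2))) + \<i> * of_real (arctan x)) \<le> pi"
  proof -
    have "arctan x \<le> pi" using arctan_ubound[of x] pi_gt_zero by linarith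
    then show ?thesis by simp
  qed
qed

text \<open>The numbers 1 + ix and 1 - ix have equal moduli, which cancel, and opposite arguments;
  each power contributes half of arctan x. Positive real parts keep the principal branch
  harmless.\<close>

lemma powr_half_quotient: "(1 + \<i> * of_real x) powr (1/2) * (1 - \<i> * of_real x) powr (-1/2) = cis (arctan x)"
proof -
  have nz: "1 + \<i> * of_real x \<noteq> 0" "1 - \<i> * of_real x \<noteq> 0" by (auto simp: complex_eq_iff)
  have 1: "Ln (1 - \<i> * of_real x) = of_real (ln (sqrt (1 + x\<^sup>2))) - \<i> * of_real (arctan x)"
    using Ln_one_plus_i[of "- x"] by (simp add: arctan_minus)
  show ?thesis
    using nz by (simp add: powr_def Ln_one_plus_i 1 exp_add[symmetric] cis_conv_exp algebra_simps flip: exp_add)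
qed

context spline_roots
begin

definition s :: real where "s = sqrt (t (m - 1))"

text \<open>The angle Sigma of the overview as a function of u: the factors 1 + t/(iu) and 1 + t iu
  have arguments -arctan(t/u) and arctan(t u).\<close>

definition phase_sum :: "real \<Rightarrow> real" where
  "phase_sum u = (\<Sum>k\<in>{1..<m}. arctan (t k / u) - arctan (t k * u))"

lemma m1: "m - 1 \<in> {1..<m}" using m by auto

lemma s_bounds: "0 < s" "s < 1" "s\<^sup>2 = t (m - 1)"
  using t_bounds[OF m1] by (auto simp: s_def real_sqrt_lt_1_iff)

lemma t_le: "k \<in> {1..<m} \<Longrightarrow> t k \<le> s\<^sup>2"
  using t_less[of k] s_bounds(3) by (cases "k = m - 1") (auto simp: less_imp_le)

lemma bpoly_i:
  assumes u: "u > 0"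
  shows "\<exists>R>0. poly (bpoly (2 * m)) (\<i> * of_real u) = (\<i> * of_real u) ^ m * (of_real R * cis (- phase_sum u))"
proof -
  define R where "R = c * (\<Prod>k\<in>{1..<m}. sqrt (1 + (t k / u)\<^sup>2) * sqrt (1 + (t k * u)\<^sup>2))"
  have "R > 0" unfolding R_def using c_pos
    by (intro mult_pos_pos prod_pos ballI) (auto simp: add_pos_nonneg)
  moreover have "poly (bpoly (2 * m)) (\<i> * of_real u) = (\<i> * of_real u) ^ m * (of_real R * cis (- phase_sum u))"
  proof -
    have "(1 + of_real (t k) / (\<i> * of_real u)) * (1 + of_real (t k) * (\<i> * of_real u)) =
       of_real (sqrt (1 + (t k / u)\<^sup>2) * sqrt (1 + (t k * u)\<^sup>2)) * cis (- (arctan (t k / u) - arctan (t k * u)))" for k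
    proof -
      have 1: "1 + of_real (t k) / (\<i> * of_real u) = 1 - \<i> * of_real (t k / u)"
        using u by (simp add: field_simps)
      have 2: "1 + of_real (t k) * (\<i> * of_real u) = 1 + \<i> * of_real (t k * u)" by simp
      show ?thesis unfolding 1 2 one_plus_i_polar one_minus_i_polar
        by (simp add: cis_mult mult_ac add.commute)
    qed
    then have "(\<Prod>k\<in>{1..<m}. (1 + of_real (t k) / (\<i> * of_real u)) * (1 + of_real (t k) * (\<i> * of_real u)))
      = (\<Prod>k\<in>{1..<m}. of_real (sqrt (1 + (t k / u)\<^sup>2) * sqrt (1 + (t k * u)\<^sup>2)) * cis (- (arctan (t k / u) - arctan (t k * u))))"
      by (simp only:)
    also have "\<dots> = of_real (\<Prod>k\<in>{1..<m}. sqrt (1 + (t k / u)\<^sup>2) * sqrt (1 + (t k * u)\<^sup>2)) * cis (- phase_sum u)"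
    proof -
      have "(\<Prod>k\<in>K. of_real (f k) * cis (- g k)) = of_real (\<Prod>k\<in>K. f k) * cis (- (\<Sum>k\<in>K. g k))"
        if "finite K" for K :: "nat set" and f g
        using that
      proof (induction K rule: finite_induct)
        case (insert x F)
        have "cis (- (g x + (\<Sum>k\<in>F. g k))) = cis (- g x) * cis (- (\<Sum>k\<in>F. g k))"
          by (simp add: cis_mult)
        then show ?case using insert by (simp add: mult_ac)
      qed simp
      then show ?thesis unfolding phase_sum_def by (simp only: finite_atLeastLessThan)
    qed
    finally show ?thesis using bpoly_factor[of "\<i> * of_real u"] u by (simp add: R_def mult_ac)
  qed
  ultimately show ?thesis by blast
qed

text \<open>The angle 2 m delta + Sigma of the overview.\<close>

definition total_phase :: "real \<Rightarrow> real" where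
  "total_phase u = 2 * real m * (pi / 4 - arctan u) + phase_sum u"

text \<open>At z = iu the two terms of \<open>bpoly_two_scale\<close> are complex conjugates, so
  P(-u^2) is, up to positive factors and a sign, the real part of one term, whose argument is known.
  The product on the left is P(-u^2) / c.\<close>

lemma symbol_on_negative_axis:
  assumes u: "u > 0"
  shows "\<exists>K>0. (\<Prod>k\<in>{1..<m}. (1 - t k / u\<^sup>2) * (1 - t k * u\<^sup>2)) = K * cos (total_phase u)"
proof -
  define p where "p = (\<Prod>k\<in>{1..<m}. (1 - t k / u\<^sup>2) * (1 - t k * u\<^sup>2))"
  obtain R where R: "R > 0" "poly (bpoly (2 * m)) (\<i> * of_real u) = (\<i> * of_real u) ^ m * (of_real R * cis (- phase_sum u))"
    using bpoly_i[OF u] by blast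
  define X where "X = (1 + \<i> * of_real u) ^ (2 * m) * poly (bpoly (2 * m)) (\<i> * of_real u)"
  have cnj_poly: "cnj (poly (bpoly n) z) = poly (bpoly n) (cnj z)" for n z
    by (simp add: poly_bpoly)
  have sq: "(\<i> * of_real u)\<^sup>2 = - of_real (u\<^sup>2)" by (simp add: power_mult_distrib)
  have "2 ^ (2 * m) * poly (bpoly (2 * m)) (- of_real (u\<^sup>2)) = X + cnj X"
    using bpoly_two_scale[of "2 * m" "\<i> * of_real u"] m unfolding sq X_def
    by (simp add: cnj_poly)
  also have "\<dots> = of_real (2 * Re X)" by (simp add: complex_add_cnj)
  also have "poly (bpoly (2 * m)) (- of_real (u\<^sup>2)) = of_real ((-1) ^ m * (u\<^sup>2) ^ m * (c * p))"
  proof -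
    have "(1 + of_real (t k) / - of_real (u\<^sup>2)) * (1 + of_real (t k) * - of_real (u\<^sup>2)) = complex_of_real ((1 - t k / u\<^sup>2) * (1 - t k * u\<^sup>2))" for k
      by simp
    then have "poly (bpoly (2 * m)) (- of_real (u\<^sup>2)) = (- of_real (u\<^sup>2)) ^ m * (of_real c * of_real p)"
      using u by (subst bpoly_factor) (simp_all add: p_def)
    also have "(- complex_of_real (u\<^sup>2)) ^ m = (-1) ^ m * of_real ((u\<^sup>2) ^ m)"
      by (subst power_minus) simp
    finally show ?thesis by simp
  qed
  finally have "complex_of_real (2 ^ (2 * m) * ((-1) ^ m * (u\<^sup>2) ^ m * (c * p))) = of_real (2 * Re X)" by simp
  then have e1: "2 ^ (2 * m) * ((-1) ^ m * (u\<^sup>2) ^ m * (c * p)) = 2 * Re X" by (simp only: of_real_eq_iff)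
  have "X = of_real ((1 + u\<^sup>2) ^ m * u ^ m * R) * cis (2 * real m * arctan u + real m * (pi / 2) - phase_sum u)"
  proof -
    have "(1 + \<i> * of_real u) ^ (2 * m) = of_real ((1 + u\<^sup>2) ^ m) * cis (2 * real m * arctan u)"
    proof -
      have "(1 + \<i> * of_real u) ^ (2 * m) = complex_of_real (sqrt (1 + u\<^sup>2)) ^ (2 * m) * cis (arctan u) ^ (2 * m)"
        unfolding one_plus_i_polar by (rule power_mult_distrib)
      also have "complex_of_real (sqrt (1 + u\<^sup>2)) ^ (2 * m) = of_real ((sqrt (1 + u\<^sup>2))\<^sup>2 ^ m)"
        by (simp only: power_mult of_real_power)
      also have "(sqrt (1 + u\<^sup>2))\<^sup>2 = 1 + u\<^sup>2" by simp
      finally show ?thesis by (simp only: Complex.DeMoivre of_nat_mult of_nat_numeral)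
    qed
    moreover have "(\<i> * of_real u) ^ m = of_real (u ^ m) * cis (real m * (pi / 2))"
    proof -
      have "\<i> ^ m = cis (real m * (pi / 2))" using Complex.DeMoivre[of "pi / 2" m] by simp
      then show ?thesis by (simp only: power_mult_distrib of_real_power mult.commute)
    qed
    ultimately have "X = (of_real ((1 + u\<^sup>2) ^ m) * cis (2 * real m * arctan u)) * (of_real (u ^ m) * cis (real m * (pi / 2)) * (of_real R * cis (- phase_sum u)))"
      unfolding X_def R by (simp only:)
    also have "\<dots> = of_real ((1 + u\<^sup>2) ^ m * u ^ m * R) * (cis (2 * real m * arctan u) * cis (real m * (pi / 2)) * cis (- phase_sum u))"
      by (simp only: of_real_mult mult_ac)
    also have "cis (2 * real m * arctan u) * cis (real m * (pi / 2)) * cis (- phase_sum u) = cis (2 * real m * arctan u + real m * (pi / 2) - phase_sum u)"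
      by (simp only: cis_mult diff_conv_add_uminus)
    finally show ?thesis .
  qed
  then have "Re X = (1 + u\<^sup>2) ^ m * u ^ m * R * cos (2 * real m * arctan u + real m * (pi / 2) - phase_sum u)"
    by (simp del: of_real_mult of_real_power)
  \<comment> \<open>The shift by m pi produces the sign (-1)^m that also occurs on the other side,
    in (-u^2)^m.\<close>
  also have "cos (2 * real m * arctan u + real m * (pi / 2) - phase_sum u) = cos (real m * pi - total_phase u)"
    by (rule arg_cong[of _ _ cos]) (simp add: total_phase_def algebra_simps)
  also have "\<dots> = (-1) ^ m * cos (total_phase u)"
    by (simp add: cos_diff cos_npi sin_npi)
  finally have "(-1) ^ m * (2 ^ (2 * m) * (u\<^sup>2) ^ m * c * p) = (-1) ^ m * (2 * (1 + u\<^sup>2) ^ m * u ^ m * R * cos (total_phase u))"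
    using e1 by (simp add: mult_ac)
  then have "2 ^ (2 * m) * (u\<^sup>2) ^ m * c * p = 2 * (1 + u\<^sup>2) ^ m * u ^ m * R * cos (total_phase u)"
    by (simp only: mult_left_cancel power_not_zero neg_equal_0_iff_equal zero_neq_one[symmetric] simp_thms)
  then have "p * (2 ^ (2 * m) * (u\<^sup>2) ^ m * c) = 2 * (1 + u\<^sup>2) ^ m * u ^ m * R * cos (total_phase u)"
    by (simp only: mult.commute)
  moreover have "2 ^ (2 * m) * (u\<^sup>2) ^ m * c > 0" using u c_pos by simp
  moreover have "x = (N / D) * y" if "x * D = N * y" "D > 0" for x D N y :: real
    using that by (simp add: eq_divide_eq)
  ultimately have "p = (2 * (1 + u\<^sup>2) ^ m * u ^ m * R / (2 ^ (2 * m) * (u\<^sup>2) ^ m * c)) * cos (total_phase u)"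
    by blast
  moreover have "2 * (1 + u\<^sup>2) ^ m * u ^ m * R / (2 ^ (2 * m) * (u\<^sup>2) ^ m * c) > 0"
    using u R c_pos \<open>2 ^ (2 * m) * (u\<^sup>2) ^ m * c > 0\<close>
    by (intro divide_pos_pos mult_pos_pos zero_less_power) (auto simp: add_pos_nonneg)
  ultimately show ?thesis unfolding p_def by blast
qed

lemma phase_sum_pos: "phase_sum s > 0"
  unfolding phase_sum_def
proof (rule sum_pos)
  show "{1..<m} \<noteq> {}" using m by auto
  fix k assume k: "k \<in> {1..<m}"
  have "s * s < 1 * 1" using s_bounds by (intro mult_strict_mono) auto
  then have "t k * (s * s) < t k" using t_bounds[OF k] by simp
  then have "t k * s < t k / s" using s_bounds by (simp add: pos_less_divide_eq mult.assoc)
  then show "0 < arctan (t k / s) - arctan (t k * s)" by (simp add: arctan_less_iff)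
qed simp

text \<open>The cosine of the phase is positive for s < u <= 1 and 0 at s, because t_{m-1} = s^2 is
  the largest t_k. A phase in (0, pi/2) at s contradicts the zero; a phase above pi/2 would, by the
  intermediate value theorem, equal pi/2 at some u > s, where the cosine is positive.\<close>

lemma total_phase_s: "total_phase s = pi / 2"
proof -
  have pos: "cos (total_phase u) > 0" if u: "s < u" "u \<le> 1" for u
  proof -
    have u0: "u > 0" using u s_bounds by linarith
    have su: "s\<^sup>2 < u\<^sup>2" using u s_bounds by (intro power_strict_mono) auto
    have u1: "u\<^sup>2 \<le> 1" using u u0 by (simp add: power_le_one)
    obtain K where K: "K > 0" "(\<Prod>k\<in>{1..<m}. (1 - t k / u\<^sup>2) * (1 - t k * u\<^sup>2)) = K * cos (total_phase u)"
      using symbol_on_negative_axis[OF u0] by blast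
    have "(\<Prod>k\<in>{1..<m}. (1 - t k / u\<^sup>2) * (1 - t k * u\<^sup>2)) > 0"
    proof (rule prod_pos, rule mult_pos_pos)
      fix k assume k: "k \<in> {1..<m}"
      have "t k < u\<^sup>2" using t_le[OF k] su by linarith
      then show "1 - t k / u\<^sup>2 > 0" using u0 by simp
      have "t k * u\<^sup>2 \<le> t k * 1" using t_bounds[OF k] u1 by (intro mult_left_mono) auto
      then show "1 - t k * u\<^sup>2 > 0" using t_bounds[OF k] by linarith
    qed
    then show ?thesis unfolding K(2) using K(1) by (simp add: zero_less_mult_iff)
  qed
  have zero: "cos (total_phase s) = 0"
  proof -
    obtain K where K: "K > 0" "(\<Prod>k\<in>{1..<m}. (1 - t k / s\<^sup>2) * (1 - t k * s\<^sup>2)) = K * cos (total_phase s)"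
      using symbol_on_negative_axis[OF s_bounds(1)] by blast
    have "(\<Prod>k\<in>{1..<m}. (1 - t k / s\<^sup>2) * (1 - t k * s\<^sup>2)) = 0"
    proof (rule prod_zero)
      show "\<exists>k\<in>{1..<m}. (1 - t k / s\<^sup>2) * (1 - t k * s\<^sup>2) = 0"
        using m1 s_bounds t_bounds[OF m1] by (intro bexI[of _ "m - 1"]) auto
    qed simp
    then show ?thesis using K by (simp only: mult_eq_0_iff) simp
  qed
  have cont: "continuous_on {s..1} total_phase"
    unfolding total_phase_def phase_sum_def using s_bounds(1)
    by (intro continuous_intros) auto
  have one: "total_phase 1 = 0" by (simp add: total_phase_def phase_sum_def arctan_one)
  have "arctan s < pi / 4" using arctan_less_iff[of s 1] s_bounds by (simp add: arctan_one)
  then have gt: "total_phase s > 0" using phase_sum_pos m by (simp add: total_phase_def add_pos_pos)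
  show ?thesis
  proof (rule linorder_cases[of "total_phase s" "pi / 2"])
    assume "total_phase s < pi / 2"
    then have "cos (total_phase s) > 0" using gt by (intro cos_gt_zero) auto
    then show ?thesis using zero by simp
  next
    assume "total_phase s > pi / 2"
    then obtain u where u: "s \<le> u" "u \<le> 1" "total_phase u = pi / 2"
      using IVT2'[of total_phase 1 "pi / 2" s] one cont s_bounds pi_gt_zero by (auto simp: less_imp_le)
    then have "u \<noteq> s" using \<open>total_phase s > pi / 2\<close> by auto
    then show ?thesis using pos[of u] u by simp
  qed
qed

text \<open>Doubling the angle treats sine and cosine together: 2x = (m-2) pi/2 + 2d with 0 < 2d <
  pi/2, so sin(2x) = 0 would place an integer strictly between 0 and 1.\<close>

lemma wavelet_phase:
  "sin (real m * arctan s - phase_sum s) \<noteq> 0" "cos (real m * arctan s - phase_sum s) \<noteq> 0"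
proof -
  define d where "d = real m * (pi / 4 - arctan s)"
  define x where "x = real m * arctan s - phase_sum s"
  have "arctan s < pi / 4" using arctan_less_iff[of s 1] s_bounds by (simp add: arctan_one)
  then have d0: "d > 0" using m by (simp add: d_def)
  have ps: "phase_sum s = pi / 2 - 2 * d" using total_phase_s by (simp add: total_phase_def d_def)
  then have d1: "2 * d < pi / 2" using phase_sum_pos by simp
  have x2: "2 * x = (real m - 2) * (pi / 2) + 2 * d"
    unfolding x_def ps by (simp add: d_def algebra_simps)
  have "sin (2 * x) \<noteq> 0"
  proof
    assume "sin (2 * x) = 0"
    then obtain i :: int where i: "2 * x = of_int i * pi" using sin_zero_iff_int2 by blast
    then have "2 * d = of_int (2 * i - int m + 2) * (pi / 2)"
      using x2 by (simp add: algebra_simps)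
    then have "0 < of_int (2 * i - int m + 2) * (pi / 2)" "of_int (2 * i - int m + 2) * (pi / 2) < 1 * (pi / 2)"
      using d0 d1 by auto
    then have "0 < real_of_int (2 * i - int m + 2)" "real_of_int (2 * i - int m + 2) < 1"
      using pi_gt_zero by (auto simp: zero_less_mult_iff mult_less_cancel_right)
    then have "0 < 2 * i - int m + 2" "2 * i - int m + 2 < 1"
      by (simp_all only: of_int_0_less_iff of_int_less_1_iff)
    then show False by linarith
  qed
  then show "sin (real m * arctan s - phase_sum s) \<noteq> 0" "cos (real m * arctan s - phase_sum s) \<noteq> 0"
    unfolding x_def sin_double by auto
qed

end

section \<open>Asymptotics of Laurent coefficients\<close>

text \<open>The limit is 1 / Gamma(1/2).\<close>

lemma central_binomial_asymptotic:
  "(\<lambda>n. \<bar>(-1/2 :: real) gchoose n\<bar> * sqrt (real n)) \<longlonglongrightarrow> 1 / sqrt pi"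
proof -
  have "(\<lambda>n. \<bar>(-1/2 gchoose n) / ((-1)^n / exp ((-1/2+1) * of_real (ln (real n))))\<bar>) \<longlonglongrightarrow> \<bar>inverse (Gamma (- (-1/2 :: real)))\<bar>"
    by (intro tendsto_rabs gbinomial_asymptotic)
  also have "\<bar>inverse (Gamma (- (-1/2 :: real)))\<bar> = 1 / sqrt pi"
    by (simp add: Gamma_one_half_real inverse_eq_divide)
  finally have *: "(\<lambda>n. \<bar>(-1/2 gchoose n) / ((-1)^n / exp ((-1/2+1) * of_real (ln (real n))))\<bar>) \<longlonglongrightarrow> 1 / sqrt pi" .
  show ?thesis
  proof (rule Lim_transform_eventually[OF *])
    show "\<forall>\<^sub>F n in sequentially. \<bar>(-1/2 gchoose n) / ((-1)^n / exp ((-1/2+1) * of_real (ln (real n))))\<bar> = \<bar>(-1/2 :: real) gchoose n\<bar> * sqrt (real n)"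
      using eventually_gt_at_top[of 0]
    proof eventually_elim
      case (elim n)
      have "exp (1/2 * ln (real n)) = sqrt (real n)"
        using elim by (simp add: powr_half_sqrt[symmetric] powr_def)
      then show ?case by (simp add: abs_mult abs_divide power_abs)
    qed
  qed
qed

lemma central_binomial_sign: "((-1/2 :: real) gchoose n) = (-1) ^ n * \<bar>(-1/2) gchoose n\<bar>"
proof (induction n)
  case (Suc n)
  have "real (Suc n) * ((-1/2) gchoose Suc n) = (-1/2 - real n) * ((-1/2 :: real) gchoose n)"
    using gbinomial_mult_1[of "-1/2 :: real" n] by (simp add: algebra_simps)
  then have "((-1/2 :: real) gchoose Suc n) = - ((1/2 + real n) / real (Suc n)) * ((-1/2) gchoose n)"
    by (simp add: field_simps)
  then have e: "((-1/2 :: real) gchoose Suc n) = - (d * ((-1/2) gchoose n))" and d: "d \<ge> 0"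
    if "d = (1/2 + real n) / real (Suc n)" for d using that by simp_all
  show ?case
    unfolding e[OF refl] abs_minus_cancel abs_mult abs_of_nonneg[OF d[OF refl]]
    by (subst Suc) (simp only: power_Suc mult_minus_left mult_1_left mult.left_commute mult_minus_right)
qed simp

text \<open>The square root of n + 1 makes the bound meaningful at n = 0 too, as the uniform
  domination in the limit exchange requires.\<close>

lemma central_binomial_bounded: "\<exists>K. \<forall>n. \<bar>(-1/2 :: real) gchoose n\<bar> * sqrt (real n + 1) \<le> K"
proof -
  obtain K where K: "K > 0" "\<And>n. norm (\<bar>(-1/2 :: real) gchoose n\<bar> * sqrt (real n)) \<le> K"
    using convergent_imp_Bseq[of "\<lambda>n. \<bar>(-1/2 :: real) gchoose n\<bar> * sqrt (real n)"] central_binomial_asymptotic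
    unfolding Bseq_def convergent_def by blast
  have "\<bar>(-1/2 :: real) gchoose n\<bar> * sqrt (real n + 1) \<le> 2 * K + 1" for n
  proof (cases "n = 0")
    case False
    have "sqrt (real n + 1) \<le> sqrt (4 * real n)" using False by (intro real_sqrt_le_mono) auto
    then have "sqrt (real n + 1) \<le> 2 * sqrt (real n)" by (simp add: real_sqrt_mult)
    then have "\<bar>(-1/2 :: real) gchoose n\<bar> * sqrt (real n + 1) \<le> \<bar>(-1/2) gchoose n\<bar> * (2 * sqrt (real n))"
      by (rule mult_left_mono) simp
    also have "\<dots> \<le> 2 * K" using K(2)[of n] by simp
    finally show ?thesis by simp
  qed (use K in simp)
  then show ?thesis by blast
qed

lemma Suc_times_power_bounded:
  fixes x :: real
  assumes "0 \<le> x" "x < 1"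
  shows "\<exists>K>0. \<forall>n. (1 + real n) * x ^ n \<le> K"
proof -
  have "(\<lambda>n. x ^ n + of_nat n * x ^ n) \<longlonglongrightarrow> 0 + 0"
    by (intro tendsto_add powser_times_n_limit_0 LIMSEQ_realpow_zero) (use assms in auto)
  then have "Bseq (\<lambda>n. x ^ n + of_nat n * x ^ n)" by (metis convergentI convergent_imp_Bseq)
  then obtain K where "K > 0" "\<And>n. norm (x ^ n + of_nat n * x ^ n) \<le> K" unfolding Bseq_def by blast
  then show ?thesis by (intro exI[of _ K]) (auto simp: distrib_right dest: abs_le_D1)
qed

text \<open>The substitution of a square into the binomial series turns the coefficient at an index of the
  form 2r + p into a convolution along the residue class of p only; Tannery's theorem then applies
  because the coefficients of the other factor decay faster than those of the binomial series.\<close>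

lemma laurent_coeff_asymptotic:
  fixes h w :: "int \<Rightarrow> real"
  assumes s: "0 < s" "s < 1" and rho: "1 / s < \<rho>"
    and h: "laurent_on h H {z. 1 \<le> norm z \<and> norm z \<le> \<rho>}"
    and w: "laurent_on w (\<lambda>z. H z * (1 + of_real (s\<^sup>2) * z\<^sup>2) powr of_real (-1/2)) (sphere 0 1)"
    and p: "p = 0 \<or> p = 1"
  shows "(\<lambda>r. w (2 * int r + p) * (-1) ^ r * sqrt (real r) / s ^ (2 * r)) \<longlonglongrightarrow>
           (if p = 0 then Re (H (\<i> / of_real s)) else s * Im (H (\<i> / of_real s))) / sqrt pi"
proof -
  let ?l = "if p = 0 then Re (H (\<i> / of_real s)) else s * Im (H (\<i> / of_real s))"
  define R where "R = {z. 1 \<le> norm z \<and> norm z \<le> \<rho>}"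
  have rho1: "\<rho> > 1" using s rho by (smt (verit) divide_less_eq_1_pos le_divide_eq_1_pos)
  define B where "B n = \<bar>(-1/2 :: real) gchoose n\<bar>" for n
  define g where "g = (\<lambda>j::int. if even j then (if j div 2 \<ge> 0 then (-1/2 gchoose nat (j div 2)) * (s\<^sup>2) ^ nat (j div 2) else 0) else 0)"
  have s2: "0 < s\<^sup>2" "s\<^sup>2 < 1" using s by (auto simp: power_less_one_iff)
  have g: "laurent_on g (\<lambda>z. (1 + of_real (s\<^sup>2) * z\<^sup>2) powr of_real (-1/2)) (sphere 0 1)"
    unfolding g_def
    by (rule laurent_on_square[OF laurent_on_binomial[of "sphere 0 1"]])
       (use s2 in \<open>auto simp: norm_mult norm_power\<close>)
  have hs: "laurent_on h H (sphere 0 1)"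
    by (rule laurent_on_subset[OF h]) (use rho1 in auto)
  have "laurent_on (conv h g) (\<lambda>z. H z * (1 + of_real (s\<^sup>2) * z\<^sup>2) powr of_real (-1/2)) (sphere 0 1)"
    by (rule laurent_on_mult[OF hs g]) simp
  then have wc: "w = conv h g" by (rule laurent_on_unique[OF w])
  have g2: "g (2 * j) = (if j \<ge> 0 then (-1) ^ nat j * B (nat j) * s ^ (2 * nat j) else 0)" for j
  proof (cases "j \<ge> 0")
    case True
    then have "g (2 * j) = (-1/2 gchoose nat j) * (s\<^sup>2) ^ nat j" by (simp add: g_def)
    also have "\<dots> = (-1) ^ nat j * B (nat j) * s ^ (2 * nat j)"
      by (subst central_binomial_sign) (simp only: B_def power_mult)
    finally show ?thesis using True by simp
  qed (simp add: g_def)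
  \<comment> \<open>These are the terms of the series of H at i/s over the residue class of p, up to
    the factor i/s for odd p; multiplied by the normalised binomial coefficient of index r - l they
    give \<open>T\<close>.\<close>
  define L where "L l = h (2 * l + p) * (-1) powi l * s powi (- 2 * l)" for l
  define T where "T l r = (if l \<le> int r then L l * (B (nat (int r - l)) * sqrt (real r)) else 0)" for l r
  have w_eq: "w (2 * int r + p) * (-1) ^ r * sqrt (real r) / s ^ (2 * r) = (\<Sum>\<^sub>\<infinity>l. T l r)" for r
  proof -
    have "w (2 * int r + p) = (\<Sum>\<^sub>\<infinity>k. h k * g (2 * int r + p - k))" by (simp add: wc conv_def)
    also have "\<dots> = (\<Sum>\<^sub>\<infinity>k\<in>range (\<lambda>l. 2 * l + p). h k * g (2 * int r + p - k))"
    proof (rule infsum_cong_neutral)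
      fix k assume k: "k \<in> UNIV - range (\<lambda>l. 2 * l + p)"
      have "odd (2 * int r + p - k)"
      proof
        assume "even (2 * int r + p - k)"
        then obtain j where "2 * int r + p - k = 2 * j" by (elim evenE)
        then have "k = 2 * (int r - j) + p" by (simp add: algebra_simps)
        then show False using k by blast
      qed
      then show "h k * g (2 * int r + p - k) = 0" by (simp add: g_def)
    qed auto
    also have "\<dots> = (\<Sum>\<^sub>\<infinity>l. h (2 * l + p) * g (2 * int r + p - (2 * l + p)))"
      by (subst infsum_reindex) (auto simp: inj_on_def o_def)
    also have "\<dots> = (\<Sum>\<^sub>\<infinity>l. h (2 * l + p) * g (2 * (int r - l)))" by (simp add: algebra_simps)
    finally have "w (2 * int r + p) * ((-1) ^ r * sqrt (real r) / s ^ (2 * r)) =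
        (\<Sum>\<^sub>\<infinity>l. h (2 * l + p) * g (2 * (int r - l)) * ((-1) ^ r * sqrt (real r) / s ^ (2 * r)))"
      by (simp only: infsum_cmult_left')
    also have "\<dots> = (\<Sum>\<^sub>\<infinity>l. T l r)"
    proof (rule infsum_cong)
      fix l :: int
      show "h (2 * l + p) * g (2 * (int r - l)) * ((-1) ^ r * sqrt (real r) / s ^ (2 * r)) = T l r"
      proof (cases "l \<le> int r")
        case True
        define n where "n = nat (int r - l)"
        have l: "l = int r - int n" using True by (simp add: n_def)
        have 1: "(-1 :: real) powi l = (-1) ^ n * (-1) ^ r"
          unfolding l by (simp add: power_int_diff power_int_of_nat divide_simps flip: power_mult_distrib)
        have 2: "s powi (- 2 * l) = s ^ (2 * n) / s ^ (2 * r)"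
        proof -
          have "- 2 * l = int (2 * n) - int (2 * r)" by (simp add: l)
          then have "s powi (- 2 * l) = s powi int (2 * n) / s powi int (2 * r)"
            using s by (simp only: power_int_diff less_irrefl) (auto simp: power_int_diff)
          then show ?thesis by (simp only: power_int_of_nat)
        qed
        have G: "g (2 * (int r - l)) = (-1) ^ n * B n * s ^ (2 * n)"
          unfolding g2 using True by (simp add: n_def)
        have T: "T l r = L l * (B n * sqrt (real r))" using True by (simp add: T_def n_def)
        show ?thesis unfolding T L_def G 1 2 by (simp add: mult_ac)
      next
        case False
        then have "g (2 * (int r - l)) = 0" unfolding g2 by simp
        then show ?thesis using False unfolding T_def by (simp only: mult_zero_right mult_zero_left if_False)
      qed
    qed
    finally show ?thesis by simp
  qed
  obtain K1 where K1: "\<And>n. B n * sqrt (real n + 1) \<le> K1" using central_binomial_bounded B_def by metis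
  have B0: "B n \<ge> 0" for n by (simp add: B_def)
  have K10: "K1 \<ge> 0" using K1[of 0] B0[of 0] by simp
  have T_bound: "norm (T l r) \<le> K1 * (\<bar>L l\<bar> * (1 + \<bar>of_int l\<bar>))" for l r
  proof (cases "l \<le> int r")
    case True
    define n where "n = nat (int r - l)"
    have l: "int r = l + int n" using True by (simp add: n_def)
    \<comment> \<open>This splits the growth of sqrt r into a part absorbed by the binomial
      coefficient of index n and a part depending on l alone.\<close>
    have "real r \<le> (real n + 1) * (1 + \<bar>of_int l\<bar>)"
    proof -
      have "real r = of_int l + real n" using l by (metis of_int_add of_int_of_nat_eq)
      also have "\<dots> \<le> \<bar>of_int l\<bar> + real n + real n * \<bar>of_int l\<bar> + 1" by (simp add: add_increasing2)
      finally show ?thesis by (simp add: algebra_simps)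
    qed
    then have "sqrt (real r) \<le> sqrt (real n + 1) * sqrt (1 + \<bar>of_int l\<bar>)"
      by (metis real_sqrt_le_mono real_sqrt_mult)
    also have "sqrt (1 + \<bar>of_int l\<bar>) \<le> 1 + \<bar>real_of_int l\<bar>"
      by (rule real_le_lsqrt) (auto simp: power2_eq_square algebra_simps)
    finally have "sqrt (real r) \<le> sqrt (real n + 1) * (1 + \<bar>real_of_int l\<bar>)"
      by (simp add: mult_left_mono)
    then have "B n * sqrt (real r) \<le> B n * (sqrt (real n + 1) * (1 + \<bar>real_of_int l\<bar>))"
      using B0 by (rule mult_left_mono)
    also have "\<dots> \<le> K1 * (1 + \<bar>real_of_int l\<bar>)"
      using mult_right_mono[OF K1[of n], of "1 + \<bar>real_of_int l\<bar>"] by (simp add: mult.assoc)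
    finally have "\<bar>L l\<bar> * (B n * sqrt (real r)) \<le> \<bar>L l\<bar> * (K1 * (1 + \<bar>real_of_int l\<bar>))"
      by (rule mult_left_mono) simp
    then show ?thesis using True B0[of n] by (simp add: T_def abs_mult mult_ac flip: n_def)
  qed (use K10 in \<open>simp add: T_def\<close>)
  have L_summable: "(\<lambda>l. \<bar>L l\<bar> * (1 + \<bar>of_int l\<bar>)) summable_on UNIV"
  proof -
    have hr: "(\<lambda>j. \<bar>h j\<bar> * \<rho> powi j) summable_on UNIV"
      using laurent_on_summable[OF h, of "of_real \<rho>"] rho1 by simp
    have h1: "(\<lambda>j. \<bar>h j\<bar>) summable_on UNIV"
      by (rule laurent_on_abs_summable[OF hs, of 1]) auto
    have inj: "inj_on (\<lambda>l::int. 2 * l + p) UNIV" by (auto simp: inj_on_def)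
    have sub: "(\<lambda>l. f (2 * l + p)) summable_on UNIV" if "f summable_on UNIV" for f :: "int \<Rightarrow> real"
      using summable_on_reindex[OF inj, of f] summable_on_subset[OF that, of "range (\<lambda>l. 2 * l + p)"]
      by (simp add: o_def)
    \<comment> \<open>For l >= 0 the radius beyond 1/s leaves a surplus decay q^(2l), with q < 1,
      that beats the factor 1 + l. For l < 0 the power of s itself decays and summability of h on
      the unit circle is enough.\<close>
    define q where "q = 1 / (\<rho> * s)"
    have q: "0 < q" "q < 1" using s rho rho1 by (auto simp: q_def field_simps)
    have q2: "0 \<le> q\<^sup>2" "q\<^sup>2 < 1" using q by (auto simp: power_less_one_iff)
    obtain Ka where Ka: "Ka > 0" "\<And>n. (1 + real n) * (q\<^sup>2) ^ n \<le> Ka"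
      using Suc_times_power_bounded[OF q2] by blast
    obtain Kb where Kb: "Kb > 0" "\<And>n. (1 + real n) * (s\<^sup>2) ^ n \<le> Kb"
      using Suc_times_power_bounded[of "s\<^sup>2"] s2 by auto
    have "(\<lambda>l. Ka * (\<bar>h (2 * l + p)\<bar> * \<rho> powi (2 * l + p)) + Kb * \<bar>h (2 * l + p)\<bar>) summable_on UNIV"
      by (intro summable_on_add summable_on_cmult_right sub[OF hr] sub[OF h1])
    then show ?thesis
    proof (rule summable_on_comparison_test)
      fix l :: int
      have absL: "\<bar>L l\<bar> = \<bar>h (2 * l + p)\<bar> * s powi (- 2 * l)"
        using s by (simp add: L_def abs_mult power_int_abs)
      show "\<bar>L l\<bar> * (1 + \<bar>of_int l\<bar>) \<le> Ka * (\<bar>h (2 * l + p)\<bar> * \<rho> powi (2 * l + p)) + Kb * \<bar>h (2 * l + p)\<bar>"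
      proof (cases "l \<ge> 0")
        case True
        then obtain n where n: "l = int n" using nonneg_int_cases by blast
        have "s powi (- 2 * l) = 1 / s ^ (2 * n)"
          using s by (simp add: n power_int_minus power_int_mult power_mult power_int_of_nat inverse_eq_divide)
        also have "\<dots> = \<rho> ^ (2 * n) * (q\<^sup>2) ^ n"
          using rho1 s by (simp add: q_def power_divide power_mult_distrib power_mult)
        finally have e: "s powi (- 2 * l) = \<rho> ^ (2 * n) * (q\<^sup>2) ^ n" .
        have "\<rho> ^ (2 * n) \<le> \<rho> powi (2 * l + p)"
          using p rho1 power_increasing[of "2 * n" "2 * n + 1" \<rho>]
          by (auto simp: n power_int_add power_int_mult power_mult power_int_of_nat)
        then have "\<rho> ^ (2 * n) * ((1 + real n) * (q\<^sup>2) ^ n) \<le> \<rho> powi (2 * l + p) * Ka"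
          using Ka q rho1 by (intro mult_mono) auto
        then have "\<bar>h (2 * l + p)\<bar> * (\<rho> ^ (2 * n) * ((1 + real n) * (q\<^sup>2) ^ n)) \<le> \<bar>h (2 * l + p)\<bar> * (\<rho> powi (2 * l + p) * Ka)"
          by (rule mult_left_mono) simp
        then have "\<bar>L l\<bar> * (1 + \<bar>of_int l\<bar>) \<le> Ka * (\<bar>h (2 * l + p)\<bar> * \<rho> powi (2 * l + p))"
          unfolding absL e by (simp add: n mult_ac)
        moreover have "Kb * \<bar>h (2 * l + p)\<bar> \<ge> 0" using Kb by simp
        ultimately show ?thesis by linarith
      next
        case False
        then obtain n where n: "l = - int n" by (metis int_cases2 of_nat_0_le_iff)
        have e: "s powi (- 2 * l) = (s\<^sup>2) ^ n"
          by (simp add: n power_int_mult power_int_of_nat flip: power_mult)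
        have "\<bar>h (2 * l + p)\<bar> * ((1 + real n) * (s\<^sup>2) ^ n) \<le> \<bar>h (2 * l + p)\<bar> * Kb"
          by (rule mult_left_mono[OF Kb(2)]) simp
        then have "\<bar>L l\<bar> * (1 + \<bar>of_int l\<bar>) \<le> Kb * \<bar>h (2 * l + p)\<bar>"
          unfolding absL e by (simp add: n mult_ac)
        moreover have "Ka * (\<bar>h (2 * l + p)\<bar> * \<rho> powi (2 * l + p)) \<ge> 0" using Ka rho1 by simp
        ultimately show ?thesis by linarith
      qed
    qed simp
  qed
  \<comment> \<open>At z = i/s even powers are real and odd powers imaginary, so real and imaginary
    parts of H(z) separate the residue classes. An odd power has an extra 1/s, which explains the
    factor s.\<close>
  have L_sum: "(L has_sum ?l) UNIV"
  proof -
    define z where "z = \<i> / of_real s"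
    have "((\<lambda>j. of_real (h j) * z powi j) has_sum H z) UNIV"
      by (rule laurent_onD[OF h]) (use s rho in \<open>auto simp: z_def norm_divide\<close>)
    note Hz = has_sum_Re[OF this] has_sum_Im[OF this]
    have z2: "z powi (2 * l) = of_real ((-1) powi l * s powi (- 2 * l))" for l
    proof -
      have "z powi (2 * l) = (z\<^sup>2) powi l" by (metis power_int_mult power_int_numeral)
      also have "z\<^sup>2 = of_real (- 1 / s\<^sup>2)" by (simp add: z_def power_divide)
      also have "of_real (- 1 / s\<^sup>2) powi l = complex_of_real ((- 1 / s\<^sup>2) powi l)" by (simp only: of_real_power_int)
      also have "(- 1 / s\<^sup>2) powi l = (-1) powi l / (s\<^sup>2) powi l"
        by (rule power_int_divide_distrib)
      also have "\<dots> = (-1) powi l * s powi (- 2 * l)"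
        by (simp add: power_int_minus divide_inverse power_int_mult)
      finally show ?thesis .
    qed
    have z21: "z powi (2 * l + 1) = \<i> * of_real ((-1) powi l * s powi (- 2 * l) / s)" for l
    proof -
      have "z powi (2 * l + 1) = z powi (2 * l) * z" using s by (simp add: power_int_add_1 z_def)
      then show ?thesis unfolding z2 by (simp add: z_def)
    qed
    have cx: "Re (of_real a * (\<i> * of_real b)) = 0" "Im (of_real a * of_real b) = 0"
      "Re (of_real a * of_real b) = a * b" "s * Im (of_real a * (\<i> * of_real (b / s))) = a * b" for a b
      using s by simp_all
    have inj: "inj_on (\<lambda>l::int. 2 * l + p) UNIV" by (auto simp: inj_on_def)
    show ?thesis
    proof (cases "p = 0")
      case True
      have "((\<lambda>j. Re (of_real (h j) * z powi j)) has_sum Re (H z)) (range (\<lambda>l. 2 * l + p))"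
      proof (rule has_sum_cong_neutral[THEN iffD1, OF _ _ _ Hz(1)])
        fix j assume "j \<in> UNIV - range (\<lambda>l. 2 * l + p)"
        then have "odd j" using True by (auto elim!: evenE)
        then obtain l where "j = 2 * l + 1" by (elim oddE)
        then show "Re (of_real (h j) * z powi j) = 0" by (simp only: z21 cx)
      qed auto
      then have "((\<lambda>l. Re (of_real (h (2 * l + p)) * z powi (2 * l + p))) has_sum Re (H z)) UNIV"
        by (subst (asm) has_sum_reindex[OF inj]) (simp add: o_def)
      moreover have "Re (of_real (h (2 * l + p)) * z powi (2 * l + p)) = L l" for l
        unfolding True add_0_right z2 cx L_def by (simp only: mult.assoc add_0_right)
      ultimately show ?thesis using True by (simp add: z_def)
    next
      case False
      then have p1: "p = 1" using p by simp
      have "((\<lambda>j. Im (of_real (h j) * z powi j)) has_sum Im (H z)) (range (\<lambda>l. 2 * l + p))"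
      proof (rule has_sum_cong_neutral[THEN iffD1, OF _ _ _ Hz(2)])
        fix j assume "j \<in> UNIV - range (\<lambda>l. 2 * l + p)"
        then have "even j" using p1 by (metis DiffD2 oddE rangeI)
        then obtain l where "j = 2 * l" by (elim evenE)
        then show "Im (of_real (h j) * z powi j) = 0" by (simp only: z2 cx)
      qed auto
      then have "((\<lambda>l. Im (of_real (h (2 * l + p)) * z powi (2 * l + p))) has_sum Im (H z)) UNIV"
        by (subst (asm) has_sum_reindex[OF inj]) (simp add: o_def)
      then have "((\<lambda>l. s * Im (of_real (h (2 * l + p)) * z powi (2 * l + p))) has_sum s * Im (H z)) UNIV"
        by (rule has_sum_cmult_right)
      moreover have "s * Im (of_real (h (2 * l + p)) * z powi (2 * l + p)) = L l" for l
        unfolding p1 z21 cx L_def by (simp only: mult.assoc)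
      ultimately show ?thesis using False by (simp add: z_def)
    qed
  qed
  have T_lim: "(\<lambda>r. T l r) \<longlonglongrightarrow> L l * (1 / sqrt pi)" for l
  proof -
    have f: "filterlim (\<lambda>r. nat (int r - l)) sequentially sequentially"
      unfolding filterlim_at_top
    proof
      fix Z show "\<forall>\<^sub>F r in sequentially. Z \<le> nat (int r - l)"
        using eventually_ge_at_top[of "nat (int Z + l)"] by eventually_elim linarith
    qed
    have 1: "(\<lambda>r. B (nat (int r - l)) * sqrt (real (nat (int r - l)))) \<longlonglongrightarrow> 1 / sqrt pi"
      using filterlim_compose[OF central_binomial_asymptotic f] by (simp add: B_def)
    have "(\<lambda>r. real r / (real r - of_int l)) \<longlonglongrightarrow> 1" by real_asymp
    then have "(\<lambda>r. sqrt (real r / (real r - of_int l))) \<longlonglongrightarrow> sqrt 1" by (rule tendsto_real_sqrt)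
    from tendsto_mult[OF tendsto_const[of "L l"] tendsto_mult[OF 1 this]]
    have "(\<lambda>r. L l * (B (nat (int r - l)) * sqrt (real (nat (int r - l))) * sqrt (real r / (real r - of_int l)))) \<longlonglongrightarrow> L l * (1 / sqrt pi)"
      by simp
    then show ?thesis
    proof (rule Lim_transform_eventually)
      show "\<forall>\<^sub>F r in sequentially. L l * (B (nat (int r - l)) * sqrt (real (nat (int r - l))) * sqrt (real r / (real r - of_int l))) = T l r"
        using eventually_gt_at_top[of "nat \<bar>l\<bar>"]
      proof eventually_elim
        case (elim r)
        then have l: "l < int r" by linarith
        then have "real (nat (int r - l)) = real r - of_int l" by simp
        moreover have "real r - of_int l > 0" using l by linarith
        ultimately have "sqrt (real (nat (int r - l))) * sqrt (real r / (real r - of_int l)) = sqrt (real r)"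
          by (simp flip: real_sqrt_mult)
        then show ?case using l by (simp add: T_def mult.assoc)
      qed
    qed
  qed
  \<comment> \<open>The partial sums converge uniformly in r by the dominating series, so the limit
    in r may be taken inside the sum.\<close>
  have "(\<lambda>r. \<Sum>\<^sub>\<infinity>l. T l r) \<longlonglongrightarrow> ?l * (1 / sqrt pi)"
  proof (rule swap_uniform_limit'[where F="finite_subsets_at_top UNIV" and S=UNIV
      and f="\<lambda>X r. \<Sum>l\<in>X. T l r" and g="\<lambda>X. \<Sum>l\<in>X. L l * (1 / sqrt pi)"])
    show "uniform_limit UNIV (\<lambda>X r. \<Sum>l\<in>X. T l r) (\<lambda>r. \<Sum>\<^sub>\<infinity>l. T l r) (finite_subsets_at_top UNIV)"
      by (rule Weierstrass_m_test_general[OF T_bound summable_on_cmult_right[OF L_summable]])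
    show "((\<lambda>X. \<Sum>l\<in>X. L l * (1 / sqrt pi)) \<longlongrightarrow> ?l * (1 / sqrt pi)) (finite_subsets_at_top UNIV)"
      using has_sum_cmult_left[OF L_sum, of "1 / sqrt pi"] by (simp add: has_sum_def)
    show "\<forall>\<^sub>F X in finite_subsets_at_top UNIV. ((\<lambda>r. \<Sum>l\<in>X. T l r) \<longlongrightarrow> (\<Sum>l\<in>X. L l * (1 / sqrt pi))) sequentially"
      by (intro always_eventually allI tendsto_sum T_lim)
  qed simp_all
  then show ?thesis unfolding w_eq by simp
qed

section \<open>Spline series\<close>

definition spline :: "nat \<Rightarrow> (int \<Rightarrow> real) \<Rightarrow> real \<Rightarrow> real" where
  "spline n e y = (\<Sum>\<^sub>\<infinity>j. e j * bspline n (y - of_int j))"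

text \<open>Both ends are closed, to match the index set of the sum in the final theorem.\<close>

definition supp_ivl :: "nat \<Rightarrow> real \<Rightarrow> int set" where
  "supp_ivl n y = {j. y - real n \<le> of_int j \<and> of_int j \<le> y}"

lemma finite_supp_ivl [simp]: "finite (supp_ivl n y)"
proof (rule finite_subset)
  show "supp_ivl n y \<subseteq> {\<lfloor>y - real n\<rfloor>..\<lceil>y\<rceil>}"
    by (auto simp: supp_ivl_def floor_le_iff le_ceiling_iff)
qed simp

lemma bspline_outside_supp: "j \<notin> supp_ivl n y \<Longrightarrow> bspline n (y - of_int j) = 0"
  by (auto simp: supp_ivl_def not_le intro: bspline_eq_0_left bspline_eq_0_right)

lemma spline_has_sum: "((\<lambda>j. e j * bspline n (y - of_int j)) has_sum (\<Sum>j\<in>supp_ivl n y. e j * bspline n (y - of_int j))) UNIV"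
  by (rule has_sum_finite_neutralI[of "supp_ivl n y"]) (auto simp: bspline_outside_supp)

lemma spline_eq: "spline n e y = (\<Sum>j\<in>supp_ivl n y. e j * bspline n (y - of_int j))"
  unfolding spline_def by (rule infsumI[OF spline_has_sum])

lemma spline_eq_superset:
  assumes "finite F" "supp_ivl n y \<subseteq> F"
  shows "spline n e y = (\<Sum>j\<in>F. e j * bspline n (y - of_int j))"
  unfolding spline_eq using assms by (intro sum.mono_neutral_left) (auto simp: bspline_outside_supp)

text \<open>For fixed y only finitely many i have N_n(y - i) nonzero, and each row in k is summable
  because \<open>b\<close> is bounded and \<open>c\<close> summable. The double series is thus
  absolutely summable and may be rearranged.\<close>

lemma spline_conv:
  assumes b: "\<And>j. \<bar>b j\<bar> \<le> M" and c: "(\<lambda>j. \<bar>c j\<bar>) summable_on UNIV"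
  shows "((\<lambda>j. b j * spline n c (y - of_int j)) has_sum spline n (conv b c) y) UNIV"
proof -
  define f where "f = (\<lambda>(i,k). b k * c (i - k) * bspline n (y - of_int i))"
  have ck: "(\<lambda>k. \<bar>c (i - k)\<bar>) summable_on UNIV" for i
    using c by (rule summable_on_reindex_bij_witness[where i="\<lambda>k. i - k" and j="\<lambda>k. i - k", THEN iffD1, rotated -1]) auto
  have bc: "(\<lambda>k. \<bar>b k * c (i - k)\<bar>) summable_on UNIV" for i
    using summable_on_cmult_right[OF ck[of i], of M]
    by (rule summable_on_comparison_test) (auto simp: abs_mult intro!: mult_right_mono b)
  have "(\<lambda>x. norm (f x)) summable_on (UNIV \<times> UNIV)"
  proof (rule summable_on_SigmaI)
    fix i :: int
    show "((\<lambda>k. norm (f (i, k))) has_sum (\<Sum>\<^sub>\<infinity>k. \<bar>b k * c (i - k)\<bar>) * bspline n (y - of_int i)) UNIV"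
      using has_sum_cmult_left[OF has_sum_infsum[OF bc[of i]], of "bspline n (y - of_int i)"]
      by (simp add: f_def abs_mult bspline_nonneg)
  next
    show "(\<lambda>i. (\<Sum>\<^sub>\<infinity>k. \<bar>b k * c (i - k)\<bar>) * bspline n (y - of_int i)) summable_on UNIV"
      using spline_has_sum[of "\<lambda>i. \<Sum>\<^sub>\<infinity>k. \<bar>b k * c (i - k)\<bar>" n y] by (auto simp: summable_on_def)
  qed auto
  then have "f summable_on (UNIV \<times> UNIV)" by (rule abs_summable_summable)
  then obtain S where S: "(f has_sum S) (UNIV \<times> UNIV)" by (auto simp: summable_on_def)
  have inner: "((\<lambda>k. f (i, k)) has_sum conv b c i * bspline n (y - of_int i)) UNIV" for i
  proof -
    have "(\<lambda>k. b k * c (i - k)) summable_on UNIV"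
      using bc[of i] by - (rule abs_summable_summable, simp)
    then have "((\<lambda>k. b k * c (i - k)) has_sum conv b c i) UNIV"
      unfolding conv_def by (rule has_sum_infsum)
    then show ?thesis unfolding f_def by (simp only: split_conv) (rule has_sum_cmult_left)
  qed
  have "((\<lambda>i. conv b c i * bspline n (y - of_int i)) has_sum S) UNIV"
    by (rule has_sum_SigmaD[OF S]) (use inner in auto)
  then have SS: "S = spline n (conv b c) y" unfolding spline_def by (simp add: infsumI)
  define g where "g = (\<lambda>(k,l). b k * (c l * bspline n (y - of_int k - of_int l)))"
  have "(\<lambda>x. g (case x of (i,k) \<Rightarrow> (k, i - k))) = f"
    by (auto simp: f_def g_def mult.assoc algebra_simps split: prod.splits)
  then have "(g has_sum S) (UNIV \<times> UNIV)"
    using has_sum_reindex_bij_betw[OF bij_conv, of g S] S by (simp only:)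
  then have "((\<lambda>k. b k * spline n c (y - of_int k)) has_sum S) UNIV"
  proof (rule has_sum_SigmaD)
    fix k :: int
    show "((\<lambda>l. g (k, l)) has_sum b k * spline n c (y - of_int k)) UNIV"
      unfolding g_def spline_eq by (simp only: split_conv) (rule has_sum_cmult_right[OF spline_has_sum])
  qed
  then show ?thesis by (simp add: SS)
qed

lemma spline_const:
  assumes "n \<ge> 1"
  shows "spline n (\<lambda>_. a) 0 = a"
proof -
  have "supp_ivl n 0 = (\<lambda>k. - int k) ` {..n}"
  proof (intro equalityI subsetI)
    fix j assume "j \<in> supp_ivl n 0"
    then have "real_of_int (- int n) \<le> of_int j" "j \<le> 0" by (auto simp: supp_ivl_def)
    then have "- int n \<le> j" "j \<le> 0" by (simp_all only: of_int_le_iff)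
    then show "j \<in> (\<lambda>k. - int k) ` {..n}" by (intro image_eqI[of _ _ "nat (- j)"]) auto
  qed (auto simp: supp_ivl_def)
  then have "spline n (\<lambda>_. a) 0 = (\<Sum>k\<le>n. a * bspline n (real k))"
    by (simp add: spline_eq sum.reindex inj_on_def)
  then show ?thesis using sum_bspline_int[OF assms] by (simp flip: sum_distrib_left)
qed

lemma spline_has_derivative:
  assumes n: "n \<ge> 2"
  shows "(spline (Suc n) e has_real_derivative spline n (\<lambda>j. e j - e (j - 1)) y) (at y)"
proof -
  have fl: "of_int \<lfloor>y\<rfloor> \<le> y" "y < of_int \<lfloor>y\<rfloor> + 1" by linarith+
  \<comment> \<open>A fixed finite window that contains all active indices for every z within
    distance 1 of y, with room for the index shift caused by the difference.\<close>
  define F where "F = {\<lfloor>y\<rfloor> - int n - 4..\<lfloor>y\<rfloor> + 4}"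
  have "((\<lambda>z. \<Sum>j\<in>F. e j * bspline (Suc n) (z - of_int j)) has_real_derivative
       (\<Sum>j\<in>F. e j * (bspline n (y - of_int j) - bspline n (y - of_int j - 1)))) (at y)" 
  proof (rule DERIV_sum)
    fix j
    have "((\<lambda>z. bspline (Suc n) (z - of_int j)) has_real_derivative (bspline n (y - of_int j) - bspline n (y - of_int j - 1)) * 1) (at y)"
      by (rule DERIV_chain2[where f="bspline (Suc n)" and g="\<lambda>z. z - of_int j", OF bspline_has_derivative])
         (use n in \<open>auto intro!: derivative_eq_intros\<close>)
    from DERIV_cmult[OF this, of "e j"]
    show "((\<lambda>z. e j * bspline (Suc n) (z - of_int j)) has_real_derivative e j * (bspline n (y - of_int j) - bspline n (y - of_int j - 1))) (at y)"
      by simp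
  qed
  moreover have "\<forall>\<^sub>F z in nhds y. spline (Suc n) e z = (\<Sum>j\<in>F. e j * bspline (Suc n) (z - of_int j))"
  proof -
    have "\<forall>\<^sub>F z in nhds y. z \<in> {y-1<..<y+1}" by (intro eventually_nhds_in_open) auto
    then show ?thesis
    proof eventually_elim
      case (elim z)
      show ?case
      proof (rule spline_eq_superset)
        show "supp_ivl (Suc n) z \<subseteq> F"
        proof
          fix j assume j: "j \<in> supp_ivl (Suc n) z"
          then have "z - real (Suc n) \<le> of_int j" "of_int j \<le> z" by (auto simp: supp_ivl_def)
          then have "real_of_int (\<lfloor>y\<rfloor> - int n - 4) \<le> of_int j" "real_of_int j \<le> of_int (\<lfloor>y\<rfloor> + 4)"
            using elim fl by (simp_all only: of_int_diff of_int_add of_int_numeral of_int_of_nat_eq of_nat_Suc greaterThanLessThan_iff) linarith+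
          then show "j \<in> F" by (simp add: F_def)
        qed
      qed (simp add: F_def)
    qed
  qed
  moreover have "(\<Sum>j\<in>F. e j * (bspline n (y - of_int j) - bspline n (y - of_int j - 1))) = spline n (\<lambda>j. e j - e (j - 1)) y"
  proof -
    have z: "bspline n (y - of_int j) = 0" if "j < \<lfloor>y\<rfloor> - int n - 2 \<or> j > \<lfloor>y\<rfloor> + 2" for j
    proof (rule bspline_outside_supp, rule notI)
      assume "j \<in> supp_ivl n y"
      then have "y - real n \<le> of_int j" "of_int j \<le> y" by (auto simp: supp_ivl_def)
      then have "real_of_int (\<lfloor>y\<rfloor> - int n - 2) \<le> of_int j" "real_of_int j \<le> of_int (\<lfloor>y\<rfloor> + 2)"
        using fl unfolding of_int_diff of_int_add of_int_numeral of_int_of_nat_eq by linarith+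
      then show False using that by (simp only: of_int_le_iff) linarith
    qed
    define G where "G = {\<lfloor>y\<rfloor> - int n - 3..\<lfloor>y\<rfloor> + 3}"
    have "(\<Sum>j\<in>F. e j * bspline n (y - of_int j)) = (\<Sum>j\<in>G. e j * bspline n (y - of_int j))"
      by (rule sum.mono_neutral_right) (auto simp: F_def G_def intro!: z)
    moreover have "(\<Sum>j\<in>F. e j * bspline n (y - of_int j - 1)) = (\<Sum>j\<in>G. e (j - 1) * bspline n (y - of_int j))"
    proof -
      have "(\<Sum>j\<in>F. e j * bspline n (y - of_int j - 1)) = (\<Sum>j\<in>{\<lfloor>y\<rfloor> - int n - 3..\<lfloor>y\<rfloor> + 5}. e (j - 1) * bspline n (y - of_int j))"
        by (rule sum.reindex_bij_witness[where i="\<lambda>j. j - 1" and j="\<lambda>j. j + 1"]) (auto simp: F_def algebra_simps)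
      also have "\<dots> = (\<Sum>j\<in>G. e (j - 1) * bspline n (y - of_int j))"
        by (rule sum.mono_neutral_right) (auto simp: G_def intro!: z)
      finally show ?thesis .
    qed
    moreover have "spline n (\<lambda>j. e j - e (j - 1)) y = (\<Sum>j\<in>G. (e j - e (j - 1)) * bspline n (y - of_int j))"
    proof (rule spline_eq_superset)
      show "supp_ivl n y \<subseteq> G"
      proof
        fix j assume "j \<in> supp_ivl n y"
        then have "y - real n \<le> of_int j" "of_int j \<le> y" by (auto simp: supp_ivl_def)
        then have "real_of_int (\<lfloor>y\<rfloor> - int n - 3) \<le> of_int j" "real_of_int j \<le> of_int (\<lfloor>y\<rfloor> + 3)"
          using fl unfolding of_int_diff of_int_add of_int_numeral of_int_of_nat_eq by linarith+
        then show "j \<in> G" by (simp add: G_def)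
      qed
    qed (simp add: G_def)
    ultimately show ?thesis by (simp add: right_diff_distrib left_diff_distrib sum_subtractf)
  qed
  ultimately show ?thesis by (subst DERIV_cong_ev) auto
qed

text \<open>Differentiation lowers the order and replaces the coefficients by their differences, so
  these vanish by induction; the remaining constant is 0 by the partition of unity. For order 2 the
  coefficients are the values at the peaks of the hat functions. No growth condition on
  \<open>e\<close> enters.\<close>

lemma spline_eq_0_imp:
  assumes "n \<ge> 2" "\<And>y. spline n e y = 0"
  shows "e = (\<lambda>_. 0)"
  using assms
proof (induction n arbitrary: e rule: dec_induct)
  case base
  show ?case
  proof
    fix k
    have "spline 2 e (of_int k + 1) = (\<Sum>j\<in>insert k (supp_ivl 2 (of_int k + 1)). e j * bspline 2 (of_int k + 1 - of_int j))"
      by (rule spline_eq_superset) auto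
    also have "\<dots> = (\<Sum>j\<in>{k}. e j * bspline 2 (of_int k + 1 - of_int j))"
    proof (rule sum.mono_neutral_right)
      show "\<forall>j\<in>insert k (supp_ivl 2 (of_int k + 1)) - {k}. e j * bspline 2 (of_int k + 1 - of_int j) = 0"
      proof
        fix j assume "j \<in> insert k (supp_ivl 2 (of_int k + 1)) - {k}"
        then have "j < k \<or> j > k" by auto
        then have "real_of_int (j + 1) \<le> of_int k \<or> real_of_int (k + 1) \<le> of_int j"
          by (simp only: of_int_le_iff) linarith
        then have "bspline 2 (of_int k + 1 - of_int j) = 0"
          by (auto intro: bspline_eq_0_left' bspline_eq_0_right)
        then show "e j * bspline 2 (of_int k + 1 - of_int j) = 0" by simp
      qed
    qed auto
    finally show "e k = 0" using base by (simp add: bspline_2)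
  qed
next
  case (step n)
  have "spline n (\<lambda>j. e j - e (j - 1)) y = 0" for y
  proof -
    have "(spline (Suc n) e has_real_derivative spline n (\<lambda>j. e j - e (j - 1)) y) (at y)"
      by (rule spline_has_derivative[OF step(1)])
    moreover have "spline (Suc n) e = (\<lambda>_. 0)" using step.prems by auto
    then have "(spline (Suc n) e has_real_derivative 0) (at y)" by simp
    ultimately show ?thesis by (rule DERIV_unique)
  qed
  from step.IH[OF this] have d: "e j = e (j - 1)" for j by (metis diff_eq_diff_eq diff_self)
  have const: "e j = e 0" for j
  proof (induction j rule: int_induct[where k=0])
    case (step1 i)
    then show ?case using d[of "i + 1"] by simp
  next
    case (step2 i)
    then show ?case using d[of i] by simp
  qed simp
  have "(\<lambda>_. e 0) = e" by (rule ext) (rule const[symmetric])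
  from arg_cong[OF this, of "\<lambda>f. spline (Suc n) f 0"]
  have "e 0 = 0" using spline_const[of "Suc n" "e 0"] step.prems[of 0] by linarith
  show ?case
  proof
    fix j show "e j = 0" using const[of j] \<open>e 0 = 0\<close> by linarith
  qed
qed

lemma conv_delta: "conv f (\<lambda>j. if j = 0 then 1 else 0) = f"
proof
  fix n
  have "((\<lambda>k. f k * (if n - k = 0 then 1 else 0)) has_sum f n) UNIV"
    by (rule has_sum_finite_neutralI[of "{n}"]) auto
  then show "conv f (\<lambda>j. if j = 0 then 1 else 0) n = f n" unfolding conv_def by (rule infsumI)
qed

lemma conv_zero: "conv (\<lambda>_. 0) g = (\<lambda>_. 0)"
  by (simp add: conv_def fun_eq_iff)

section \<open>The scaling function\<close>

context spline_roots
begin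

text \<open>A branch of (P/c)^alpha. Principal powers of the factors are analytic in the annulus
  because each factor stays in the unit disc about 1, whereas the arguments of the factors may add
  up past pi.\<close>

definition symbol_power :: "real \<Rightarrow> complex \<Rightarrow> complex" where
  "symbol_power \<alpha> z = (\<Prod>k\<in>{1..<m}. (1 + of_real (t k) * (1 / z)) powr of_real \<alpha> * (1 + of_real (t k) * z) powr of_real \<alpha>)"

lemma norm_t_less:
  fixes z :: complex
  assumes "k \<in> {1..<m}" "s\<^sup>2 < norm z" "s\<^sup>2 * norm z < 1"
  shows "norm (of_real (t k) * (1 / z)) < 1" "norm (of_real (t k) * z) < 1" "z \<noteq> 0"
proof -
  have t: "0 < t k" "t k \<le> s\<^sup>2" using t_bounds[OF assms(1)] t_le[OF assms(1)] by auto
  have z: "norm z > 0" using assms(2) by (rule le_less_trans[rotated]) simp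
  then show "z \<noteq> 0" by auto
  have "t k < norm z" using t assms(2) by linarith
  then show "norm (of_real (t k) * (1 / z)) < 1" using t z by (simp add: norm_divide)
  have "t k * norm z \<le> s\<^sup>2 * norm z" using t z by (intro mult_right_mono) auto
  then show "norm (of_real (t k) * z) < 1" using t assms(3) by (simp add: norm_mult)
qed

lemma has_laurent_symbol_power:
  assumes "\<And>z. z \<in> R \<Longrightarrow> s\<^sup>2 < norm z \<and> s\<^sup>2 * norm z < 1"
  shows "has_laurent (symbol_power \<alpha>) R"
proof -
  have R0: "0 \<notin> R"
  proof
    assume "0 \<in> R"
    then have "s\<^sup>2 < 0" using assms[of 0] by simp
    then show False using zero_le_power2[of s] by linarith
  qed
  have "has_laurent (\<lambda>z. (1 + of_real (t k) * (1 / z)) powr of_real \<alpha> * (1 + of_real (t k) * z) powr of_real \<alpha>) R"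
    if k: "k \<in> {1..<m}" for k
  proof (rule has_laurent_mult[OF _ _ R0])
    show "has_laurent (\<lambda>z. (1 + of_real (t k) * (1 / z)) powr of_real \<alpha>) R"
      by (rule has_laurent_reflect[where S="(\<lambda>z. 1 / z) ` R", OF has_laurent_binomial])
         (use norm_t_less(1)[OF k] assms in auto)
    show "has_laurent (\<lambda>z. (1 + of_real (t k) * z) powr of_real \<alpha>) R"
      by (rule has_laurent_binomial) (use norm_t_less(2)[OF k] assms in auto)
  qed
  then show ?thesis unfolding symbol_power_def[abs_def] by (intro has_laurent_prod R0) auto
qed

lemma one_plus_nonzero: "norm (w :: complex) < 1 \<Longrightarrow> 1 + w \<noteq> 0"
  by (metis add.commute add_eq_0_iff norm_minus_cancel norm_one order_less_irrefl)

lemma symbol_power_inverse: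
  assumes "s\<^sup>2 < norm z" "s\<^sup>2 * norm z < 1"
  shows "symbol_power \<alpha> z * symbol_power (- \<alpha>) z = 1"
proof -
  have pw: "w powr of_real \<alpha> * w powr of_real (- \<alpha>) = 1" if "w \<noteq> 0" for w :: complex
    using that by (simp flip: powr_add)
  have "symbol_power \<alpha> z * symbol_power (- \<alpha>) z = (\<Prod>k\<in>{1..<m}. 1)"
    unfolding symbol_power_def prod.distrib[symmetric]
  proof (rule prod.cong[OF refl])
    fix k assume k: "k \<in> {1..<m}"
    note nz = one_plus_nonzero[OF norm_t_less(1)[OF k assms]] one_plus_nonzero[OF norm_t_less(2)[OF k assms]]
    have re: "a * b * (c * d) = (a * c) * (b * d)" for a b c d :: complex by simp
    show "(1 + of_real (t k) * (1 / z)) powr of_real \<alpha> * (1 + of_real (t k) * z) powr of_real \<alpha> *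
        ((1 + of_real (t k) * (1 / z)) powr of_real (- \<alpha>) * (1 + of_real (t k) * z) powr of_real (- \<alpha>)) = 1"
      by (rule trans[OF re]) (simp only: pw[OF nz(1)] pw[OF nz(2)] mult_1)
  qed
  then show ?thesis by simp
qed

lemma symbol_power_reflect: "symbol_power \<alpha> (1 / z) = symbol_power \<alpha> z"
  unfolding symbol_power_def by (intro prod.cong refl) simp

lemma unit_circle_bounds: "norm (z :: complex) = 1 \<Longrightarrow> s\<^sup>2 < norm z \<and> s\<^sup>2 * norm z < 1"
  using s_bounds t_bounds[OF m1] by simp

text \<open>The value of P at exp(i theta): the two factors of index k are conjugate, with product
  |1 + t_k exp(i theta)|^2.\<close>

definition real_symbol :: "real \<Rightarrow> real" where
  "real_symbol \<theta> = c * (\<Prod>k\<in>{1..<m}. 1 + 2 * t k * cos \<theta> + (t k)\<^sup>2)"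

lemma norm_one_plus_t_exp: "(norm (1 + of_real a * exp (\<i> * of_real \<theta>)))\<^sup>2 = 1 + 2 * a * cos \<theta> + a\<^sup>2"
proof -
  have "(norm (1 + of_real a * exp (\<i> * of_real \<theta>)))\<^sup>2 = (1 + a * cos \<theta>)\<^sup>2 + (a * sin \<theta>)\<^sup>2"
    by (simp add: cmod_power2 Re_exp Im_exp)
  also have "\<dots> = 1 + 2 * a * cos \<theta> + a\<^sup>2 * ((sin \<theta>)\<^sup>2 + (cos \<theta>)\<^sup>2)"
    unfolding power2_sum power_mult_distrib distrib_left by simp
  finally show ?thesis by simp
qed

text \<open>On the circle conjugate factors have conjugate powers, so the chosen branch is the
  positive square root that occurs in the definition of the scaling coefficients.\<close>

lemma symbol_power_unit_circle:
  "of_real (1 / sqrt c) * symbol_power (-1/2) (exp (\<i> * of_real \<theta>)) = of_real (1 / sqrt (real_symbol \<theta>))"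
proof -
  define z where "z = exp (\<i> * complex_of_real \<theta>)"
  have z: "norm z = 1" "1 / z = cnj z"
    by (simp_all add: z_def norm_exp_eq_Re exp_minus[symmetric] exp_cnj divide_inverse)
  have "(1 + of_real (t k) * (1 / z)) powr of_real (-1/2) * (1 + of_real (t k) * z) powr of_real (-1/2)
     = of_real (1 / sqrt (1 + 2 * t k * cos \<theta> + (t k)\<^sup>2))" if k: "k \<in> {1..<m}" for k
  proof -
    define w where "w = 1 + of_real (t k) * z"
    have n: "norm (of_real (t k) * z) < 1" using t_bounds[OF k] z by (simp add: norm_mult)
    have w0: "w \<noteq> 0" unfolding w_def by (rule one_plus_nonzero[OF n])
    \<comment> \<open>Conjugation commutes with the principal power away from the negative axis; a
      nonnegative real part ensures this.\<close>
    have wr: "Re w \<ge> 0"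
      using n abs_Re_le_cmod[of "of_real (t k) * z"] unfolding w_def by simp
    have "1 + of_real (t k) * (1 / z) = cnj w" by (simp add: w_def z(2))
    then have "(1 + of_real (t k) * (1 / z)) powr of_real (-1/2) = cnj (w powr of_real (-1/2))"
      using cnj_powr[of w "of_real (-1/2)"] wr by (simp only: complex_cnj_complex_of_real)
    then have "(1 + of_real (t k) * (1 / z)) powr of_real (-1/2) * w powr of_real (-1/2) = of_real ((norm (w powr of_real (-1/2)))\<^sup>2)"
      by (simp only: complex_norm_square mult.commute)
    also have "(norm (w powr of_real (-1/2)))\<^sup>2 = norm (w powr of_real (-1/2) * w powr of_real (-1/2))"
      by (simp only: norm_mult power2_eq_square)
    also have "w powr of_real (-1/2) * w powr of_real (-1/2) = 1 / w"
      using w0 by (simp add: powr_minus_divide flip: powr_add)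
    also have "norm (1 / w) = 1 / sqrt ((norm w)\<^sup>2)" by (simp add: norm_divide)
    also have "(norm w)\<^sup>2 = 1 + 2 * t k * cos \<theta> + (t k)\<^sup>2"
      unfolding w_def z_def by (rule norm_one_plus_t_exp)
    finally show ?thesis by (simp only: w_def)
  qed
  then have "symbol_power (-1/2) z = (\<Prod>k\<in>{1..<m}. of_real (1 / sqrt (1 + 2 * t k * cos \<theta> + (t k)\<^sup>2)))"
    unfolding symbol_power_def by (intro prod.cong refl)
  also have "\<dots> = of_real (1 / sqrt (\<Prod>k\<in>{1..<m}. 1 + 2 * t k * cos \<theta> + (t k)\<^sup>2))"
  proof -
    have "(\<Prod>k\<in>K. of_real (1 / sqrt (f k))) = complex_of_real (1 / sqrt (\<Prod>k\<in>K. f k))" if "finite K"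
      for K :: "nat set" and f
      using that by (induction K rule: finite_induct) (simp_all add: real_sqrt_mult)
    then show ?thesis by simp
  qed
  finally show ?thesis unfolding z_def real_symbol_def
    by (simp only: of_real_mult[symmetric] real_sqrt_mult) simp
qed

text \<open>The half-angle formula makes each factor 1 + 2t cos(theta) + t^2 equal to (1-t)^2 + 4t
  x^2 with x = cos(theta/2). A polynomial is determined by its values on [-1,1], which settles the
  definite description.\<close>

lemma poly_bspline_P: "poly (bspline_P m) (cos (\<theta> / 2)) = real_symbol \<theta>"
proof -
  define p where "p = smult c (\<Prod>k\<in>{1..<m}. [:(1 - t k)\<^sup>2, 0, 4 * t k:])"
  have cos2: "cos \<theta> = 2 * (cos (\<theta> / 2))\<^sup>2 - 1" for \<theta> :: real
    using cos_double_cos[of "\<theta> / 2"] by simp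
  have pp: "poly p (cos (\<theta> / 2)) = real_symbol \<theta>" for \<theta>
  proof -
    have "poly [:(1 - t k)\<^sup>2, 0, 4 * t k:] (cos (\<theta> / 2)) = 1 + 2 * t k * cos \<theta> + (t k)\<^sup>2" for k
      unfolding cos2[of \<theta>] by (simp add: power2_eq_square algebra_simps)
    then show ?thesis unfolding p_def real_symbol_def by (simp only: poly_smult poly_prod)
  qed
  have sum: "2 * pi * (\<Sum>\<^sub>\<infinity>j\<in>(UNIV::int set). (norm (fourier (bspline m) (\<theta> + 2 * pi * of_int j)))\<^sup>2) = real_symbol \<theta>" for \<theta>
  proof -
    define E where "E = exp (- \<i> * complex_of_real \<theta>)"
    have E0: "E \<noteq> 0" by (simp add: E_def)
    have "(1 + of_real (t k) / E) * (1 + of_real (t k) * E) = of_real (1 + 2 * t k * cos \<theta> + (t k)\<^sup>2)" for k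
    proof -
      have "1 / E + E = of_real (2 * cos \<theta>)"
        unfolding E_def by (simp add: cos_exp_eq exp_minus cos_of_real[symmetric] field_simps del: cos_of_real)
      moreover have "(1 + of_real (t k) / E) * (1 + of_real (t k) * E) = 1 + of_real (t k) * (1 / E + E) + (of_real (t k))\<^sup>2"
        using E0 by (simp add: field_simps power2_eq_square)
      ultimately show ?thesis by simp
    qed
    then have "poly (bpoly (2 * m)) E = E ^ m * of_real (real_symbol \<theta>)"
      unfolding bpoly_factor[OF E0] real_symbol_def by (simp only: of_real_mult of_real_prod)
    with sum_norm_fourier_bspline[of m \<theta>] m
    have "of_real (2 * pi * (\<Sum>\<^sub>\<infinity>j\<in>(UNIV::int set). (norm (fourier (bspline m) (\<theta> + 2 * pi * of_int j)))\<^sup>2)) * E ^ m = E ^ m * of_real (real_symbol \<theta>)"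
      unfolding E_def by simp
    then have "complex_of_real (2 * pi * (\<Sum>\<^sub>\<infinity>j\<in>(UNIV::int set). (norm (fourier (bspline m) (\<theta> + 2 * pi * of_int j)))\<^sup>2)) = of_real (real_symbol \<theta>)"
      using E0 by (simp only: mult.commute[of _ "E ^ m"] mult_left_cancel power_not_zero not_False_eq_True)
    then show ?thesis by (simp only: of_real_eq_iff)
  qed
  have "bspline_P m = p"
    unfolding bspline_P_def sum
  proof (rule the_equality)
    show "\<forall>\<theta>. poly p (cos (\<theta> / 2)) = real_symbol \<theta>" using pp by simp
    fix q assume q: "\<forall>\<theta>. poly q (cos (\<theta> / 2)) = real_symbol \<theta>"
    show "q = p"
    proof (rule ccontr)
      assume "q \<noteq> p"
      then have "finite {x. poly (q - p) x = 0}" by (intro poly_roots_finite) simp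
      moreover have "{-1..1} \<subseteq> {x. poly (q - p) x = 0}"
      proof
        fix x :: real assume "x \<in> {-1..1}"
        then have "cos (2 * arccos x / 2) = x" by simp
        then show "x \<in> {x. poly (q - p) x = 0}" using q pp by (metis (mono_tags, lifting) diff_self mem_Collect_eq poly_diff)
      qed
      ultimately have "finite {-1..1::real}" by (rule finite_subset[rotated])
      then show False using infinite_Icc[of "-1::real" 1] by simp
    qed
  qed
  then show ?thesis using pp by simp
qed

text \<open>The branches of P^(-1/2) and P^(1/2) given by the binomial series of the factors of P; they are
  analytic in the annulus between the absolute values of the two roots nearest to the unit circle.\<close>

definition symbol_C :: "complex \<Rightarrow> complex" where
  "symbol_C z = of_real (1 / sqrt c) * symbol_power (-1/2) z"

definition symbol_D :: "complex \<Rightarrow> complex" where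
  "symbol_D z = of_real (sqrt c) * symbol_power (1/2) z"

lemma symbol_C_D:
  assumes "s\<^sup>2 < norm z" "s\<^sup>2 * norm z < 1"
  shows "symbol_C z * symbol_D z = 1"
proof -
  have re: "a * x * (b * y) = (a * b) * (y * x)" for a b x y :: complex by simp
  have "symbol_power (1/2) z * symbol_power (-1/2) z = 1"
    using symbol_power_inverse[OF assms, of "1/2"] by simp
  moreover have "complex_of_real (1 / sqrt c) * of_real (sqrt c) = 1"
    using c_pos by (simp flip: of_real_mult)
  ultimately show ?thesis unfolding symbol_C_def symbol_D_def by (subst re) (simp only: mult_1)
qed

text \<open>The symbol is real on the circle, so the real part of the Fourier integral for a
  coefficient is the defining cosine integral.\<close>

lemma laurent_scaling_coeff: "laurent_on (scaling_coeff m) symbol_C (sphere 0 1)"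
proof -
  have "has_laurent symbol_C (sphere 0 1)"
    unfolding symbol_C_def[abs_def]
    by (intro has_laurent_mult has_laurent_const has_laurent_symbol_power) (use unit_circle_bounds in auto)
  then obtain f where f: "laurent_on f symbol_C (sphere 0 1)" unfolding has_laurent_def by blast
  have "f j = scaling_coeff m j" for j
  proof -
    have "((\<lambda>\<theta>. symbol_C (exp (\<i> * of_real \<theta>)) * exp (- \<i> * of_int j * of_real \<theta>)) has_integral of_real (2 * pi * f j)) {-pi..pi}"
      by (rule laurent_coeff_integral[OF f])
    from has_integral_linear[OF this bounded_linear_Re]
    have "((\<lambda>\<theta>. Re (symbol_C (exp (\<i> * of_real \<theta>)) * exp (- \<i> * of_int j * of_real \<theta>))) has_integral 2 * pi * f j) {-pi..pi}"
      by (simp add: o_def)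
    moreover have "Re (symbol_C (exp (\<i> * of_real \<theta>)) * exp (- \<i> * of_int j * of_real \<theta>)) = cos (of_int j * \<theta>) / sqrt (poly (bspline_P m) (cos (\<theta> / 2)))" for \<theta>
      unfolding symbol_C_def symbol_power_unit_circle poly_bspline_P by (simp add: Re_exp)
    ultimately have "((\<lambda>\<theta>. cos (of_int j * \<theta>) / sqrt (poly (bspline_P m) (cos (\<theta> / 2)))) has_integral 2 * pi * f j) {-pi..pi}"
      by simp
    then show ?thesis unfolding scaling_coeff_def by (simp add: integral_unique)
  qed
  then have "f = scaling_coeff m" by auto
  then show ?thesis using f by simp
qed

end

section \<open>The two-scale relation and the wavelet\<close>

lemma abs_summable_bounded:
  fixes f :: "int \<Rightarrow> real"
  assumes "(\<lambda>j. \<bar>f j\<bar>) summable_on UNIV"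
  shows "\<bar>f j\<bar> \<le> (\<Sum>\<^sub>\<infinity>j. \<bar>f j\<bar>)"
  using finite_sum_le_infsum[OF assms, of "{j}"] by simp

definition refinement_mask :: "nat \<Rightarrow> int \<Rightarrow> real" where
  "refinement_mask n j = (if j \<ge> 0 then 2 * (1/2) ^ n * real (n choose nat j) else 0)"

lemma laurent_refinement_mask: "laurent_on (refinement_mask n) (\<lambda>z. 2 * ((1 + z) / 2) ^ n) R"
proof -
  have "laurent_on (\<lambda>j. if j \<ge> 0 then 2 * (1/2) ^ n * real (n choose nat j) else 0) (\<lambda>z. 2 * ((1 + z) / 2) ^ n) R"
  proof (rule laurent_on_nat)
    fix z :: complex
    have "(\<lambda>k. of_real (2 * (1/2) ^ n * real (n choose k)) * z ^ k) sums (\<Sum>k\<le>n. of_real (2 * (1/2) ^ n * real (n choose k)) * z ^ k)"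
      by (rule sums_finite) auto
    also have "(\<Sum>k\<le>n. of_real (2 * (1/2) ^ n * real (n choose k)) * z ^ k) = 2 * (1/2) ^ n * (z + 1) ^ n"
      by (subst binomial_ring) (simp add: sum_distrib_left mult.assoc)
    also have "\<dots> = 2 * ((1 + z) / 2) ^ n" by (simp add: power_divide add.commute)
    finally show "(\<lambda>k. of_real (2 * (1/2) ^ n * real (n choose k)) * z ^ k) sums (2 * ((1 + z) / 2) ^ n)" .
    show "summable (\<lambda>k. norm (of_real (2 * (1/2) ^ n * real (n choose k)) * z ^ k))"
      by (rule summable_finite[of "{..n}"]) auto
  qed
  then show ?thesis by (simp add: refinement_mask_def[abs_def])
qed

lemma spline_refinement_mask:
  assumes "n \<ge> 1"
  shows "spline n (refinement_mask n) (2 * x) = bspline n x"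
proof -
  have "((\<lambda>j. refinement_mask n j * bspline n (2 * x - of_int j)) has_sum bspline n x) UNIV"
  proof (rule has_sum_finite_neutralI[of "int ` {..n}"])
    fix j assume "j \<in> UNIV - int ` {..n}"
    then have "j < 0 \<or> nat j > n" by (metis Diff_iff atMost_iff image_eqI int_nat_eq not_le_imp_less not_less)
    then show "refinement_mask n j * bspline n (2 * x - of_int j) = 0"
      by (auto simp: refinement_mask_def binomial_eq_0)
  next
    show "bspline n x = (\<Sum>j\<in>int ` {..n}. refinement_mask n j * bspline n (2 * x - of_int j))"
      by (subst bspline_two_scale[OF assms]) (simp add: sum.reindex refinement_mask_def sum_distrib_left mult.assoc)
  qed auto
  then show ?thesis unfolding spline_def by (rule infsumI)
qed

context spline_roots
begin

text \<open>Writing N_m(x) in terms of the N_m(2x - j) turns the symbol C(z) of the scaling function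
  into C(z^2) times the binomial mask. Multiplication by D = 1/C converts back to translates of the
  scaling function.\<close>

definition symbol_A :: "complex \<Rightarrow> complex" where
  "symbol_A z = symbol_C (z\<^sup>2) * (2 * ((1 + z) / 2) ^ m) * symbol_D z"

lemma scaling_fun_spline: "scaling_fun m = spline m (scaling_coeff m)"
  by (simp add: fun_eq_iff scaling_fun_def spline_def)

lemma scaling_coeff_summable: "(\<lambda>j. \<bar>scaling_coeff m j\<bar>) summable_on UNIV"
  by (rule laurent_on_abs_summable[OF laurent_scaling_coeff, of 1]) auto

lemma has_laurent_symbol_D:
  assumes "\<And>z. z \<in> R \<Longrightarrow> s\<^sup>2 < norm z \<and> s\<^sup>2 * norm z < 1" "0 \<notin> R"
  shows "has_laurent symbol_D R"
  unfolding symbol_D_def[abs_def]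
  by (intro has_laurent_mult has_laurent_const has_laurent_symbol_power assms)

lemma has_laurent_symbol_C:
  assumes "\<And>z. z \<in> R \<Longrightarrow> s\<^sup>2 < norm z \<and> s\<^sup>2 * norm z < 1" "0 \<notin> R"
  shows "has_laurent symbol_C R"
  unfolding symbol_C_def[abs_def]
  by (intro has_laurent_mult has_laurent_const has_laurent_symbol_power assms)

lemma sphere_bounds: "z \<in> sphere 0 1 \<Longrightarrow> s\<^sup>2 < norm (z :: complex) \<and> s\<^sup>2 * norm z < 1"
  by (rule unit_circle_bounds) simp

text \<open>The sequence with symbol A satisfies the two-scale relation because
  \<open>conv a cc = q\<close>, where \<open>q\<close> expands the scaling function in the N_m(2x -
  j). For any other solution, linear independence makes the convolution of the difference with
  \<open>cc\<close> zero, and the inverse sequence \<open>d\<close> removes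
  \<open>cc\<close>.\<close>

lemma scaling_const_symbol:
  "laurent_on (scaling_const m) symbol_A (sphere 0 1)"
proof -
  define cc where "cc = scaling_coeff m"
  define cu where "cu j = (if even j then cc (j div 2) else 0)" for j
  have S0: "0 \<notin> sphere 0 (1::real)" "(0::complex) \<notin> sphere 0 1" by auto
  obtain d where d: "laurent_on d symbol_D (sphere 0 1)"
    using has_laurent_symbol_D[OF sphere_bounds] S0 unfolding has_laurent_def by blast
  have lc: "laurent_on cc symbol_C (sphere 0 1)" unfolding cc_def by (rule laurent_scaling_coeff)
  have lcu: "laurent_on cu (\<lambda>z. symbol_C (z\<^sup>2)) (sphere 0 1)"
    unfolding cu_def[abs_def] by (rule laurent_on_square[OF lc]) (simp add: norm_power)
  define q where "q = conv cu (refinement_mask m)"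
  have lq: "laurent_on q (\<lambda>z. symbol_C (z\<^sup>2) * (2 * ((1 + z) / 2) ^ m)) (sphere 0 1)"
    unfolding q_def by (rule laurent_on_mult[OF lcu laurent_refinement_mask S0(2)])
  define a where "a = conv q d"
  have la: "laurent_on a symbol_A (sphere 0 1)"
    unfolding a_def symbol_A_def[abs_def] by (rule laurent_on_mult[OF lq d S0(2)])
  have sum: "(\<lambda>j. \<bar>f j\<bar>) summable_on UNIV" if "laurent_on f F (sphere 0 1)" for f F
    by (rule laurent_on_abs_summable[OF that, of 1]) auto
  have CD: "symbol_C z * symbol_D z = 1" if "z \<in> sphere 0 1" for z
    using symbol_C_D sphere_bounds[OF that] by blast
  have ac: "conv a cc = q"
  proof (rule laurent_on_unique[OF _ lq])
    have "laurent_on (conv a cc) (\<lambda>z. symbol_A z * symbol_C z) (sphere 0 1)"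
      by (rule laurent_on_mult[OF la lc S0(2)])
    then show "laurent_on (conv a cc) (\<lambda>z. symbol_C (z\<^sup>2) * (2 * ((1 + z) / 2) ^ m)) (sphere 0 1)"
    proof (rule laurent_on_cong)
      fix z :: complex assume "z \<in> sphere 0 1"
      have "x * d * c = x" if "c * d = 1" for x c d :: complex
        using that by (simp add: mult.assoc mult.commute)
      from this[OF CD[OF \<open>z \<in> sphere 0 1\<close>]]
      show "symbol_A z * symbol_C z = symbol_C (z\<^sup>2) * (2 * ((1 + z) / 2) ^ m)"
        unfolding symbol_A_def .
    qed
  qed
  have cd: "conv cc d = (\<lambda>j. if j = 0 then 1 else 0)"
  proof (rule laurent_on_unique)
    show "laurent_on (conv cc d) (\<lambda>_. 1) (sphere 0 1)"
      by (rule laurent_on_cong[OF laurent_on_mult[OF lc d S0(2)]]) (rule CD)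
    show "laurent_on (\<lambda>j. if j = 0 then 1 else 0) (\<lambda>_. 1) (sphere 0 1)"
      using laurent_on_zmonom[of 0 1] by simp
  qed
  have phi: "scaling_fun m x = spline m q (2 * x)" for x
  proof -
    have "((\<lambda>j. cu j * spline m (refinement_mask m) (2 * x - of_int j)) has_sum spline m q (2 * x)) UNIV"
      unfolding q_def by (rule spline_conv[OF abs_summable_bounded[OF sum[OF lcu]] sum[OF laurent_refinement_mask]])
    \<comment> \<open>The sequence \<open>cu\<close> lives on even indices, where the refined spline
      is a single B-spline of argument x - k.\<close>
    also have "?this \<longleftrightarrow> ((\<lambda>j. cu j * spline m (refinement_mask m) (2 * x - of_int j)) has_sum spline m q (2 * x)) (range (\<lambda>k. 2 * k))"
      by (rule has_sum_cong_neutral) (auto simp: cu_def elim!: evenE)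
    also have "\<dots> \<longleftrightarrow> ((\<lambda>k. cu (2 * k) * spline m (refinement_mask m) (2 * x - of_int (2 * k))) has_sum spline m q (2 * x)) UNIV"
      by (subst has_sum_reindex) (auto simp: inj_on_def o_def)
    also have "(\<lambda>k. cu (2 * k) * spline m (refinement_mask m) (2 * x - of_int (2 * k))) = (\<lambda>k. cc k * bspline m (x - of_int k))"
    proof
      fix k :: int
      have "2 * x - of_int (2 * k) = 2 * (x - of_int k)" by simp
      then have "spline m (refinement_mask m) (2 * x - of_int (2 * k)) = bspline m (x - of_int k)"
        using spline_refinement_mask[of m "x - of_int k"] m by (simp only:)
      then show "cu (2 * k) * spline m (refinement_mask m) (2 * x - of_int (2 * k)) = cc k * bspline m (x - of_int k)"
        by (simp add: cu_def)
    qed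
    finally show ?thesis unfolding scaling_fun_spline spline_def[of m "scaling_coeff m"] cc_def by (rule infsumI)
  qed
  have hs: "((\<lambda>j. b j * scaling_fun m (y - of_int j)) has_sum spline m (conv b cc) y) UNIV"
    if "\<And>j. \<bar>b j\<bar> \<le> M" for b M y
    unfolding scaling_fun_spline cc_def by (rule spline_conv[OF that scaling_coeff_summable])
  have "scaling_const m = a"
    unfolding scaling_const_def
  proof (rule the_equality, intro conjI allI)
    define M where "M = (\<Sum>\<^sub>\<infinity>j. \<bar>a j\<bar>)"
    have aM: "\<bar>a j\<bar> \<le> M" for j unfolding M_def by (rule abs_summable_bounded[OF sum[OF la]])
    show "(\<lambda>j. (a j)\<^sup>2) summable_on UNIV"
    proof (rule summable_on_comparison_test[OF summable_on_cmult_right[OF sum[OF la], of M]])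
      fix j
      have "\<bar>a j\<bar> * \<bar>a j\<bar> \<le> M * \<bar>a j\<bar>" by (rule mult_right_mono[OF aM]) simp
      then show "(a j)\<^sup>2 \<le> M * \<bar>a j\<bar>" by (simp add: power2_eq_square)
    qed simp
    show "((\<lambda>j. a j * scaling_fun m (2 * x - of_int j)) has_sum scaling_fun m x) UNIV" for x
      unfolding phi[of x] ac[symmetric] by (rule hs[OF aM])
  next
    fix a' assume a': "(\<lambda>j. (a' j)\<^sup>2) summable_on UNIV \<and>
       (\<forall>x. ((\<lambda>j. a' j * scaling_fun m (2 * x - of_int j)) has_sum scaling_fun m x) UNIV)"
    \<comment> \<open>Square summability enters only as boundedness, through |x| <= 1 + x^2.\<close>
    define M where "M = 1 + (\<Sum>\<^sub>\<infinity>j. (a' j)\<^sup>2)"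
    have a'M: "\<bar>a' j\<bar> \<le> M" for j
    proof -
      have "(a' j)\<^sup>2 \<le> (\<Sum>\<^sub>\<infinity>j. (a' j)\<^sup>2)"
        using finite_sum_le_infsum[of "\<lambda>j. (a' j)\<^sup>2" UNIV "{j}"] a' by simp
      moreover have "\<bar>a' j\<bar> \<le> 1 + (a' j)\<^sup>2"
        using zero_le_power2[of "\<bar>a' j\<bar> - 1"] by (simp add: power2_eq_square algebra_simps)
      ultimately show ?thesis by (simp add: M_def)
    qed
    define b where "b j = a' j - a j" for j
    have bM: "\<bar>b j\<bar> \<le> M + (\<Sum>\<^sub>\<infinity>j. \<bar>a j\<bar>)" for j
      using a'M[of j] abs_summable_bounded[OF sum[OF la], of j] by (simp add: b_def)
    have "spline m (conv b cc) y = 0" for y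
    proof -
      define x where "x = y / 2"
      have y: "y = 2 * x" by (simp add: x_def)
      have 1: "((\<lambda>j. a' j * scaling_fun m (2 * x - of_int j)) has_sum scaling_fun m x) UNIV" using a' by blast
      have 2: "((\<lambda>j. a j * scaling_fun m (2 * x - of_int j)) has_sum scaling_fun m x) UNIV"
        unfolding phi[of x] ac[symmetric] by (rule hs[OF abs_summable_bounded[OF sum[OF la]]])
      have "((\<lambda>j. b j * scaling_fun m (2 * x - of_int j)) has_sum 0) UNIV"
        using has_sum_add[OF 1 has_sum_cmult_right[OF 2, of "-1"]] by (simp add: b_def left_diff_distrib)
      moreover have "((\<lambda>j. b j * scaling_fun m (2 * x - of_int j)) has_sum spline m (conv b cc) (2 * x)) UNIV"
        by (rule hs[OF bM])
      ultimately show ?thesis unfolding y by (rule has_sum_unique[symmetric])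
    qed
    then have "conv b cc = (\<lambda>_. 0)" by (rule spline_eq_0_imp[OF m])
    then have "conv (conv b cc) d = (\<lambda>_. 0)" by (simp add: conv_zero)
    moreover have "conv (conv b cc) d = conv b (conv cc d)"
      by (rule ext) (rule conv_assoc_bounded[OF bM sum[OF lc] sum[OF d]])
    ultimately have "b = (\<lambda>_. 0)" by (simp add: cd conv_delta)
    then show "a' = a" by (auto simp: b_def fun_eq_iff)
  qed
  then show ?thesis using la by simp
qed

text \<open>The coefficients (-1)^j a_{1-j} have the symbol -z A(-1/z), and C(z) passes from the
  scaling function to B-splines. Invariance of C and D under z -> 1/z gives this form.\<close>

definition symbol_W :: "complex \<Rightarrow> complex" where
  "symbol_W z = - (2 * z * ((1 - 1 / z) / 2) ^ m * (symbol_D (- z) * symbol_C z) * symbol_C (z\<^sup>2))"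

lemma symbol_C_reflect: "symbol_C (1 / z) = symbol_C z" and symbol_D_reflect: "symbol_D (1 / z) = symbol_D z"
  by (simp_all only: symbol_C_def symbol_D_def symbol_power_reflect)

definition wavelet_coeff :: "int \<Rightarrow> real" where
  "wavelet_coeff = conv (\<lambda>j. (-1) powi j * scaling_const m (1 - j)) (scaling_coeff m)"

lemma laurent_wavelet_coeff: "laurent_on wavelet_coeff symbol_W (sphere 0 1)"
  and wavelet_spline: "wavelet m x = spline m wavelet_coeff (2 * x)"
proof -
  define v where "v j = (-1) powi j * scaling_const m (1 - j)" for j :: int
  have "laurent_on (\<lambda>j. scaling_const m (- j)) (\<lambda>z. symbol_A (1 / z)) (sphere 0 1)"
    by (rule laurent_on_reflect[OF scaling_const_symbol]) (simp add: norm_divide)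
  then have "laurent_on (\<lambda>j. (-1) powi j * scaling_const m (- j)) (\<lambda>z. symbol_A (1 / (- z))) (sphere 0 1)"
    by (rule laurent_on_neg) simp
  \<comment> \<open>Since 1 - j = -(j - 1), a shift by one index is needed; it changes the parity of
    the sign, which the factor -1 repairs.\<close>
  then have "laurent_on (\<lambda>j. (-1) powi (j - 1) * scaling_const m (- (j - 1))) (\<lambda>z. z powi 1 * symbol_A (1 / (- z))) (sphere 0 1)"
    by (rule laurent_on_shift) simp
  from laurent_on_cmult[OF this, of "-1"]
  have lv: "laurent_on v (\<lambda>z. - (z * symbol_A (1 / (- z)))) (sphere 0 1)"
    by (simp add: v_def[abs_def] power_int_diff)
  have "laurent_on wavelet_coeff (\<lambda>z. - (z * symbol_A (1 / (- z))) * symbol_C z) (sphere 0 1)"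
    unfolding wavelet_coeff_def v_def[symmetric, abs_def]
    by (rule laurent_on_mult[OF lv laurent_scaling_coeff]) simp
  then show "laurent_on wavelet_coeff symbol_W (sphere 0 1)"
  proof (rule laurent_on_cong)
    fix z :: complex
    have 1: "(1 / (- z))\<^sup>2 = 1 / z\<^sup>2" by (simp add: power_divide)
    have 2: "1 + 1 / (- z) = 1 - 1 / z" by simp
    have "- (z * (a * (2 * x) * d)) * c = - (2 * z * x * (d * c) * a)" for a x d c :: complex
      by simp
    then show "- (z * symbol_A (1 / (- z))) * symbol_C z = symbol_W z"
      unfolding symbol_A_def symbol_W_def 1 2 symbol_C_reflect symbol_D_reflect .
  qed
  have sv: "(\<lambda>j. \<bar>v j\<bar>) summable_on UNIV"
    by (rule laurent_on_abs_summable[OF lv, of 1]) auto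
  have "((\<lambda>j. v j * scaling_fun m (2 * x - of_int j)) has_sum spline m wavelet_coeff (2 * x)) UNIV"
    unfolding scaling_fun_spline wavelet_coeff_def v_def[symmetric, abs_def]
    by (rule spline_conv[OF abs_summable_bounded[OF sv] scaling_coeff_summable])
  then show "wavelet m x = spline m wavelet_coeff (2 * x)"
    unfolding wavelet_def v_def by (rule infsumI)
qed

text \<open>The factors containing C and D are invariant under z -> 1/z. Only z (1 - 1/z)^m changes,
  and it accounts for the sign (-1)^m and the shift by m - 2.\<close>

lemma wavelet_coeff_reflect: "wavelet_coeff (- j) = (-1) ^ m * wavelet_coeff (j - (int m - 2))"
proof -
  have 1: "laurent_on (\<lambda>j. wavelet_coeff (- j)) (\<lambda>z. symbol_W (1 / z)) (sphere 0 1)"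
    by (rule laurent_on_reflect[OF laurent_wavelet_coeff]) (simp add: norm_divide)
  have "laurent_on (\<lambda>j. wavelet_coeff (j - (int m - 2))) (\<lambda>z. z powi (int m - 2) * symbol_W z) (sphere 0 1)"
    by (rule laurent_on_shift[OF laurent_wavelet_coeff]) simp
  from laurent_on_cmult[OF this, of "(-1) ^ m"]
  have 2: "laurent_on (\<lambda>j. (-1) ^ m * wavelet_coeff (j - (int m - 2))) (\<lambda>z. of_real ((-1) ^ m) * (z powi (int m - 2) * symbol_W z)) (sphere 0 1)" .
  have "laurent_on (\<lambda>j. (-1) ^ m * wavelet_coeff (j - (int m - 2))) (\<lambda>z. symbol_W (1 / z)) (sphere 0 1)"
  proof (rule laurent_on_cong[OF 2])
    fix z :: complex assume "z \<in> sphere 0 1"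
    then have z: "z \<noteq> 0" by auto
    have a: "- (1 / z) = 1 / (- z)" "(1 / z)\<^sup>2 = 1 / z\<^sup>2" by (simp_all add: power_divide)
    have "of_real ((-1) ^ m) * (z powi (int m - 2) * (z * ((1 - 1 / z) / 2) ^ m)) = (1 / z) * ((1 - 1 / (1 / z)) / 2) ^ m"
    proof -
      have "z powi (int m - 2) * z = z ^ m / z"
        using z by (simp add: power_int_diff power_int_of_nat power2_eq_square)
      moreover have "of_real ((-1) ^ m) * z ^ m * ((1 - 1 / z) / 2) ^ m = ((1 - z) / 2) ^ m"
      proof -
        have "(- 1) * z * ((1 - 1 / z) / 2) = (1 - z) / 2" using z by (simp add: field_simps)
        moreover have "of_real ((-1) ^ m) * z ^ m * ((1 - 1 / z) / 2) ^ m = ((- 1) * z * ((1 - 1 / z) / 2)) ^ m"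
          by (simp only: power_mult_distrib of_real_power of_real_minus of_real_1)
        ultimately show ?thesis by (simp only:)
      qed
      moreover have "o1 * (p * (z * y)) = o1 * (p * z) * y" "o1 * (q / z) * y = (1 / z) * (o1 * q * y)" for o1 p q y :: complex
        by simp_all
      ultimately show ?thesis by (simp only: divide_divide_eq_right mult_1 div_by_1)
    qed
    note fact = this
    have "o1 * (p * - (2 * z * y * d * e)) = - (2 * (1 / z) * y' * d * e)"
      if "o1 * (p * (z * y)) = (1 / z) * y'" for o1 p y y' d e :: complex
    proof -
      have "o1 * (p * - (2 * z * y * d * e)) = - (2 * (o1 * (p * (z * y))) * d * e)" by simp
      then show ?thesis unfolding that by simp
    qed
    from this[OF fact] show "of_real ((-1) ^ m) * (z powi (int m - 2) * symbol_W z) = symbol_W (1 / z)"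
      unfolding symbol_W_def a symbol_C_reflect symbol_D_reflect .
  qed
  from fun_cong[OF laurent_on_unique[OF 1 this]] show ?thesis .
qed

end

section \<open>The dominant singularity\<close>

context spline_roots
begin

text \<open>The wavelet symbol without the factor of index m - 1 that is singular at i/s and -i/s;
  the rest is regular slightly beyond |z| = 1/s.\<close>

definition symbol_H :: "complex \<Rightarrow> complex" where
  "symbol_H z = - (2 * z * ((1 - 1 / z) / 2) ^ m * (symbol_D (- z) * symbol_C z) * (of_real (1 / sqrt c) *
     ((\<Prod>k\<in>{1..<m}. (1 + of_real (t k) * (1 / z\<^sup>2)) powr of_real (-1/2)) *
      (\<Prod>k\<in>{1..<m-1}. (1 + of_real (t k) * z\<^sup>2) powr of_real (-1/2)))))"

lemma symbol_W_factor: "symbol_W z = symbol_H z * (1 + of_real (s\<^sup>2) * z\<^sup>2) powr of_real (-1/2)"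
proof -
  have "{1..<m} = insert (m - 1) {1..<m-1}" using m by auto
  then have "(\<Prod>k\<in>{1..<m}. (1 + of_real (t k) * z\<^sup>2) powr of_real (-1/2)) =
     (1 + of_real (s\<^sup>2) * z\<^sup>2) powr of_real (-1/2) * (\<Prod>k\<in>{1..<m-1}. (1 + of_real (t k) * z\<^sup>2) powr of_real (-1/2))"
    unfolding s_bounds(3) by (subst (1) \<open>{1..<m} = _\<close>) (rule prod.insert, auto)
  then have "symbol_C (z\<^sup>2) = of_real (1 / sqrt c) * ((\<Prod>k\<in>{1..<m}. (1 + of_real (t k) * (1 / z\<^sup>2)) powr of_real (-1/2)) *
      (\<Prod>k\<in>{1..<m-1}. (1 + of_real (t k) * z\<^sup>2) powr of_real (-1/2))) * (1 + of_real (s\<^sup>2) * z\<^sup>2) powr of_real (-1/2)"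
    unfolding symbol_C_def symbol_power_def prod.distrib by (simp only: mult_ac)
  moreover have "- (x * (q * f)) = - (x * q) * f" for x q f :: complex by simp
  ultimately show ?thesis unfolding symbol_W_def symbol_H_def by (simp only:)
qed

text \<open>Beyond 1/s the next obstacles are at 1/s^2, from C(z) and D(-z), and at 1/sqrt(t_k) with
  k < m - 1, from C(z^2). All are strictly farther away.\<close>

lemma outer_radius:
  obtains \<rho> where "1 / s < \<rho>" "s\<^sup>2 * \<rho> < 1" "\<And>k. k \<in> {1..<m-1} \<Longrightarrow> t k * \<rho>\<^sup>2 < 1"
proof -
  \<comment> \<open>The element s^4 encodes the condition at 1/s^2 and keeps the set nonempty when m
    = 2.\<close>
  define T where "T = insert (s ^ 4) (t ` {1..<m-1})"
  have fin: "finite T" "T \<noteq> {}" by (auto simp: T_def)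
  have "s ^ 4 < s\<^sup>2" using s_bounds by (intro power_strict_decreasing) auto
  then have "Max T < s\<^sup>2" using fin t_less s_bounds(3) by (auto simp: T_def)
  then obtain x where x: "Max T < x" "x < s\<^sup>2" using dense by blast
  have s4: "s ^ 4 < x" using x(1) fin by (auto simp: T_def)
  then have x0: "x > 0" using s_bounds(1) by (smt (verit) zero_less_power)
  have tx: "t k < x" if "k \<in> {1..<m-1}" for k
  proof -
    have "t k \<in> T" using that by (auto simp: T_def)
    then show ?thesis using Max_ge[OF fin(1)] x(1) by (meson le_less_trans)
  qed
  show ?thesis
  proof (rule that[of "1 / sqrt x"])
    have "sqrt x < sqrt (s\<^sup>2)" by (rule real_sqrt_less_mono[OF x(2)])
    then have "sqrt x < s" using s_bounds(1) by simp
    then show "1 / s < 1 / sqrt x" using x0 s_bounds(1) by (intro divide_strict_left_mono) auto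
    have "sqrt (s ^ 4) = s\<^sup>2" by (rule real_sqrt_unique) (auto simp flip: power_mult)
    then have "s\<^sup>2 < sqrt x" using real_sqrt_less_mono[OF s4] by simp
    then show "s\<^sup>2 * (1 / sqrt x) < 1" using x0 by simp
    show "t k * (1 / sqrt x)\<^sup>2 < 1" if "k \<in> {1..<m-1}" for k
      using tx[OF that] x0 by (simp add: power_divide)
  qed
qed

lemma has_laurent_symbol_H:
  assumes rho: "s\<^sup>2 * \<rho> < 1" "\<And>k. k \<in> {1..<m-1} \<Longrightarrow> t k * \<rho>\<^sup>2 < 1"
  shows "has_laurent symbol_H {z. 1 \<le> norm z \<and> norm z \<le> \<rho>}"
proof -
  define R where "R = {z :: complex. 1 \<le> norm z \<and> norm z \<le> \<rho>}"
  have R0: "0 \<notin> R" by (simp add: R_def)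
  have s2: "s\<^sup>2 < 1" using s_bounds t_bounds[OF m1] by simp
  have b: "s\<^sup>2 < norm z \<and> s\<^sup>2 * norm z < 1" if "z \<in> R" for z
  proof -
    have "s\<^sup>2 * norm z \<le> s\<^sup>2 * \<rho>" using that by (intro mult_left_mono) (auto simp: R_def)
    then show ?thesis using that rho(1) s2 by (auto simp: R_def)
  qed
  have lin: "has_laurent (\<lambda>z. 1 / 2 + (-1/2) * (1 / z)) R"
    using has_laurent_reflect[OF has_laurent_linear[of "1/2" "-1/2" UNIV], of R] by simp
  have D: "has_laurent (\<lambda>z. symbol_D (- z)) R"
    by (rule has_laurent_neg[OF has_laurent_symbol_D[OF b R0]]) (auto simp: R_def)
  have C: "has_laurent symbol_C R" by (rule has_laurent_symbol_C[OF b R0])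
  have P1: "has_laurent (\<lambda>z. (1 + of_real (t k) * (1 / z\<^sup>2)) powr of_real (-1/2)) R" if k: "k \<in> {1..<m}" for k
  proof -
    have "has_laurent (\<lambda>z. (1 + of_real (t k) * z) powr of_real (-1/2)) {z. norm z \<le> 1}"
    proof (rule has_laurent_binomial)
      fix z :: complex assume "z \<in> {z. norm z \<le> 1}"
      then have "t k * norm z \<le> t k * 1" using t_bounds[OF k] by (intro mult_left_mono) auto
      then have "t k * norm z < 1" using t_bounds[OF k] by linarith
      then show "norm (of_real (t k) * z) < 1" using t_bounds[OF k] by (simp add: norm_mult)
    qed
    then have "has_laurent (\<lambda>z. (1 + of_real (t k) * (1 / z)) powr of_real (-1/2)) {z. 1 \<le> norm z}"
      by (rule has_laurent_reflect) (auto simp: norm_divide divide_simps)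
    then show ?thesis
      by (rule has_laurent_square) (auto simp: R_def norm_power one_le_power)
  qed
  have P2: "has_laurent (\<lambda>z. (1 + of_real (t k) * z\<^sup>2) powr of_real (-1/2)) R" if k: "k \<in> {1..<m-1}" for k
  proof -
    have k': "k \<in> {1..<m}" using k by auto
    have "has_laurent (\<lambda>z. (1 + of_real (t k) * z) powr of_real (-1/2)) {z. norm z \<le> \<rho>\<^sup>2}"
    proof (rule has_laurent_binomial)
      fix z :: complex assume "z \<in> {z. norm z \<le> \<rho>\<^sup>2}"
      then have "t k * norm z \<le> t k * \<rho>\<^sup>2" using t_bounds[OF k'] by (intro mult_left_mono) auto
      then have "t k * norm z < 1" using rho(2)[OF k] by linarith
      then show "norm (of_real (t k) * z) < 1" using t_bounds[OF k'] by (simp add: norm_mult)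
    qed
    then show ?thesis
      by (rule has_laurent_square) (auto simp: R_def norm_power power_mono)
  qed
  have "has_laurent (\<lambda>z. (of_real (-2) * z powi 1) * (1 / 2 + (-1/2) * (1 / z)) ^ m * (symbol_D (- z) * symbol_C z) * (of_real (1 / sqrt c) *
     ((\<Prod>k\<in>{1..<m}. (1 + of_real (t k) * (1 / z\<^sup>2)) powr of_real (-1/2)) *
      (\<Prod>k\<in>{1..<m-1}. (1 + of_real (t k) * z\<^sup>2) powr of_real (-1/2))))) R"
    by (intro has_laurent_mult[OF _ _ R0] has_laurent_zmonom has_laurent_power[OF lin R0] D C has_laurent_const
          has_laurent_prod[OF _ R0] P1 P2) auto
  then have "has_laurent symbol_H R"
  proof (rule has_laurent_cong)
    fix z :: complex
    have h: "1 / 2 + (-1/2) * (1 / z) = (1 - 1 / z) / 2" by (simp add: diff_divide_distrib)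
    show "(of_real (-2) * z powi 1) * (1 / 2 + (-1/2) * (1 / z)) ^ m * (symbol_D (- z) * symbol_C z) * (of_real (1 / sqrt c) *
     ((\<Prod>k\<in>{1..<m}. (1 + of_real (t k) * (1 / z\<^sup>2)) powr of_real (-1/2)) *
      (\<Prod>k\<in>{1..<m-1}. (1 + of_real (t k) * z\<^sup>2) powr of_real (-1/2)))) = symbol_H z"
      unfolding symbol_H_def h by simp
  qed
  then show ?thesis by (simp add: R_def)
qed

text \<open>All moduli are collected in K. The factor -2z contributes -i, the power of 1 - 1/z = 1 +
  is contributes m arctan s, and D(-z) C(z) contributes the negative of \<open>phase_sum s\<close>.
  The other factors depend on z^2 = -1/s^2 and are positive.\<close>

lemma symbol_H_singular_point:
  "\<exists>K>0. symbol_H (\<i> / of_real s) = of_real K * (- \<i> * cis (real m * arctan s - phase_sum s))"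
proof -
  define z where "z = \<i> / complex_of_real s"
  have s0: "s > 0" "complex_of_real s \<noteq> 0" using s_bounds by auto
  have z1: "1 / z = - (\<i> * of_real s)" using s0 by (simp add: z_def field_simps)
  have z2: "z\<^sup>2 = of_real (- 1 / s\<^sup>2)" by (simp add: z_def power_divide)
  have z2': "1 / z\<^sup>2 = of_real (- (s\<^sup>2))" unfolding z2 using s0 by simp
  have lin: "((1 - 1 / z) / 2) ^ m = of_real ((sqrt (1 + s\<^sup>2) / 2) ^ m) * cis (real m * arctan s)"
  proof -
    have "(1 - 1 / z) / 2 = of_real (sqrt (1 + s\<^sup>2) / 2) * cis (arctan s)"
      unfolding z1 using one_plus_i_polar[of s] by simp
    then have "((1 - 1 / z) / 2) ^ m = of_real (sqrt (1 + s\<^sup>2) / 2) ^ m * cis (arctan s) ^ m"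
      by (simp only: power_mult_distrib)
    then show ?thesis by (simp only: Complex.DeMoivre of_real_power)
  qed
  have DC: "symbol_D (- z) * symbol_C z = cis (- phase_sum s)"
  proof -
    have "symbol_D (- z) * symbol_C z = (of_real (sqrt c) * of_real (1 / sqrt c)) * (symbol_power (1/2) (- z) * symbol_power (-1/2) z)"
      unfolding symbol_D_def symbol_C_def by (simp only: mult_ac)
    also have "of_real (sqrt c) * of_real (1 / sqrt c) = (1 :: complex)" using c_pos by (simp flip: of_real_mult)
    also have "symbol_power (1/2) (- z) * symbol_power (-1/2) z = (\<Prod>k\<in>{1..<m}. cis (arctan (t k * s) - arctan (t k / s)))"
      unfolding symbol_power_def prod.distrib[symmetric]
    proof (rule prod.cong[OF refl])
      fix k
      have e1: "1 + of_real (t k) * (1 / - z) = 1 + \<i> * of_real (t k * s)"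
        using z1 by (simp add: minus_divide_right[symmetric])
      have e2: "1 + of_real (t k) * - z = 1 - \<i> * of_real (t k / s)" by (simp add: z_def)
      have e3: "1 + of_real (t k) * (1 / z) = 1 - \<i> * of_real (t k * s)" unfolding z1 by simp
      have e4: "1 + of_real (t k) * z = 1 + \<i> * of_real (t k / s)" by (simp add: z_def)
      have r: "a * b * (c' * d) = (a * c') * (b * d)" for a b c' d :: complex by simp
      have q2: "(1 - \<i> * of_real x) powr (1/2) * (1 + \<i> * of_real x) powr (-1/2) = cis (- arctan x)" for x
        using powr_half_quotient[of "- x"] by (simp add: arctan_minus)
      have h: "complex_of_real (1/2) = 1/2" "complex_of_real (-1/2) = -1/2" by simp_all
      show "(1 + of_real (t k) * (1 / - z)) powr of_real (1/2) * (1 + of_real (t k) * - z) powr of_real (1/2) *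
         ((1 + of_real (t k) * (1 / z)) powr of_real (-1/2) * (1 + of_real (t k) * z) powr of_real (-1/2)) =
         cis (arctan (t k * s) - arctan (t k / s))"
        unfolding e1 e2 e3 e4 h
        by (rule trans[OF r]) (simp only: powr_half_quotient q2 cis_mult, simp)
    qed
    also have "\<dots> = cis (\<Sum>k\<in>{1..<m}. arctan (t k * s) - arctan (t k / s))"
    proof -
      have "(\<Prod>k\<in>K. cis (f k)) = cis (\<Sum>k\<in>K. f k)" if "finite K" for K :: "nat set" and f
        using that by (induction K rule: finite_induct) (simp_all add: cis_mult)
      then show ?thesis by simp
    qed
    also have "(\<Sum>k\<in>{1..<m}. arctan (t k * s) - arctan (t k / s)) = - phase_sum s"
      unfolding phase_sum_def sum_negf[symmetric] by simp
    finally show ?thesis by simp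
  qed
  define b1 where "b1 = (\<Prod>k\<in>{1..<m}. (1 - t k * s\<^sup>2) powr (-1/2))"
  define b2 where "b2 = (\<Prod>k\<in>{1..<m-1}. (1 - t k / s\<^sup>2) powr (-1/2))"
  have P1: "(\<Prod>k\<in>{1..<m}. (1 + of_real (t k) * (1 / z\<^sup>2)) powr of_real (-1/2)) = of_real b1" and b1: "b1 > 0"
  proof -
    have pos: "1 - t k * s\<^sup>2 > 0" if k: "k \<in> {1..<m}" for k
    proof -
      have "t k * s\<^sup>2 < 1 * 1" using t_bounds[OF k] t_bounds[OF m1] s_bounds(3) by (intro mult_strict_mono) auto
      then show ?thesis by simp
    qed
    show "b1 > 0" unfolding b1_def
    proof (rule prod_pos)
      fix k assume "k \<in> {1..<m}"
      from pos[OF this, THEN less_imp_neq] show "0 < (1 - t k * s\<^sup>2) powr (-1/2)" unfolding powr_gt_zero by (rule not_sym)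
    qed
    show "(\<Prod>k\<in>{1..<m}. (1 + of_real (t k) * (1 / z\<^sup>2)) powr of_real (-1/2)) = of_real b1"
      unfolding b1_def of_real_prod
    proof (rule prod.cong[OF refl])
      fix k assume k: "k \<in> {1..<m}"
      have "1 + of_real (t k) * (1 / z\<^sup>2) = complex_of_real (1 - t k * s\<^sup>2)" unfolding z2' by simp
      then show "(1 + of_real (t k) * (1 / z\<^sup>2)) powr of_real (-1/2) = of_real ((1 - t k * s\<^sup>2) powr (-1/2))"
        by (simp only: powr_of_real[OF less_imp_le[OF pos[OF k]]])
    qed
  qed
  have P2: "(\<Prod>k\<in>{1..<m-1}. (1 + of_real (t k) * z\<^sup>2) powr of_real (-1/2)) = of_real b2" and b2: "b2 > 0"
  proof -
    \<comment> \<open>Strict maximality of t_{m-1} is needed here; the factor of index m - 1 would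
      be 0 and has been split off.\<close>
    have pos: "1 - t k / s\<^sup>2 > 0" if k: "k \<in> {1..<m-1}" for k
    proof -
      have "t k < s\<^sup>2" using t_less[OF k] s_bounds(3) by simp
      moreover have "0 < s\<^sup>2" using s0(1) by (rule zero_less_power)
      ultimately show ?thesis by (simp only: diff_gt_0_iff_gt divide_less_eq_1_pos)
    qed
    show "b2 > 0" unfolding b2_def
    proof (rule prod_pos)
      fix k assume "k \<in> {1..<m-1}"
      from pos[OF this, THEN less_imp_neq] show "0 < (1 - t k / s\<^sup>2) powr (-1/2)" unfolding powr_gt_zero by (rule not_sym)
    qed
    show "(\<Prod>k\<in>{1..<m-1}. (1 + of_real (t k) * z\<^sup>2) powr of_real (-1/2)) = of_real b2"
      unfolding b2_def of_real_prod
    proof (rule prod.cong[OF refl])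
      fix k assume k: "k \<in> {1..<m-1}"
      have "1 + of_real (t k) * z\<^sup>2 = complex_of_real (1 - t k / s\<^sup>2)" unfolding z2 by simp
      then show "(1 + of_real (t k) * z\<^sup>2) powr of_real (-1/2) = of_real ((1 - t k / s\<^sup>2) powr (-1/2))"
        by (simp only: powr_of_real[OF less_imp_le[OF pos[OF k]]])
    qed
  qed
  define K where "K = 2 / s * (sqrt (1 + s\<^sup>2) / 2) ^ m * (1 / sqrt c) * b1 * b2"
  have "K > 0" unfolding K_def using s0 c_pos b1 b2
    by (intro mult_pos_pos zero_less_power divide_pos_pos) (auto simp: add_pos_nonneg)
  moreover have "symbol_H z = of_real K * (- \<i> * (cis (real m * arctan s) * cis (- phase_sum s)))"
    unfolding symbol_H_def lin DC P1 P2 K_def by (simp add: z_def)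
  ultimately show ?thesis unfolding z_def cis_mult by auto
qed

text \<open>Real and imaginary part of -i cis(x) are sin x and -cos x, so the two parities need
  exactly the two assertions of \<open>wavelet_phase\<close>.\<close>

lemma wavelet_coeff_asymptotic_pos:
  assumes "p = 0 \<or> p = (1 :: int)"
  shows "\<exists>L. L \<noteq> 0 \<and> (\<lambda>r. wavelet_coeff (2 * int r + p) * (-1) ^ r * sqrt (real r) / s ^ (2 * r)) \<longlonglongrightarrow> L"
proof -
  obtain \<rho> where rho: "1 / s < \<rho>" "s\<^sup>2 * \<rho> < 1" "\<And>k. k \<in> {1..<m-1} \<Longrightarrow> t k * \<rho>\<^sup>2 < 1"
    using outer_radius by blast
  obtain h where h: "laurent_on h symbol_H {z. 1 \<le> norm z \<and> norm z \<le> \<rho>}"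
    using has_laurent_symbol_H[OF rho(2,3)] unfolding has_laurent_def by blast
  have w: "laurent_on wavelet_coeff (\<lambda>z. symbol_H z * (1 + of_real (s\<^sup>2) * z\<^sup>2) powr of_real (-1/2)) (sphere 0 1)"
    by (rule laurent_on_cong[OF laurent_wavelet_coeff symbol_W_factor])
  note lim = laurent_coeff_asymptotic[OF s_bounds(1,2) rho(1) h w assms]
  obtain K where K: "K > 0" "symbol_H (\<i> / of_real s) = of_real K * (- \<i> * cis (real m * arctan s - phase_sum s))"
    using symbol_H_singular_point by blast
  have "(if p = 0 then Re (symbol_H (\<i> / of_real s)) else s * Im (symbol_H (\<i> / of_real s))) / sqrt pi \<noteq> 0"
    unfolding K(2) using K(1) wavelet_phase s_bounds(1) by simp
  then show ?thesis using lim by blast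
qed

end

section \<open>The asymptotic form\<close>

text \<open>With x = |l| = y^2 both square roots are rational: mu and mu + 1 are the squares of
  (1-x)/(2y) and (1+x)/(2y), and the quotient inside the logarithm collapses to 1/x.\<close>

lemma exp_minus_decay_alpha:
  assumes "-1 < l" "l < 0"
  shows "exp (- decay_alpha l) = - l"
proof -
  define x where "x = - l"
  have x: "0 < x" "x < 1" "l = - x" using assms by (auto simp: x_def)
  define y where "y = sqrt x"
  have y: "y > 0" "x = y\<^sup>2" using x by (auto simp: y_def)
  have "root_mu l = ((1 - x) / (2 * y))\<^sup>2"
    using y(1) by (simp add: root_mu_def x(3) y(2) power_divide power_mult_distrib)
  moreover have "root_mu l + 1 = ((1 + x) / (2 * y))\<^sup>2"
    using y(1) by (simp add: root_mu_def x(3) y(2) field_simps power2_eq_square)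
  ultimately have r: "sqrt (root_mu l) = (1 - x) / (2 * y)" "sqrt (root_mu l + 1) = (1 + x) / (2 * y)"
    using x y by (simp_all del: real_sqrt_pow2_iff)
  have "(sqrt (root_mu l + 1) + sqrt (root_mu l)) / (sqrt (root_mu l + 1) - sqrt (root_mu l)) = 1 / x"
    unfolding r diff_divide_distrib[symmetric] add_divide_distrib[symmetric] using y(1) x(1) by simp
  then have "decay_alpha l = - ln x" using x by (simp add: decay_alpha_def ln_div)
  then show ?thesis using x by simp
qed

lemma half_index_eq: "half_index j = nat (\<bar>j\<bar> div 2)"
  using floor_divide_of_int_eq[of "\<bar>j\<bar>" 2, where 'a=real] by (simp add: half_index_def)

context spline_roots
begin

lemma wavelet_coeff_asymptotic_neg:
  assumes p: "p = 0 \<or> p = (1 :: int)"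
  shows "\<exists>L. L \<noteq> 0 \<and> (\<lambda>r. wavelet_coeff (- (2 * int r + p)) * (-1) ^ r * sqrt (real r) / s ^ (2 * r)) \<longlonglongrightarrow> L"
proof -
  \<comment> \<open>Reflection turns the index 2r + p into 2r + p - (m - 2) = 2(r + d) + p', so the
    parity class may change and r is shifted by a constant.\<close>
  define d where "d = (p - (int m - 2)) div 2"
  define p' where "p' = (p - (int m - 2)) mod 2"
  have p': "p' = 0 \<or> p' = 1" unfolding p'_def by auto
  have dp: "p - (int m - 2) = 2 * d + p'" by (simp add: d_def p'_def)
  define f where "f = (\<lambda>r. wavelet_coeff (2 * int r + p') * (-1) ^ r * sqrt (real r) / s ^ (2 * r))"
  obtain L where L: "L \<noteq> 0" "f \<longlonglongrightarrow> L" using wavelet_coeff_asymptotic_pos[OF p'] f_def by blast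
  have "filterlim (\<lambda>r. nat (int r + d)) sequentially sequentially"
    unfolding filterlim_at_top
  proof
    fix Z show "\<forall>\<^sub>F r in sequentially. Z \<le> nat (int r + d)"
      using eventually_ge_at_top[of "nat (int Z - d)"] by eventually_elim linarith
  qed
  from filterlim_compose[OF L(2) this] have 1: "(\<lambda>r. f (nat (int r + d))) \<longlonglongrightarrow> L" .
  have "(\<lambda>r. real r / (real r + of_int d)) \<longlonglongrightarrow> 1" by real_asymp
  then have 2: "(\<lambda>r. sqrt (real r / (real r + of_int d))) \<longlonglongrightarrow> sqrt 1" by (rule tendsto_real_sqrt)
  \<comment> \<open>The sign (-1)^m comes from the reflection; the other factors compensate for
    normalising at r + d instead of r.\<close>
  define C where "C = (-1) ^ m * (-1) powi d * s powi (2 * d)"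
  have C: "C \<noteq> 0" using s_bounds by (simp add: C_def)
  have "(\<lambda>r. C * (f (nat (int r + d)) * sqrt (real r / (real r + of_int d)))) \<longlonglongrightarrow> C * (L * sqrt 1)"
    by (intro tendsto_intros 1 2)
  then have "(\<lambda>r. wavelet_coeff (- (2 * int r + p)) * (-1) ^ r * sqrt (real r) / s ^ (2 * r)) \<longlonglongrightarrow> C * (L * sqrt 1)"
  proof (rule Lim_transform_eventually)
    show "\<forall>\<^sub>F r in sequentially. C * (f (nat (int r + d)) * sqrt (real r / (real r + of_int d))) =
       wavelet_coeff (- (2 * int r + p)) * (-1) ^ r * sqrt (real r) / s ^ (2 * r)"
      using eventually_gt_at_top[of "nat \<bar>d\<bar>"]
    proof eventually_elim
      case (elim r)
      define n where "n = nat (int r + d)"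
      have n: "int n = int r + d" using elim by (simp add: n_def)
      then have n0: "real n > 0" "real r + of_int d = real n" using elim by linarith+
      have "2 * int r + p - (int m - 2) = 2 * int n + p'" using dp n by linarith
      then have w: "wavelet_coeff (- (2 * int r + p)) = (-1) ^ m * wavelet_coeff (2 * int n + p')"
        unfolding wavelet_coeff_reflect by (simp only:)
      have d: "d = int n - int r" using n by simp
      have e1: "(-1) powi d * (-1) ^ n = ((-1) ^ r :: real)"
      proof -
        have "((-1) powi d :: real) = (-1) powi int n / (-1) powi int r" unfolding d by (rule power_int_diff) simp
        also have "\<dots> = (-1) ^ n * (-1) ^ r" by (simp add: power_int_of_nat divide_simps flip: power_mult_distrib)
        also have "(-1) ^ n * (-1) ^ r * (-1) ^ n = ((-1) ^ r :: real)" by (simp add: mult.commute mult.left_commute)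
        finally show ?thesis by (simp only: mult.commute)
      qed
      have e2: "s powi (2 * d) / s ^ (2 * n) = 1 / s ^ (2 * r)"
      proof -
        have "2 * d = int (2 * n) - int (2 * r)" by (simp add: d)
        then have "s powi (2 * d) = s powi int (2 * n) / s powi int (2 * r)"
          using s_bounds(1) by (simp only:) (rule power_int_diff, simp)
        then show ?thesis using s_bounds(1) by (simp only: power_int_of_nat) simp
      qed
      have e3: "sqrt (real n) * sqrt (real r / (real r + of_int d)) = sqrt (real r)"
        unfolding n0(2) using n0(1) by (simp flip: real_sqrt_mult)
      have "C * (f n * sqrt (real r / (real r + of_int d))) =
        (-1) ^ m * wavelet_coeff (2 * int n + p') * ((-1) powi d * (-1) ^ n) * (sqrt (real n) * sqrt (real r / (real r + of_int d))) * (s powi (2 * d) / s ^ (2 * n))"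
        unfolding C_def f_def by simp
      also have "\<dots> = wavelet_coeff (- (2 * int r + p)) * (-1) ^ r * sqrt (real r) / s ^ (2 * r)"
        unfolding e1 e2 e3 w by simp
      finally show ?case by (simp only: n_def)
    qed
  qed
  moreover have "C * (L * sqrt 1) \<noteq> 0" using C L by simp
  ultimately show ?thesis by blast
qed

text \<open>At half-index 0 the division by sqrt 0 makes this 0, so quotients by it are meaningful
  only from half-index 1 on.\<close>

definition leading_term :: "int \<Rightarrow> real" where
  "leading_term j = (-1) ^ half_index j * (s ^ (2 * half_index j) / sqrt (real (half_index j)))"

text \<open>There are four limits, one for each sign and parity, and \<open>E\<close> selects among
  them. As they are nonzero, convergence can be stated as a relative error with a single threshold
  in the half-index.\<close>

lemma wavelet_coeff_asymptotic:
  obtains E where "\<And>i j. sgn i = sgn j \<Longrightarrow> even i = even j \<Longrightarrow> E i = E j" "\<And>j. E j \<noteq> 0"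
    "\<And>e. e > 0 \<Longrightarrow> \<exists>N. \<forall>j. half_index j \<ge> N \<longrightarrow> \<bar>wavelet_coeff j / (E j * leading_term j) - 1\<bar> < e"
proof -
  define F where "F \<sigma> p r = wavelet_coeff (\<sigma> * (2 * int r + p)) * (-1) ^ r * sqrt (real r) / s ^ (2 * r)" for \<sigma> p r
  have "\<exists>L. L \<noteq> 0 \<and> F \<sigma> p \<longlonglongrightarrow> L" if "\<sigma> = 1 \<or> \<sigma> = -1" "p = 0 \<or> p = 1" for \<sigma> p
    using wavelet_coeff_asymptotic_pos[OF that(2)] wavelet_coeff_asymptotic_neg[OF that(2)] that(1)
    unfolding F_def[abs_def] by auto
  then obtain L where L: "\<And>\<sigma> p. \<sigma> = 1 \<or> \<sigma> = -1 \<Longrightarrow> p = 0 \<or> p = 1 \<Longrightarrow> L \<sigma> p \<noteq> 0 \<and> F \<sigma> p \<longlonglongrightarrow> L \<sigma> p"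
    by metis
  \<comment> \<open>Index 0 is counted as positive, so that sign, half-index and residue recover
    every j.\<close>
  define sg where "sg j = (if j < 0 then -1 else 1 :: int)" for j :: int
  define E where "E j = L (sg j) (j mod 2)" for j
  have sg: "sg j = 1 \<or> sg j = -1" for j by (simp add: sg_def)
  have md: "j mod 2 = 0 \<or> j mod 2 = 1" for j :: int by auto
  have j_eq: "j = sg j * (2 * int (half_index j) + j mod 2)" for j
  proof (cases "j < 0")
    case True
    have "int (half_index j) = (- j) div 2" using True by (simp add: half_index_eq)
    then show ?thesis using True by (simp add: sg_def) presburger
  next
    case False
    then show ?thesis by (simp add: sg_def half_index_eq)
  qed
  show ?thesis
  proof (rule that[of E])
    show "E i = E j" if "sgn i = sgn j" "even i = even j" for i j
    proof -
      have "sg i = sg j" using that(1) by (auto simp: sg_def sgn_if split: if_splits)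
      moreover have "i mod 2 = j mod 2" using that(2) by presburger
      ultimately show ?thesis by (simp add: E_def)
    qed
    show E0: "E j \<noteq> 0" for j unfolding E_def using L[OF sg md] by blast
    fix e :: real assume e: "e > 0"
    have "\<exists>N. \<forall>r\<ge>N. \<bar>F \<sigma> p r / L \<sigma> p - 1\<bar> < e" if "\<sigma> = 1 \<or> \<sigma> = -1" "p = 0 \<or> p = 1" for \<sigma> p
    proof -
      have "(\<lambda>r. F \<sigma> p r / L \<sigma> p) \<longlonglongrightarrow> L \<sigma> p / L \<sigma> p"
        using L[OF that] by (intro tendsto_divide tendsto_const) auto
      then have "(\<lambda>r. F \<sigma> p r / L \<sigma> p) \<longlonglongrightarrow> 1" using L[OF that] by simp
      from LIMSEQ_D[OF this e] show ?thesis by simp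
    qed
    then obtain N where N: "\<And>\<sigma> p r. \<sigma> = 1 \<or> \<sigma> = -1 \<Longrightarrow> p = 0 \<or> p = 1 \<Longrightarrow> r \<ge> N \<sigma> p \<Longrightarrow> \<bar>F \<sigma> p r / L \<sigma> p - 1\<bar> < e"
      by metis
    \<comment> \<open>The sum of four natural thresholds dominates each of them.\<close>
    define N0 where "N0 = N 1 0 + N 1 1 + N (-1) 0 + N (-1) 1"
    have "\<bar>wavelet_coeff j / (E j * leading_term j) - 1\<bar> < e" if "half_index j \<ge> N0" for j
    proof -
      define r where "r = half_index j"
      have "N (sg j) (j mod 2) \<le> N0" using sg[of j] md[of j] by (auto simp: N0_def)
      then have "\<bar>F (sg j) (j mod 2) r / L (sg j) (j mod 2) - 1\<bar> < e"
        using N[OF sg md, of j j r] that by (simp add: r_def)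
      moreover have "F (sg j) (j mod 2) r / L (sg j) (j mod 2) = wavelet_coeff j / (E j * leading_term j)"
      proof -
        have w: "wavelet_coeff (sg j * (2 * int r + j mod 2)) = wavelet_coeff j"
          unfolding r_def by (rule arg_cong[OF j_eq[symmetric]])
        have "x * u * q / y / l = x / (l * (u * (y / q)))" if "u * u = 1" for x u q y l :: real
        proof -
          have "u \<noteq> 0" using that by auto
          then have "u = 1 / u" using that by (simp add: eq_divide_eq)
          then have "x * u * q / y / l = x * (1 / u) * q / y / l" by (rule arg_cong)
          then show ?thesis by simp
        qed
        from this[of "(-1) ^ r"] show ?thesis
          unfolding F_def w E_def leading_term_def r_def[symmetric] by simp
      qed
      ultimately show ?thesis by simp
    qed
    then show "\<exists>N. \<forall>j. half_index j \<ge> N \<longrightarrow> \<bar>wavelet_coeff j / (E j * leading_term j) - 1\<bar> < e" by blast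
  qed
qed

end

text \<open>The argument 2x reflects the dilation in \<open>wavelet_spline\<close>. The error factor
  is attached to the single terms because these have different signs: relative errors of the terms
  do not yield one of the sum, which may cancel.\<close>

theorem theoremA:
  fixes m :: nat and lam :: "nat \<Rightarrow> real" and \<alpha>\<^sub>0 :: real
  assumes "m \<ge> 2"
    and "euler_frobenius_roots m lam"
    and "\<alpha>\<^sub>0 = decay_alpha (lam (m - 1))"
  shows "\<exists>E :: int \<Rightarrow> real.
    (\<forall>i j. sgn i = sgn j \<and> (even i \<longleftrightarrow> even j) \<longrightarrow> E i = E j) \<and>
    (\<exists>\<epsilon> :: real \<Rightarrow> int \<Rightarrow> real.
      uniform_limit UNIV \<epsilon> (\<lambda>_. 0) at_infinity \<and>
      (\<forall>\<^sub>F x in at_infinity.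
        wavelet m x =
          (\<Sum>j \<in> {j. 2 * x - real m \<le> of_int j \<and> of_int j \<le> 2 * x}.
             (- 1) ^ half_index j * E j *
             (exp (- \<alpha>\<^sub>0 * real (half_index j)) / sqrt (real (half_index j))) *
             bspline m (2 * x - of_int j) * (1 + \<epsilon> x j))))"
proof -
  obtain c where "spline_roots m (\<lambda>k. - lam k) c"
    using euler_frobenius_roots_imp[OF assms(1,2)] by blast
  then interpret spline_roots m "\<lambda>k. - lam k" c .
  have l: "-1 < lam (m - 1)" "lam (m - 1) < 0" "s\<^sup>2 = - lam (m - 1)"
    using t_bounds[OF m1] s_bounds(3) by auto
  have exp_eq: "exp (- \<alpha>\<^sub>0 * real r) = s ^ (2 * r)" for r
  proof -
    have "exp (- \<alpha>\<^sub>0 * real r) = exp (- \<alpha>\<^sub>0) ^ r" by (metis exp_of_nat2_mult)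
    also have "exp (- \<alpha>\<^sub>0) = s\<^sup>2" unfolding assms(3) exp_minus_decay_alpha[OF l(1,2)] l(3) ..
    finally show ?thesis by (simp only: power_mult)
  qed
  obtain E where E: "\<And>i j. sgn i = sgn j \<Longrightarrow> even i = even j \<Longrightarrow> E i = E j" "\<And>j. E j \<noteq> 0"
    "\<And>e. e > 0 \<Longrightarrow> \<exists>N. \<forall>j. half_index j \<ge> N \<longrightarrow> \<bar>wavelet_coeff j / (E j * leading_term j) - 1\<bar> < e"
    using wavelet_coeff_asymptotic by blast
  \<comment> \<open>Uniformity over all j forces the error to be 0 off the support window, since at
    a fixed j the relative error does not change with x.\<close>
  define \<epsilon> where "\<epsilon> x j = (if j \<in> supp_ivl m (2 * x) then wavelet_coeff j / (E j * leading_term j) - 1 else 0)"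
    for x :: real and j :: int
  let ?term = "\<lambda>x j. (- 1) ^ half_index j * E j *
    (exp (- \<alpha>\<^sub>0 * real (half_index j)) / sqrt (real (half_index j))) *
    bspline m (2 * x - of_int j) * (1 + \<epsilon> x j)"
  have far: "half_index j \<ge> N" if "real N + real m + 1 \<le> norm x" "j \<in> supp_ivl m (2 * x)" for N x j
  proof -
    have "2 * x - real m \<le> of_int j" "of_int j \<le> 2 * x" using that by (auto simp: supp_ivl_def)
    then have "real_of_int \<bar>j\<bar> \<ge> 2 * \<bar>x\<bar> - real m" by linarith
    then have "real_of_int \<bar>j\<bar> \<ge> 2 * real N" using that(1) by simp
    then have "\<bar>j\<bar> \<ge> 2 * int N" by linarith
    then show ?thesis by (simp add: half_index_eq)
  qed
  have "uniform_limit UNIV \<epsilon> (\<lambda>_. 0) at_infinity"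
  proof (rule uniform_limitI)
    fix e :: real assume "e > 0"
    then obtain N where N: "\<And>j. half_index j \<ge> N \<Longrightarrow> \<bar>wavelet_coeff j / (E j * leading_term j) - 1\<bar> < e"
      using E(3) by blast
    have "dist (\<epsilon> x j) 0 < e" if "real N + real m + 1 \<le> norm x" for x j
      using N[OF far[OF that]] \<open>e > 0\<close> by (simp add: \<epsilon>_def)
    then show "\<forall>\<^sub>F x in at_infinity. \<forall>j\<in>UNIV. dist (\<epsilon> x j) 0 < e"
      unfolding eventually_at_infinity by blast
  qed
  moreover have "\<forall>\<^sub>F x in at_infinity.
        wavelet m x =
          (\<Sum>j \<in> {j. 2 * x - real m \<le> of_int j \<and> of_int j \<le> 2 * x}.
             ?term x j)"
    unfolding eventually_at_infinity
  proof (intro exI allI impI)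
    \<comment> \<open>The threshold is that of \<open>far\<close> with N = 1: half-indices in the
      window are at least 1, which avoids the zero of \<open>leading_term\<close>.\<close>
    fix x :: real assume x: "real 1 + real m + 1 \<le> norm x"
    have "wavelet m x = (\<Sum>j\<in>supp_ivl m (2 * x). wavelet_coeff j * bspline m (2 * x - of_int j))"
      unfolding wavelet_spline spline_eq ..
    also have "\<dots> = (\<Sum>j\<in>supp_ivl m (2 * x). ?term x j)"
    proof (rule sum.cong[OF refl])
      fix j assume j: "j \<in> supp_ivl m (2 * x)"
      have "half_index j \<ge> 1" by (rule far[OF x j])
      then have "leading_term j \<noteq> 0" using s_bounds(1) by (simp add: leading_term_def)
      then have w: "wavelet_coeff j = E j * leading_term j * (1 + \<epsilon> x j)"
        using j E(2)[of j] by (simp add: \<epsilon>_def)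
      show "wavelet_coeff j * bspline m (2 * x - of_int j) = ?term x j"
        unfolding w exp_eq leading_term_def by simp
    qed
    finally show "wavelet m x =
          (\<Sum>j \<in> {j. 2 * x - real m \<le> of_int j \<and> of_int j \<le> 2 * x}.
             ?term x j)"
      by (simp only: supp_ivl_def)
  qed
  ultimately show ?thesis using E(1) by (intro exI[of _ E] conjI exI[of _ \<epsilon>]) blast+
qed

end
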